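(* Let $d\ge 1$ and suppose that $\mathbf{X}\subseteq\mathbb{K}^d$ is a nonempty closed convex semialgebraic set. Then for every $y\in\mathbb{T}_{\pm}^d$ with $y\notin\mathrm{sval}(\mathbf{X})$ there exists $\mathbf{a}=(\mathbf{a}_0,\dots,\mathbf{a}_d)\in\mathbb{K}^{d+1}$ with $(\mathbf{a}_1,\dots,\mathbf{a}_d)\neq 0$ such that $\mathbf{X}\subseteq\overline{\mathbf{H}}^+(\mathbf{a})$ and $y\notin\overline{\mathcal{H}}^+(\mathrm{sval}(\mathbf{a}))$. In particular, $\mathrm{sval}(\mathbf{X})$ is equal to the intersection of the closed tropical halfspaces that contain it.
   Context: Signed tropical numbers. Let $\mathbb{O}=-\infty$ be the tropical zero. $\mathbb{T}_{>\mathbb{O}}=\mathbb{R}$ (positive numbers), $\mathbb{T}_{<\mathbb{O}}=\{\ominus r: r\in\mathbb{R}\}$ (negative numbers), $\mathbb{T}_{\pm}=\mathbb{T}_{>\mathbb{O}}\cup\mathbb{T}_{<\mathbb{O}}\cup\{\mathbb{O}\}$, balanced numbers $\mathbb{T}_{\bullet}=\{\bullet r: r\in\mathbb{R}\}\cup\{\mathbb{O}\}$, symmetrized semiring $\mathbb{S}=\mathbb{T}_{\pm}\cup\mathbb{T}_{\bullet}$. The norm is $|r|=|\ominus r|=|\bullet r|=r$ and $|\mathbb{O}|=\mathbb{O}$; the sign $\mathrm{tsgn}$ takes values in $\{\oplus,\ominus,\bullet,\mathbb{O}\}$. Addition on $\mathbb{S}$: $x\oplus y$ equals $x$ if $|x|>|y|$,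 $y$ if $|y|>|x|$, $x$ if $|x|=|y|$ and $\mathrm{tsgn}(x)=\mathrm{tsgn}(y)$, and $\bullet|x|$ if $|x|=|y|$ and the signs differ. Multiplication: $x\odot y$ has norm $|x|+|y|$ and sign the product of signs (with $\oplus,\ominus,\bullet$ multiplying like $1,-1,0$); $\mathbb{O}$ is absorbing. The multiplicative unit is the real number $0$. Closed tropical halfspaces. For $a=(a_0,\dots,a_d)\in\mathbb{T}_{\pm}^{d+1}$ with $(a_1,\dots,a_d)\ne(\mathbb{O},\dots,\mathbb{O})$, $\overline{\mathcal{H}}^+(a)=\{x\in\mathbb{T}_{\pm}^d: a_0\oplus a_1\odot x_1\oplus\dots\oplus a_d\odot x_d\in\mathbb{T}_{>\mathbb{O}}\cup\mathbb{T}_{\bullet}\}$. An empty intersection of halfspaces is $\mathbb{T}_{\pm}^d$. Puiseux series. $\mathbb{K}$ is the field of generalized real Puiseux series: formal series $\gamma=\sum_i c_it^{\alpha_i}$ with $\alpha_i\in\mathbb{R}$, nonzero $c_i\in\mathbb{R}$, $\alpha_0>\alpha_1>\cdots$, where the sequence $(\alpha_i)$ is finite (possibly empty, giving $0$) or unbounded. $\gamma\ne0$ is positive iff its leading coefficient $c_0$ is positive; this makes $\mathbb{K}$ an ordered (real closed) field. "Closed" refers to the product of order topologies on $\mathbb{K}^d$; "convex" and "semialgebraic" (finite Boolean combination of polynomial inequalities with coefficients in $\mathbb{K}$) are with respect to the ordered field $\mathbb{K}$. For $\mathbf{a}\in\mathbb{K}^{d+1}$ with $(\mathbf{a}_1,\dots,\mathbf{a}_d)\neq0$,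 $\overline{\mathbf{H}}^+(\mathbf{a})=\{\mathbf{x}\in\mathbb{K}^d:\mathbf{a}_0+\mathbf{a}_1\mathbf{x}_1+\dots+\mathbf{a}_d\mathbf{x}_d\ge0\}$. The signed valuation $\mathrm{sval}:\mathbb{K}\to\mathbb{T}_{\pm}$ sends a series $\gamma=\sum_i c_it^{\alpha_i}$ with nonzero coefficients $c_i$ and $\alpha_0>\alpha_1>\cdots$ to its leading exponent $\alpha_0$ if $\gamma>0$, to $\mathbb{O}$ if $\gamma=0$, and to $\ominus\alpha_0$ if $\gamma<0$; it is extended componentwise to vectors and to sets by taking images. *)

theory Defs
  imports "HOL-Analysis.Analysis" "HOL-Library.Poly_Mapping"
begin

section \<open>Generalized real Puiseux series\<close>

text \<open>The exponents of a series form a strictly decreasing sequence that is finite or unbounded.\<close>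

definition puiseux_exponents :: "real set \<Rightarrow> bool" where
  "puiseux_exponents S \<longleftrightarrow>
     finite S \<or>
     (\<exists>\<alpha>::nat \<Rightarrow> real. (\<forall>i. \<alpha> (Suc i) < \<alpha> i) \<and> \<not> bdd_below (range \<alpha>) \<and> S = range \<alpha>)"

lemma puiseux_exponents_iff: "puiseux_exponents S \<longleftrightarrow> (\<forall>r. finite (S \<inter> {r..}))"
proof
  assume "puiseux_exponents S"
  then consider "finite S" | \<alpha> :: "nat \<Rightarrow> real" where "\<And>i. \<alpha> (Suc i) < \<alpha> i"
    "\<not> bdd_below (range \<alpha>)" "S = range \<alpha>"
    unfolding puiseux_exponents_def by metis
  then show "\<forall>r. finite (S \<inter> {r..})"
  proof cases
    case 2
    have anti: "decseq \<alpha>" using 2(1) by (simp add: decseq_Suc_iff less_imp_le)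
    show ?thesis
    proof
      fix r
      obtain n where n: "\<alpha> n < r"
        using 2(2) unfolding bdd_below_def by (metis (full_types) not_le rangeE)
      have "S \<inter> {r..} \<subseteq> \<alpha> ` {..<n}"
      proof
        fix x assume "x \<in> S \<inter> {r..}"
        then obtain k where k: "x = \<alpha> k" "r \<le> \<alpha> k" using 2(3) by auto
        have "k < n"
        proof (rule ccontr)
          assume "\<not> k < n"
          then have "\<alpha> k \<le> \<alpha> n" using anti by (auto simp: decseq_def)
          then show False using n k by simp
        qed
        then show "x \<in> \<alpha> ` {..<n}" using k by simp
      qed
      then show "finite (S \<inter> {r..})" by (rule finite_subset) simp
    qed
  qed simp
next
  assume fin: "\<forall>r. finite (S \<inter> {r..})"
  show "puiseux_exponents S"
  proof (cases "finite S")
    case False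
    have grt: "\<exists>m. m \<in> T \<and> (\<forall>s\<in>T. s \<le> m)" if T: "T \<subseteq> S" "T \<noteq> {}" for T
    proof -
      obtain t where t: "t \<in> T" using T by blast
      have f: "finite (T \<inter> {t..})" using fin T(1)
        by (meson finite_subset Int_mono order_refl)
      have ne: "T \<inter> {t..} \<noteq> {}" using t by auto
      let ?m = "Max (T \<inter> {t..})"
      have m: "?m \<in> T \<inter> {t..}" using Max_in[OF f ne] .
      have "s \<le> ?m" if "s \<in> T" for s
      proof (cases "t \<le> s")
        case True then show ?thesis using that f by (intro Max_ge) auto
      next
        case False then show ?thesis using m by auto
      qed
      then show ?thesis using m by blast
    qed
    have ne: "{s\<in>S. s < x} \<noteq> {}" for x
    proof
      assume "{s\<in>S. s < x} = {}"
      then have "S \<subseteq> S \<inter> {x..}" by (auto simp: not_less)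
      then show False using fin False finite_subset by blast
    qed
    define g where "g x = (SOME m. m \<in> {s\<in>S. s < x} \<and> (\<forall>s\<in>{s\<in>S. s < x}. s \<le> m))" for x
    have g: "g x \<in> S" "g x < x" "\<And>s. s \<in> S \<Longrightarrow> s < x \<Longrightarrow> s \<le> g x" for x
    proof -
      have "\<exists>m. m \<in> {s\<in>S. s < x} \<and> (\<forall>s\<in>{s\<in>S. s < x}. s \<le> m)"
        by (rule grt) (use ne in auto)
      from someI_ex[OF this, folded g_def]
      show "g x \<in> S" "g x < x" "\<And>s. s \<in> S \<Longrightarrow> s < x \<Longrightarrow> s \<le> g x" by auto
    qed
    obtain m where m: "m \<in> S" "\<And>s. s \<in> S \<Longrightarrow> s \<le> m"
      using grt[of S] False by (metis finite.emptyI order_refl)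
    define \<alpha> where "\<alpha> n = (g ^^ n) m" for n
    have dec: "\<alpha> (Suc i) < \<alpha> i" for i using g(2) by (simp add: \<alpha>_def)
    have inS: "\<alpha> i \<in> S" for i by (cases i) (simp_all add: \<alpha>_def m g)
    have anti: "strict_mono (\<lambda>n. - \<alpha> n)" using dec by (simp add: strict_mono_Suc_iff)
    have unb: "\<not> bdd_below (range \<alpha>)"
    proof
      assume "bdd_below (range \<alpha>)"
      then obtain r where r: "\<And>n. r \<le> \<alpha> n" unfolding bdd_below_def by auto
      have "range \<alpha> \<subseteq> S \<inter> {r..}" using inS r by auto
      then have "finite (range \<alpha>)" using fin finite_subset by blast
      moreover have "inj \<alpha>" using strict_mono_imp_inj_on[OF anti] by (auto simp: inj_on_def)
      ultimately show False using finite_imageD infinite_UNIV_nat by blast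
    qed
    have "S \<subseteq> range \<alpha>"
    proof
      fix s assume s: "s \<in> S"
      obtain n where "\<alpha> n \<le> s"
        using unb unfolding bdd_below_def by (metis (full_types) linear rangeE)
      then have "\<alpha> (LEAST n. \<alpha> n \<le> s) \<le> s" by (rule LeastI)
      moreover have "s \<le> \<alpha> (LEAST n. \<alpha> n \<le> s)"
      proof (cases "LEAST n. \<alpha> n \<le> s")
        case 0
        then show ?thesis using m(2)[OF s] by (simp add: \<alpha>_def)
      next
        case (Suc k)
        then have "\<not> \<alpha> k \<le> s" using not_less_Least[of k "\<lambda>n. \<alpha> n \<le> s"] by simp
        then have "s \<le> g (\<alpha> k)" using g(3) s by simp
        then show ?thesis using Suc by (simp add: \<alpha>_def)
      qed
      ultimately show "s \<in> range \<alpha>" by (metis order_antisym rangeI)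
    qed
    then have "S = range \<alpha>" using inS by auto
    then show ?thesis using dec unb unfolding puiseux_exponents_def
      by (intro disjI2 exI[of _ \<alpha>]) auto
  qed (simp add: puiseux_exponents_def)
qed

text \<open>The series \<open>\<Sum>\<^sub>i c\<^sub>i t\<^sup>\<alpha>\<^sup>i\<close> is represented by its coefficient function, which maps \<open>\<alpha>\<^sub>i\<close> to \<open>c\<^sub>i\<close> and
  all other exponents to \<open>0\<close>.\<close>

typedef puiseux = "{f :: real \<Rightarrow> real. puiseux_exponents {a. f a \<noteq> 0}}"
  morphisms pcoeff Abs_puiseux
  by (rule exI[of _ "\<lambda>_. 0"]) (simp add: puiseux_exponents_def)

setup_lifting type_definition_puiseux

definition psupp :: "puiseux \<Rightarrow> real set" where
  "psupp x = {a. pcoeff x a \<noteq> 0}"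

lemma puiseux_eqI: "(\<And>a. pcoeff x a = pcoeff y a) \<Longrightarrow> x = y"
  by (simp add: pcoeff_inject[symmetric] fun_eq_iff)

lemma finite_supp_above: "finite (psupp x \<inter> {r..})"
  using pcoeff[of x] by (simp add: puiseux_exponents_iff psupp_def)

lemma not_in_psupp: "a \<notin> psupp x \<longleftrightarrow> pcoeff x a = 0"
  by (simp add: psupp_def)

lemma in_psupp: "a \<in> psupp x \<longleftrightarrow> pcoeff x a \<noteq> 0"
  by (simp add: psupp_def)

lemma psupp_bounded_above: "\<exists>B. \<forall>a\<in>psupp x. a \<le> B"
proof -
  have "finite (psupp x \<inter> {0..})" by (rule finite_supp_above)
  then obtain B where "\<forall>a\<in>psupp x \<inter> {0..}. a \<le> B"
    by (meson bdd_above_def bdd_above_finite)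
  then have "a \<le> max 0 B" if "a \<in> psupp x" for a
    using that by (cases "0 \<le> a") force+
  then show ?thesis by blast
qed

instantiation puiseux :: "{zero, one, plus, minus, uminus, times}"
begin

lift_definition zero_puiseux :: puiseux is "\<lambda>_. 0"
  by (simp add: puiseux_exponents_def)

lift_definition one_puiseux :: puiseux is "\<lambda>a. if a = 0 then 1 else 0"
  by (simp add: puiseux_exponents_def)

lift_definition plus_puiseux :: "puiseux \<Rightarrow> puiseux \<Rightarrow> puiseux" is "\<lambda>f g a. f a + g a"
proof -
  fix f g :: "real \<Rightarrow> real"
  assume "puiseux_exponents {a. f a \<noteq> 0}" "puiseux_exponents {a. g a \<noteq> 0}"
  then have fin: "finite (({a. f a \<noteq> 0} \<inter> {r..}) \<union> ({a. g a \<noteq> 0} \<inter> {r..}))" for r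
    by (simp add: puiseux_exponents_iff)
  have "finite ({a. f a + g a \<noteq> 0} \<inter> {r..})" for r
    by (rule finite_subset[OF _ fin[of r]]) auto
  then show "puiseux_exponents {a. f a + g a \<noteq> 0}"
    unfolding puiseux_exponents_iff by blast
qed

lift_definition uminus_puiseux :: "puiseux \<Rightarrow> puiseux" is "\<lambda>f a. - f a"
  by simp

definition minus_puiseux :: "puiseux \<Rightarrow> puiseux \<Rightarrow> puiseux" where
  "minus_puiseux x y = x + - y"

text \<open>The index set of the sum is finite, because the exponents of a series are bounded above.\<close>

lift_definition times_puiseux :: "puiseux \<Rightarrow> puiseux \<Rightarrow> puiseux" is
  "\<lambda>f g c. \<Sum>a | f a \<noteq> 0 \<and> g (c - a) \<noteq> 0. f a * g (c - a)"
proof -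
  fix f g :: "real \<Rightarrow> real"
  assume fg: "puiseux_exponents {a. f a \<noteq> 0}" "puiseux_exponents {a. g a \<noteq> 0}"
  obtain x y where xy: "pcoeff x = f" "pcoeff y = g"
    using Abs_puiseux_inverse[of f] Abs_puiseux_inverse[of g] fg by auto
  obtain A where A: "\<And>a. f a \<noteq> 0 \<Longrightarrow> a \<le> A"
    using psupp_bounded_above[of x] xy by (auto simp: psupp_def)
  obtain B where B: "\<And>a. g a \<noteq> 0 \<Longrightarrow> a \<le> B"
    using psupp_bounded_above[of y] xy by (auto simp: psupp_def)
  show "puiseux_exponents {c. (\<Sum>a | f a \<noteq> 0 \<and> g (c - a) \<noteq> 0. f a * g (c - a)) \<noteq> 0}"
    unfolding puiseux_exponents_iff
  proof
    fix r
    have "{c. (\<Sum>a | f a \<noteq> 0 \<and> g (c - a) \<noteq> 0. f a * g (c - a)) \<noteq> 0} \<inter> {r..}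
      \<subseteq> (\<lambda>(a, b). a + b) ` ((psupp x \<inter> {r - B..}) \<times> (psupp y \<inter> {r - A..}))" (is "?L \<subseteq> ?R")
    proof
      fix c assume c: "c \<in> ?L"
      then have "{a. f a \<noteq> 0 \<and> g (c - a) \<noteq> 0} \<noteq> {}" by force
      then obtain a where a: "f a \<noteq> 0" "g (c - a) \<noteq> 0" by auto
      have "(a, c - a) \<in> (psupp x \<inter> {r - B..}) \<times> (psupp y \<inter> {r - A..})"
        using a A[OF a(1)] B[OF a(2)] c xy by (auto simp: psupp_def)
      then show "c \<in> ?R" by (auto intro!: rev_image_eqI)
    qed
    then show "finite ?L" by (rule finite_subset) (simp add: finite_supp_above)
  qed
qed

instance ..

end

lemma pcoeff_0 [simp]: "pcoeff 0 a = 0" by transfer simp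
lemma pcoeff_1: "pcoeff 1 a = (if a = 0 then 1 else 0)" by transfer simp
lemma pcoeff_add [simp]: "pcoeff (x + y) a = pcoeff x a + pcoeff y a" by transfer simp
lemma pcoeff_uminus [simp]: "pcoeff (- x) a = - pcoeff x a" by transfer simp
lemma pcoeff_diff [simp]: "pcoeff (x - y) a = pcoeff x a - pcoeff y a"
  by (simp add: minus_puiseux_def)

lemma pcoeff_mult_raw:
  "pcoeff (x * y) c = (\<Sum>a | pcoeff x a \<noteq> 0 \<and> pcoeff y (c - a) \<noteq> 0. pcoeff x a * pcoeff y (c - a))"
  by transfer simp

lemma pcoeff_mult:
  assumes "finite F" "\<And>a. a \<in> psupp x \<Longrightarrow> c - a \<in> psupp y \<Longrightarrow> a \<in> F"
  shows "pcoeff (x * y) c = (\<Sum>a\<in>F. pcoeff x a * pcoeff y (c - a))"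
  unfolding pcoeff_mult_raw
  by (rule sum.mono_neutral_left) (use assms in \<open>auto simp: in_psupp\<close>)

lemma pcoeff_mult2:
  assumes "finite F" "finite G" "\<And>a. a \<in> psupp x \<Longrightarrow> c - a \<in> psupp y \<Longrightarrow> a \<in> F \<and> c - a \<in> G"
  shows "pcoeff (x * y) c = (\<Sum>a\<in>F. \<Sum>b\<in>G. if a + b = c then pcoeff x a * pcoeff y b else 0)"
proof -
  have "(\<Sum>b\<in>G. if a + b = c then pcoeff x a * pcoeff y b else 0) = pcoeff x a * pcoeff y (c - a)"
    if "a \<in> F" for a
  proof -
    have "(\<Sum>b\<in>G. if a + b = c then pcoeff x a * pcoeff y b else 0)
        = (\<Sum>b\<in>G. if b = c - a then pcoeff x a * pcoeff y b else 0)"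
      by (intro sum.cong) (auto simp: algebra_simps)
    also have "\<dots> = (if c - a \<in> G then pcoeff x a * pcoeff y (c - a) else 0)"
      using assms(2) by (simp add: sum.delta)
    also have "\<dots> = pcoeff x a * pcoeff y (c - a)"
      using assms(3)[of a] by (auto simp: in_psupp)
    finally show ?thesis .
  qed
  then show ?thesis using assms by (simp add: pcoeff_mult[of F])
qed

lemma finite_mult_index: "finite {a. a \<in> psupp x \<and> c - a \<in> psupp y}"
proof -
  obtain B where B: "\<And>a. a \<in> psupp y \<Longrightarrow> a \<le> B" using psupp_bounded_above by blast
  have "{a. a \<in> psupp x \<and> c - a \<in> psupp y} \<subseteq> psupp x \<inter> {c - B..}"
    using B by fastforce
  then show ?thesis using finite_supp_above finite_subset by blast
qed

lemma psupp_mult: "c \<in> psupp (x * y) \<Longrightarrow> \<exists>a\<in>psupp x. \<exists>b\<in>psupp y. c = a + b"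
proof -
  assume "c \<in> psupp (x * y)"
  then have "{a. pcoeff x a \<noteq> 0 \<and> pcoeff y (c - a) \<noteq> 0} \<noteq> {}"
    unfolding in_psupp pcoeff_mult_raw by force
  then obtain a where "a \<in> psupp x" "c - a \<in> psupp y" by (auto simp: in_psupp)
  then show ?thesis by (intro bexI[of _ a] bexI[of _ "c - a"]) auto
qed

lemma puiseux_mult_commute: "x * y = y * (x::puiseux)"
proof (rule puiseux_eqI)
  fix c
  show "pcoeff (x * y) c = pcoeff (y * x) c"
    unfolding pcoeff_mult_raw
    by (rule sum.reindex_bij_witness[of _ "\<lambda>a. c - a" "\<lambda>a. c - a"]) (auto simp: mult.commute)
qed

lemma puiseux_mult_assoc: "(x * y) * z = x * (y * (z::puiseux))"
proof (rule puiseux_eqI)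
  fix t
  obtain A where A: "\<And>a. a \<in> psupp x \<Longrightarrow> a \<le> A" using psupp_bounded_above by blast
  obtain B where B: "\<And>a. a \<in> psupp y \<Longrightarrow> a \<le> B" using psupp_bounded_above by blast
  obtain C where C: "\<And>a. a \<in> psupp z \<Longrightarrow> a \<le> C" using psupp_bounded_above by blast
  define F where "F = psupp x \<inter> {t - B - C..}"
  define G where "G = psupp y \<inter> {t - A - C..}"
  define H where "H = psupp z \<inter> {t - A - B..}"
  have fin: "finite F" "finite G" "finite H" by (simp_all add: F_def G_def H_def finite_supp_above)
  define E where "E = (\<lambda>(a, b). a + b) ` (F \<times> G)"
  define D where "D = (\<lambda>(a, b). a + b) ` (G \<times> H)"
  have finE: "finite E" "finite D" using fin by (auto simp: E_def D_def)
  let ?p = "\<lambda>a b c. pcoeff x a * pcoeff y b * pcoeff z c"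
  have "pcoeff ((x * y) * z) t = (\<Sum>e\<in>E. \<Sum>c\<in>H. if e + c = t then pcoeff (x * y) e * pcoeff z c else 0)"
  proof (rule pcoeff_mult2)
    fix e assume e: "e \<in> psupp (x * y)" "t - e \<in> psupp z"
    then obtain a b where ab: "a \<in> psupp x" "b \<in> psupp y" "e = a + b" using psupp_mult by blast
    have "a \<in> F" "b \<in> G" "t - e \<in> H"
      using ab e(2) A[OF ab(1)] B[OF ab(2)] C[OF e(2)] by (auto simp: F_def G_def H_def)
    then show "e \<in> E \<and> t - e \<in> H" using ab by (auto simp: E_def)
  qed (use fin finE in auto)
  also have "\<dots> = (\<Sum>e\<in>E. \<Sum>c\<in>H. \<Sum>a\<in>F. \<Sum>b\<in>G. if a + b = e \<and> e + c = t then ?p a b c else 0)"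
  proof (intro sum.cong refl)
    fix e c assume c: "e \<in> E" "c \<in> H"
    show "(if e + c = t then pcoeff (x * y) e * pcoeff z c else 0)
      = (\<Sum>a\<in>F. \<Sum>b\<in>G. if a + b = e \<and> e + c = t then ?p a b c else 0)"
    proof (cases "e + c = t")
      case True
      have cC: "c \<le> C" using C c by (auto simp: H_def)
      have "pcoeff (x * y) e = (\<Sum>a\<in>F. \<Sum>b\<in>G. if a + b = e then pcoeff x a * pcoeff y b else 0)"
      proof (rule pcoeff_mult2)
        fix a assume a: "a \<in> psupp x" "e - a \<in> psupp y"
        then show "a \<in> F \<and> e - a \<in> G"
          using A[OF a(1)] B[OF a(2)] cC True by (auto simp: F_def G_def)
      qed (use fin in auto)
      then show ?thesis using True by (auto simp: sum_distrib_right intro!: sum.cong)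
    qed simp
  qed
  also have "\<dots> = (\<Sum>c\<in>H. \<Sum>e\<in>E. \<Sum>a\<in>F. \<Sum>b\<in>G. if a + b = e \<and> e + c = t then ?p a b c else 0)"
    by (rule sum.swap)
  also have "\<dots> = (\<Sum>c\<in>H. \<Sum>a\<in>F. \<Sum>e\<in>E. \<Sum>b\<in>G. if a + b = e \<and> e + c = t then ?p a b c else 0)"
    by (rule sum.cong[OF refl], rule sum.swap)
  also have "\<dots> = (\<Sum>c\<in>H. \<Sum>a\<in>F. \<Sum>b\<in>G. \<Sum>e\<in>E. if a + b = e \<and> e + c = t then ?p a b c else 0)"
    by (rule sum.cong[OF refl], rule sum.cong[OF refl], rule sum.swap)
  also have "\<dots> = (\<Sum>c\<in>H. \<Sum>a\<in>F. \<Sum>b\<in>G. if a + b + c = t then ?p a b c else 0)"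
  proof (intro sum.cong refl)
    fix a b c assume "c \<in> H" "a \<in> F" "b \<in> G"
    then have "a + b \<in> E" by (auto simp: E_def)
    moreover have "(\<Sum>e\<in>E. if a + b = e \<and> e + c = t then ?p a b c else 0)
      = (\<Sum>e\<in>E. if e = a + b then (if a + b + c = t then ?p a b c else 0) else 0)"
      by (intro sum.cong) auto
    ultimately show "(\<Sum>e\<in>E. if a + b = e \<and> e + c = t then ?p a b c else 0)
      = (if a + b + c = t then ?p a b c else 0)" using finE by (simp add: sum.delta)
  qed
  also have "\<dots> = (\<Sum>a\<in>F. \<Sum>c\<in>H. \<Sum>b\<in>G. if a + b + c = t then ?p a b c else 0)"
    by (rule sum.swap)
  also have "\<dots> = (\<Sum>a\<in>F. \<Sum>b\<in>G. \<Sum>c\<in>H. if a + b + c = t then ?p a b c else 0)"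
    by (rule sum.cong[OF refl], rule sum.swap)
  finally have 1: "pcoeff ((x * y) * z) t
    = (\<Sum>a\<in>F. \<Sum>b\<in>G. \<Sum>c\<in>H. if a + b + c = t then ?p a b c else 0)" .
  have "pcoeff (x * (y * z)) t = (\<Sum>a\<in>F. \<Sum>d\<in>D. if a + d = t then pcoeff x a * pcoeff (y * z) d else 0)"
  proof (rule pcoeff_mult2)
    fix a assume e: "a \<in> psupp x" "t - a \<in> psupp (y * z)"
    then obtain b c where ab: "b \<in> psupp y" "c \<in> psupp z" "t - a = b + c" using psupp_mult by blast
    have "a \<in> F" "b \<in> G" "c \<in> H"
      using ab e(1) A[OF e(1)] B[OF ab(1)] C[OF ab(2)] by (auto simp: F_def G_def H_def)
    then show "a \<in> F \<and> t - a \<in> D" using ab by (auto simp: D_def)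
  qed (use fin finE in auto)
  also have "\<dots> = (\<Sum>a\<in>F. \<Sum>d\<in>D. \<Sum>b\<in>G. \<Sum>c\<in>H. if b + c = d \<and> a + d = t then ?p a b c else 0)"
  proof (intro sum.cong refl)
    fix a d assume a: "a \<in> F" "d \<in> D"
    show "(if a + d = t then pcoeff x a * pcoeff (y * z) d else 0)
      = (\<Sum>b\<in>G. \<Sum>c\<in>H. if b + c = d \<and> a + d = t then ?p a b c else 0)"
    proof (cases "a + d = t")
      case True
      have aA: "a \<le> A" using A a by (auto simp: F_def)
      have "pcoeff (y * z) d = (\<Sum>b\<in>G. \<Sum>c\<in>H. if b + c = d then pcoeff y b * pcoeff z c else 0)"
      proof (rule pcoeff_mult2)
        fix b assume b: "b \<in> psupp y" "d - b \<in> psupp z"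
        then show "b \<in> G \<and> d - b \<in> H"
          using B[OF b(1)] C[OF b(2)] aA True by (auto simp: G_def H_def)
      qed (use fin in auto)
      then show ?thesis using True by (auto simp: sum_distrib_left mult.assoc intro!: sum.cong)
    qed simp
  qed
  also have "\<dots> = (\<Sum>a\<in>F. \<Sum>b\<in>G. \<Sum>d\<in>D. \<Sum>c\<in>H. if b + c = d \<and> a + d = t then ?p a b c else 0)"
    by (rule sum.cong[OF refl], rule sum.swap)
  also have "\<dots> = (\<Sum>a\<in>F. \<Sum>b\<in>G. \<Sum>c\<in>H. \<Sum>d\<in>D. if b + c = d \<and> a + d = t then ?p a b c else 0)"
    by (rule sum.cong[OF refl], rule sum.cong[OF refl], rule sum.swap)
  also have "\<dots> = (\<Sum>a\<in>F. \<Sum>b\<in>G. \<Sum>c\<in>H. if a + b + c = t then ?p a b c else 0)"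
  proof (intro sum.cong refl)
    fix a b c assume "c \<in> H" "a \<in> F" "b \<in> G"
    then have "b + c \<in> D" by (auto simp: D_def)
    moreover have "(\<Sum>d\<in>D. if b + c = d \<and> a + d = t then ?p a b c else 0)
      = (\<Sum>d\<in>D. if d = b + c then (if a + b + c = t then ?p a b c else 0) else 0)"
      by (intro sum.cong) (auto simp: add.assoc)
    ultimately show "(\<Sum>d\<in>D. if b + c = d \<and> a + d = t then ?p a b c else 0)
      = (if a + b + c = t then ?p a b c else 0)" using finE by (simp add: sum.delta)
  qed
  finally show "pcoeff ((x * y) * z) t = pcoeff (x * (y * z)) t" using 1 by simp
qed

instance puiseux :: comm_ring_1
proof
  fix x y z :: puiseux
  show "x + y + z = x + (y + z)" by (rule puiseux_eqI) (simp add: add.assoc)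
  show "x + y = y + x" by (rule puiseux_eqI) (simp add: add.commute)
  show "0 + x = x" "- x + x = 0" by (rule puiseux_eqI, simp)+
  show "x - y = x + - y" by (rule minus_puiseux_def)
  show "x * y * z = x * (y * z)" by (rule puiseux_mult_assoc)
  show "x * y = y * x" by (rule puiseux_mult_commute)
  show "1 * x = x"
  proof (rule puiseux_eqI)
    fix c
    have "pcoeff (1 * x) c = (\<Sum>a\<in>{0}. pcoeff 1 a * pcoeff x (c - a))"
      by (rule pcoeff_mult) (auto simp: in_psupp pcoeff_1 split: if_splits)
    then show "pcoeff (1 * x) c = pcoeff x c" by (simp add: pcoeff_1)
  qed
  show "(x + y) * z = x * z + y * z"
  proof (rule puiseux_eqI)
    fix c
    define F where "F = {a. a \<in> psupp x \<and> c - a \<in> psupp z} \<union> {a. a \<in> psupp y \<and> c - a \<in> psupp z}"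
    have F: "finite F" by (simp add: F_def finite_mult_index)
    have "pcoeff ((x + y) * z) c = (\<Sum>a\<in>F. pcoeff (x + y) a * pcoeff z (c - a))"
      by (rule pcoeff_mult[OF F]) (auto simp: F_def in_psupp)
    also have "\<dots> = (\<Sum>a\<in>F. pcoeff x a * pcoeff z (c - a)) + (\<Sum>a\<in>F. pcoeff y a * pcoeff z (c - a))"
      by (simp add: algebra_simps sum.distrib)
    also have "(\<Sum>a\<in>F. pcoeff x a * pcoeff z (c - a)) = pcoeff (x * z) c"
      by (rule pcoeff_mult[OF F, symmetric]) (auto simp: F_def)
    also have "(\<Sum>a\<in>F. pcoeff y a * pcoeff z (c - a)) = pcoeff (y * z) c"
      by (rule pcoeff_mult[OF F, symmetric]) (auto simp: F_def)
    finally show "pcoeff ((x + y) * z) c = pcoeff (x * z + y * z) c" by simp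
  qed
  have "pcoeff 0 0 \<noteq> pcoeff 1 0" by (simp add: pcoeff_1)
  then show "(0::puiseux) \<noteq> 1" by metis
qed

text \<open>For \<open>x \<noteq> 0\<close> these are \<open>\<alpha>\<^sub>0\<close> and \<open>c\<^sub>0\<close>; the value of \<open>lead_exp 0\<close> is irrelevant.\<close>

definition lead_exp :: "puiseux \<Rightarrow> real" where
  "lead_exp x = (GREATEST a. pcoeff x a \<noteq> 0)"

definition plead_coeff :: "puiseux \<Rightarrow> real" where
  "plead_coeff x = pcoeff x (lead_exp x)"

lemma psupp_0 [simp]: "psupp 0 = {}" by (simp add: psupp_def)

lemma psupp_eq_empty: "psupp x = {} \<longleftrightarrow> x = 0"
  by (metis (full_types) pcoeff_0 empty_iff not_in_psupp puiseux_eqI psupp_0)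

lemma lead_exp_props:
  assumes "x \<noteq> 0"
  shows "lead_exp x \<in> psupp x" "\<And>a. a \<in> psupp x \<Longrightarrow> a \<le> lead_exp x"
proof -
  obtain t where t: "t \<in> psupp x" using assms psupp_eq_empty by blast
  let ?T = "psupp x \<inter> {t..}"
  have f: "finite ?T" by (rule finite_supp_above)
  have m: "Max ?T \<in> ?T" using t f by (intro Max_in) auto
  have ub: "a \<le> Max ?T" if "a \<in> psupp x" for a
  proof (cases "t \<le> a")
    case True then show ?thesis using that f by (intro Max_ge) auto
  next
    case False then show ?thesis using m by auto
  qed
  have "lead_exp x = Max ?T" unfolding lead_exp_def
    by (rule Greatest_equality) (use m ub in \<open>auto simp: in_psupp\<close>)
  then show "lead_exp x \<in> psupp x" "\<And>a. a \<in> psupp x \<Longrightarrow> a \<le> lead_exp x" using m ub by auto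
qed

lemma lead_exp_eqI:
  assumes "pcoeff x m \<noteq> 0" "\<And>a. pcoeff x a \<noteq> 0 \<Longrightarrow> a \<le> m"
  shows "lead_exp x = m"
  unfolding lead_exp_def by (rule Greatest_equality) (use assms in auto)

lemma plead_coeff_nz: "x \<noteq> 0 \<Longrightarrow> plead_coeff x \<noteq> 0"
  using lead_exp_props(1) by (simp add: plead_coeff_def in_psupp)

lemma plead_coeff_0 [simp]: "plead_coeff 0 = 0" by (simp add: plead_coeff_def)

lemma pcoeff_above_lead: "x \<noteq> 0 \<Longrightarrow> lead_exp x < a \<Longrightarrow> pcoeff x a = 0"
  using lead_exp_props(2)[of x a] by (force simp: in_psupp)

lemma plead_mult:
  assumes "x \<noteq> 0" "y \<noteq> 0"
  shows "x * y \<noteq> 0" "lead_exp (x * y) = lead_exp x + lead_exp y"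
    "plead_coeff (x * y) = plead_coeff x * plead_coeff y"
proof -
  have "pcoeff (x * y) (lead_exp x + lead_exp y)
      = (\<Sum>a\<in>{lead_exp x}. pcoeff x a * pcoeff y (lead_exp x + lead_exp y - a))"
  proof (rule pcoeff_mult)
    fix a assume "a \<in> psupp x" "lead_exp x + lead_exp y - a \<in> psupp y"
    then show "a \<in> {lead_exp x}"
      using lead_exp_props(2)[OF assms(1), of a]
        lead_exp_props(2)[OF assms(2), of "lead_exp x + lead_exp y - a"] by auto
  qed simp
  then have c: "pcoeff (x * y) (lead_exp x + lead_exp y) = plead_coeff x * plead_coeff y"
    by (simp add: plead_coeff_def)
  then have nz: "pcoeff (x * y) (lead_exp x + lead_exp y) \<noteq> 0" using assms plead_coeff_nz by simp
  then show "x * y \<noteq> 0" by auto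
  show "lead_exp (x * y) = lead_exp x + lead_exp y"
  proof (rule lead_exp_eqI)
    fix a assume "pcoeff (x * y) a \<noteq> 0"
    then obtain b c where "b \<in> psupp x" "c \<in> psupp y" "a = b + c"
      using psupp_mult in_psupp by blast
    then show "a \<le> lead_exp x + lead_exp y"
      using lead_exp_props(2)[OF assms(1)] lead_exp_props(2)[OF assms(2)] by fastforce
  qed (rule nz)
  then show "plead_coeff (x * y) = plead_coeff x * plead_coeff y"
    using c by (simp add: plead_coeff_def)
qed

lemma plead_coeff_uminus [simp]: "plead_coeff (- x) = - plead_coeff x"
  by (simp add: plead_coeff_def lead_exp_def)

lemma plead_coeff_add_pos:
  assumes "plead_coeff x > 0" "plead_coeff y > 0"
  shows "plead_coeff (x + y) > 0"
proof -
  have nz: "x \<noteq> 0" "y \<noteq> 0" using assms by auto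
  let ?m = "max (lead_exp x) (lead_exp y)"
  have px: "pcoeff x ?m \<ge> 0" and py: "pcoeff y ?m \<ge> 0"
    using assms pcoeff_above_lead[OF nz(1), of ?m] pcoeff_above_lead[OF nz(2), of ?m]
    by (cases "lead_exp x" "lead_exp y" rule: linorder_cases; force simp: max_def plead_coeff_def)+
  moreover have "pcoeff x ?m > 0 \<or> pcoeff y ?m > 0"
    using assms by (auto simp: max_def plead_coeff_def)
  ultimately have pos: "pcoeff (x + y) ?m > 0" by auto
  have "lead_exp (x + y) = ?m"
  proof (rule lead_exp_eqI)
    fix a assume "pcoeff (x + y) a \<noteq> 0"
    then have "pcoeff x a \<noteq> 0 \<or> pcoeff y a \<noteq> 0" by auto
    then show "a \<le> ?m"
      using lead_exp_props(2)[OF nz(1), of a] lead_exp_props(2)[OF nz(2), of a] by (auto simp: in_psupp)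
  qed (use pos in auto)
  then show ?thesis using pos by (simp add: plead_coeff_def)
qed

lift_definition pmonom :: "real \<Rightarrow> real \<Rightarrow> puiseux" is "\<lambda>c \<alpha> a. if a = \<alpha> then c else 0"
  by (simp add: puiseux_exponents_def)

lemma pcoeff_monom: "pcoeff (pmonom c \<alpha>) a = (if a = \<alpha> then c else 0)"
  by transfer simp

lemma pcoeff_monom_mult: "pcoeff (pmonom c \<alpha> * x) a = c * pcoeff x (a - \<alpha>)"
proof -
  have "pcoeff (pmonom c \<alpha> * x) a = (\<Sum>b\<in>{\<alpha>}. pcoeff (pmonom c \<alpha>) b * pcoeff x (a - b))"
    by (rule pcoeff_mult) (auto simp: in_psupp pcoeff_monom split: if_splits)
  then show ?thesis by (simp add: pcoeff_monom)
qed

lemma pmonom_mult_monom: "pmonom c \<alpha> * pmonom e \<beta> = pmonom (c * e) (\<alpha> + \<beta>)"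
  by (rule puiseux_eqI) (auto simp: pcoeff_monom_mult pcoeff_monom algebra_simps)

lemma pmonom_1_0: "pmonom 1 0 = 1"
  by (rule puiseux_eqI) (simp add: pcoeff_monom pcoeff_1)

lemma psupp_power_le:
  assumes "\<And>a. a \<in> psupp e \<Longrightarrow> a \<le> - \<delta>" "a \<in> psupp (e ^ n)"
  shows "a \<le> - (of_nat n * \<delta>)"
  using assms(2)
proof (induction n arbitrary: a)
  case 0
  then show ?case by (simp add: in_psupp pcoeff_1 split: if_splits)
next
  case (Suc n)
  then obtain b c where bc: "b \<in> psupp e" "c \<in> psupp (e ^ n)" "a = b + c"
    using psupp_mult by fastforce
  then show ?case using assms(1)[OF bc(1)] Suc.IH[OF bc(2)] by (simp add: algebra_simps)
qed

lemma pcoeff_sum: "pcoeff (sum f A) a = (\<Sum>i\<in>A. pcoeff (f i) a)"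
  by (induction A rule: infinite_finite_induct) auto

lemma one_minus_inverse_ex:
  assumes d: "\<delta> > 0" "\<And>a. a \<in> psupp e \<Longrightarrow> a \<le> - \<delta>"
  shows "\<exists>g. (1 - e) * g = 1"
proof -
  define N where "N r = Suc (nat \<lceil>\<bar>r\<bar> / \<delta>\<rceil>)" for r
  have N: "- r < of_nat n * \<delta>" if "N r \<le> n" for r n
  proof -
    have "\<bar>r\<bar> / \<delta> < of_nat (N r)" unfolding N_def by linarith
    also have "\<dots> \<le> of_nat n" using that by simp
    finally show ?thesis using d(1) by (simp add: field_simps)
  qed
  have pz: "pcoeff (e ^ n) a = 0" if "N r \<le> n" "r \<le> a" for r n a
  proof (rule ccontr)
    assume "pcoeff (e ^ n) a \<noteq> 0"
    then have "a \<le> - (of_nat n * \<delta>)" using psupp_power_le[OF d(2)] in_psupp by blast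
    then show False using N[OF that(1)] that(2) by linarith
  qed
  define S where "S n = (\<Sum>k<n. e ^ k)" for n
  have S: "pcoeff (S n) a = pcoeff (S m) a" if "N r \<le> n" "N r \<le> m" "r \<le> a" for r n m a
  proof -
    have "pcoeff (S n) a = pcoeff (S (N r)) a" if "N r \<le> n" for n
      unfolding S_def pcoeff_sum
      by (rule sum.mono_neutral_right) (use that pz[OF _ \<open>r \<le> a\<close>] in auto)
    then show ?thesis using that by metis
  qed
  define f where "f a = pcoeff (S (N a)) a" for a
  have f: "f a = pcoeff (S (N r)) a" if "r \<le> a" for r a
  proof -
    have "f a = pcoeff (S (N a + N r)) a" unfolding f_def by (rule S[of a]) auto
    also have "\<dots> = pcoeff (S (N r)) a" by (rule S[of r]) (use that in auto)
    finally show ?thesis .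
  qed
  have "puiseux_exponents {a. f a \<noteq> 0}"
    unfolding puiseux_exponents_iff
  proof
    fix r
    have "{a. f a \<noteq> 0} \<inter> {r..} \<subseteq> psupp (S (N r)) \<inter> {r..}" using f by (auto simp: in_psupp)
    then show "finite ({a. f a \<noteq> 0} \<inter> {r..})" using finite_supp_above finite_subset by blast
  qed
  then obtain g where g: "pcoeff g = f" using Abs_puiseux_inverse[of f] by auto
  have "(1 - e) * g = 1"
  proof (rule puiseux_eqI)
    fix t
    define h where "h = S (N t)"
    have gh: "pcoeff g a = pcoeff h a" if "t \<le> a" for a using f[OF that] by (simp add: g h_def)
    have ub: "a \<le> 0" if "a \<in> psupp (1 - e)" for a
    proof -
      have "a = 0 \<or> a \<in> psupp e" using that by (auto simp: in_psupp pcoeff_1 split: if_splits)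
      then show ?thesis using d by force
    qed
    define F where "F = {a. a \<in> psupp (1 - e) \<and> t - a \<in> psupp g} \<union> {a. a \<in> psupp (1 - e) \<and> t - a \<in> psupp h}"
    have F: "finite F" by (simp add: F_def finite_mult_index)
    have "pcoeff ((1 - e) * g) t = (\<Sum>a\<in>F. pcoeff (1 - e) a * pcoeff g (t - a))"
      by (rule pcoeff_mult[OF F]) (auto simp: F_def)
    also have "\<dots> = (\<Sum>a\<in>F. pcoeff (1 - e) a * pcoeff h (t - a))"
    proof (rule sum.cong[OF refl])
      fix a assume "a \<in> F"
      then have "a \<le> 0" using ub by (auto simp: F_def)
      then show "pcoeff (1 - e) a * pcoeff g (t - a) = pcoeff (1 - e) a * pcoeff h (t - a)"
        using gh[of "t - a"] by simp
    qed
    also have "\<dots> = pcoeff ((1 - e) * h) t"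
      by (rule pcoeff_mult[OF F, symmetric]) (auto simp: F_def)
    also have "(1 - e) * h = 1 - e ^ N t"
      unfolding h_def S_def by (rule one_diff_power_eq[symmetric])
    also have "pcoeff (1 - e ^ N t) t = pcoeff 1 t" using pz[of t "N t" t] by simp
    finally show "pcoeff ((1 - e) * g) t = pcoeff 1 t" .
  qed
  then show ?thesis ..
qed

lemma puiseux_inverse_ex:
  assumes "x \<noteq> (0::puiseux)"
  shows "\<exists>y. x * y = 1"
proof -
  define m where "m = pmonom (1 / plead_coeff x) (- lead_exp x)"
  define e where "e = 1 - m * x"
  have lc: "plead_coeff x \<noteq> 0" using assms by (rule plead_coeff_nz)
  have neg: "a < 0" if "a \<in> psupp e" for a
  proof (rule ccontr)
    assume "\<not> a < 0"
    then consider "a = 0" | "a > 0" by linarith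
    then have "pcoeff e a = 0"
    proof cases
      case 1
      then show ?thesis using lc by (simp add: e_def m_def pcoeff_monom_mult pcoeff_1 plead_coeff_def)
    next
      case 2
      then show ?thesis using pcoeff_above_lead[OF assms, of "a + lead_exp x"]
        by (simp add: e_def m_def pcoeff_monom_mult pcoeff_1)
    qed
    then show False using that by (simp add: in_psupp)
  qed
  have "\<exists>\<delta>>0. \<forall>a\<in>psupp e. a \<le> - \<delta>"
  proof (cases "e = 0")
    case True
    then show ?thesis by (intro exI[of _ 1]) simp
  next
    case False
    then show ?thesis
      using lead_exp_props[OF False] neg by (intro exI[of _ "- lead_exp e"]) auto
  qed
  then obtain g where "(1 - e) * g = 1" using one_minus_inverse_ex by blast
  then have "x * (m * g) = 1" by (simp add: e_def algebra_simps)
  then show ?thesis ..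
qed

instantiation puiseux :: linordered_field
begin

definition inverse_puiseux :: "puiseux \<Rightarrow> puiseux" where
  "inverse_puiseux x = (if x = 0 then 0 else (THE y. x * y = 1))"

definition divide_puiseux :: "puiseux \<Rightarrow> puiseux \<Rightarrow> puiseux" where
  "divide_puiseux x y = x * inverse y"

definition less_puiseux :: "puiseux \<Rightarrow> puiseux \<Rightarrow> bool" where
  "less_puiseux x y \<longleftrightarrow> plead_coeff (y - x) > 0"

definition less_eq_puiseux :: "puiseux \<Rightarrow> puiseux \<Rightarrow> bool" where
  "less_eq_puiseux x y \<longleftrightarrow> x < y \<or> x = (y::puiseux)"

definition abs_puiseux :: "puiseux \<Rightarrow> puiseux" where
  "abs_puiseux x = (if x < 0 then - x else x)"

definition sgn_puiseux :: "puiseux \<Rightarrow> puiseux" where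
  "sgn_puiseux x = (if x = 0 then 0 else if 0 < x then 1 else - 1)"

instance
proof
  fix x y z :: puiseux
  show "x \<noteq> 0 \<Longrightarrow> inverse x * x = 1"
  proof -
    assume x: "x \<noteq> 0"
    then obtain y where y: "x * y = 1" using puiseux_inverse_ex by blast
    have "(THE y. x * y = 1) = y"
    proof (rule the_equality[of "\<lambda>y. x * y = 1", OF y])
      fix z assume z: "x * z = 1"
      have "z = (x * y) * z" using y by simp
      also have "\<dots> = (x * z) * y" by (simp add: mult.commute mult.left_commute)
      finally show "z = y" using z by simp
    qed
    then show ?thesis using x y by (simp add: inverse_puiseux_def mult.commute)
  qed
  show "x div y = x * inverse y" by (rule divide_puiseux_def)
  show "inverse (0::puiseux) = 0" by (simp add: inverse_puiseux_def)
  have asym: "\<not> y < x" if "x < y" for x y :: puiseux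
    using that plead_coeff_uminus[of "x - y"] unfolding less_puiseux_def minus_diff_eq by linarith
  have tr: "x < z" if "x < y" "y < z" for x y z :: puiseux
    using plead_coeff_add_pos[of "z - y" "y - x"] that by (simp add: less_puiseux_def)
  show "x < y \<longleftrightarrow> x \<le> y \<and> \<not> y \<le> x"
    using asym unfolding less_eq_puiseux_def by metis
  show "x \<le> x" by (simp add: less_eq_puiseux_def)
  show "x \<le> y \<Longrightarrow> y \<le> z \<Longrightarrow> x \<le> z"
    using tr unfolding less_eq_puiseux_def by blast
  show "x \<le> y \<Longrightarrow> y \<le> x \<Longrightarrow> x = y"
    using asym unfolding less_eq_puiseux_def by blast
  show "x \<le> y \<or> y \<le> x"
  proof (cases "x = y")
    case False
    then have "plead_coeff (y - x) \<noteq> 0" by (intro plead_coeff_nz) simp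
    then show ?thesis using plead_coeff_uminus[of "y - x"]
      unfolding less_eq_puiseux_def less_puiseux_def minus_diff_eq by linarith
  qed (simp add: less_eq_puiseux_def)
  show "x \<le> y \<Longrightarrow> z + x \<le> z + y"
    by (auto simp: less_eq_puiseux_def less_puiseux_def)
  show "x < y \<Longrightarrow> 0 < z \<Longrightarrow> z * x < z * y"
  proof -
    assume a: "x < y" "0 < z"
    then have nz: "z \<noteq> 0" "y - x \<noteq> 0" by (auto simp: less_puiseux_def)
    have "z * y - z * x = z * (y - x)" by (simp add: algebra_simps)
    then show ?thesis using plead_mult(3)[OF nz] a by (simp add: less_puiseux_def)
  qed
  show "\<bar>x\<bar> = (if x < 0 then - x else x)" by (rule abs_puiseux_def)
  show "sgn x = (if x = 0 then 0 else if 0 < x then 1 else - 1)" by (rule sgn_puiseux_def)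
qed

end

lemma puiseux_pos_iff: "0 < x \<longleftrightarrow> plead_coeff x > 0"
  by (simp add: less_puiseux_def)

instantiation puiseux :: linorder_topology
begin

definition open_puiseux :: "puiseux set \<Rightarrow> bool" where
  "open_puiseux = generate_topology (range (\<lambda>a. {..< a}) \<union> range (\<lambda>a. {a <..}))"

instance by standard (rule open_puiseux_def)

end


section \<open>Convex and semialgebraic sets, and halfspaces, over an ordered field\<close>

text \<open>The library constant \<^const>\<open>convex\<close> refers to real scalars; over \<^typ>\<open>puiseux\<close> the scalars
  have to range over the whole field.\<close>

definition field_convex :: "('a::linordered_field ^ 'n) set \<Rightarrow> bool" where
  "field_convex X \<longleftrightarrow>
     (\<forall>x\<in>X. \<forall>y\<in>X. \<forall>u v. 0 \<le> u \<longrightarrow> 0 \<le> v \<longrightarrow> u + v = 1 \<longrightarrow> u *s x + v *s y \<in> X)"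

text \<open>Polynomials in the variables indexed by \<^typ>\<open>'n\<close> are the finitely supported maps from
  exponent vectors to coefficients.\<close>

type_synonym ('n, 'a) mpolynomial = "('n \<Rightarrow>\<^sub>0 nat) \<Rightarrow>\<^sub>0 'a"

definition mpoly_eval :: "('n, 'a) mpolynomial \<Rightarrow> 'a::comm_ring_1 ^ 'n \<Rightarrow> 'a" where
  "mpoly_eval p x = (\<Sum>m\<in>Poly_Mapping.keys p. Poly_Mapping.lookup p m * (\<Prod>i\<in>UNIV. (x $ i) ^ Poly_Mapping.lookup m i))"

inductive semialgebraic :: "('a::linordered_field ^ 'n) set \<Rightarrow> bool" where
  nonneg: "semialgebraic {x. mpoly_eval p x \<ge> 0}"
| pos: "semialgebraic {x. mpoly_eval p x > 0}"
| compl: "semialgebraic A \<Longrightarrow> semialgebraic (- A)"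
| union: "semialgebraic A \<Longrightarrow> semialgebraic B \<Longrightarrow> semialgebraic (A \<union> B)"
| inter: "semialgebraic A \<Longrightarrow> semialgebraic B \<Longrightarrow> semialgebraic (A \<inter> B)"

text \<open>The coefficient vector \<open>(a\<^sub>0, \<dots>, a\<^sub>d)\<close> is split into \<open>a\<^sub>0\<close> and \<open>(a\<^sub>1, \<dots>, a\<^sub>d)\<close>, here and in the
  tropical setting below.\<close>

definition halfspace :: "'a::linordered_field \<Rightarrow> 'a ^ 'n \<Rightarrow> ('a ^ 'n) set" where
  "halfspace a0 a = {x. a0 + (\<Sum>i\<in>UNIV. a $ i * x $ i) \<ge> 0}"


section \<open>Signed tropical numbers\<close>

datatype tsign = Pl | Mi | Ba

instantiation tsign :: times
begin

fun times_tsign :: "tsign \<Rightarrow> tsign \<Rightarrow> tsign" where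
  "Pl * s = s"
| "Mi * Pl = Mi"
| "Mi * Mi = Pl"
| "Mi * Ba = Ba"
| "Ba * s = Ba"

instance ..

end

text \<open>The symmetrized semiring: \<open>TNum Pl r\<close>, \<open>TNum Mi r\<close> and \<open>TNum Ba r\<close> are \<open>r\<close>, \<open>\<ominus>r\<close> and \<open>\<bullet>r\<close>,
  with norm \<open>r\<close>, and \<open>TZero\<close> is the tropical zero, with norm \<open>-\<infinity>\<close>. Below, \<open>\<oplus>\<close> and \<open>\<odot>\<close> are the
  addition and multiplication of the type. Hence \<open>0\<close> and \<open>1\<close> of this type are \<open>TZero\<close> and the real
  number \<open>0\<close>, respectively.\<close>

datatype symtrop = TZero | TNum tsign real

instantiation symtrop :: "{zero, one, plus, times}"
begin

definition zero_symtrop :: symtrop where "zero_symtrop = TZero"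

definition one_symtrop :: symtrop where "one_symtrop = TNum Pl 0"

fun plus_symtrop :: "symtrop \<Rightarrow> symtrop \<Rightarrow> symtrop" where
  "TZero + y = y"
| "TNum s r + TZero = TNum s r"
| "TNum s r + TNum s' r' =
     (if r > r' then TNum s r
      else if r' > r then TNum s' r'
      else if s = s' then TNum s r
      else TNum Ba r)"

fun times_symtrop :: "symtrop \<Rightarrow> symtrop \<Rightarrow> symtrop" where
  "TZero * y = TZero"
| "TNum s r * TZero = TZero"
| "TNum s r * TNum s' r' = TNum (s * s') (r + r')"

instance ..

end

lemma tsign_mult_assoc: "(a * b) * c = a * (b * (c::tsign))"
  by (cases a; cases b; cases c) simp_all

lemma tsign_mult_commute: "a * b = b * (a::tsign)"
  by (cases a; cases b) simp_all

lemma tsign_distrib: "s \<noteq> s' \<Longrightarrow> s * t = s' * t \<Longrightarrow> s * t = Ba"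
  by (cases s; cases s'; cases t) simp_all

instance symtrop :: comm_semiring_1
proof
  fix x y z :: symtrop
  show "x + y + z = x + (y + z)" by (cases x; cases y; cases z) auto
  show "x + y = y + x" by (cases x; cases y) auto
  show "0 + x = x" "0 * x = 0" by (simp_all add: zero_symtrop_def)
  show "x * 0 = 0" by (cases x) (simp_all add: zero_symtrop_def)
  show "x * y * z = x * (y * z)" by (cases x; cases y; cases z) (auto simp: tsign_mult_assoc)
  show "x * y = y * x" by (cases x; cases y) (auto simp: tsign_mult_commute)
  show "1 * x = x" by (cases x) (auto simp: one_symtrop_def)
  show "(x + y) * z = x * z + y * z"
    by (cases x; cases y; cases z) (auto dest: tsign_distrib)
  show "(0::symtrop) \<noteq> 1" by (simp add: zero_symtrop_def one_symtrop_def)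
qed

definition tpositive :: "symtrop set" where
  "tpositive = range (TNum Pl)"

definition tnegative :: "symtrop set" where
  "tnegative = range (TNum Mi)"

definition tsigned :: "symtrop set" where
  "tsigned = tpositive \<union> tnegative \<union> {0}"

definition tbalanced :: "symtrop set" where
  "tbalanced = range (TNum Ba) \<union> {0}"

definition tsigned_vec :: "(symtrop ^ 'n) set" where
  "tsigned_vec = {x. \<forall>i. x $ i \<in> tsigned}"

definition trop_halfspace :: "symtrop \<Rightarrow> symtrop ^ 'n \<Rightarrow> (symtrop ^ 'n) set" where
  "trop_halfspace a0 a =
     {x \<in> tsigned_vec. a0 + (\<Sum>i\<in>UNIV. a $ i * x $ i) \<in> tpositive \<union> tbalanced}"

definition closed_trop_halfspaces :: "(symtrop ^ 'n) set set" where
  "closed_trop_halfspaces =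
     {trop_halfspace a0 a | a0 a. a0 \<in> tsigned \<and> a \<in> tsigned_vec \<and> a \<noteq> 0}"

definition sval :: "puiseux \<Rightarrow> symtrop" where
  "sval x = (if x = 0 then 0 else if x > 0 then TNum Pl (lead_exp x) else TNum Mi (lead_exp x))"

definition sval_vec :: "puiseux ^ 'n \<Rightarrow> symtrop ^ 'n" where
  "sval_vec x = (\<chi> i. sval (x $ i))"

end

theory Submission
  imports Defs "HOL-Library.Multiset_Order"
begin

text \<open>Lifting \<open>y\<close> to all series of the given signed valuation turns the tropical separation of \<open>y\<close> from
  \<open>sval X\<close> into the separation of \<open>X\<close> from the union of the boxes \<open>B\<^sub>n\<close> that consist of the vectors with
  coordinates between \<open>1/n\<close> and \<open>n\<close> times the coordinates of a fixed lift, where \<open>n\<close> is real. This union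
  is not definable, but since \<open>X\<close> is semialgebraic and misses every \<open>B\<^sub>n\<close>, it also misses \<open>B\<^sub>N\<close> for some
  infinitely large \<open>N\<close>. A pair of nearest points of \<open>X\<close> and \<open>B\<^sub>N\<close> gives an affine function that is
  nonnegative on \<open>X\<close> and negative on \<open>B\<^sub>N\<close>, and a function that is negative on all lifts of \<open>y\<close> is
  tropically negative at \<open>y\<close>.

  Both the overspill and the existence of nearest points rest on suprema of definable sets, that is, on
  quantifier elimination over a real closed field and on the intermediate value property for
  polynomials over the Puiseux series.\<close>

section \<open>Polynomials over real closed fields\<close>

text \<open>For each real \<open>n\<close> the box could be separated from \<open>X\<close> on its
  own, but the halfspace would depend on \<open>n\<close>, and the field is neither order complete
  nor locally compact, so no limit of these halfspaces is at hand. One definable box that contains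
  all of them removes this dependence; since it is closed and bounded, nearest points can be sought
  in it.

  The step back to \<open>y\<close> rests on cancellation being unstable: where leading terms of
  both signs meet in a balanced tropical sum, reweighting the coordinates by positive reals makes
  the positive ones win. All reweighted lifts lie in the box, so negativity on the box excludes
  positive and balanced values at \<open>y\<close>.

  Quantifier elimination is done without a syntax of formulas: a predicate counts as definable if
  the signs of finitely many polynomials determine its truth.

  The intermediate value property of the series is proved by induction on the multiplicity of a zero
  of the residue polynomial over the reals. The exponents lie in no common lattice, so a step of
  this Newton polygon argument rescales by an arbitrary real power of \<open>t\<close>; termination
  comes from the multiplicity alone.\<close>

text \<open>The axiom is stated with sums since the type \<open>'a poly\<close> is not available in a class
  specification.\<close>

class real_closed_field = linordered_field +
  assumes intermediate_value_sum:
    "a < b \<Longrightarrow> (\<Sum>k\<le>n. f k * a ^ k) < 0 \<Longrightarrow> 0 < (\<Sum>k\<le>n. f k * b ^ k)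
      \<Longrightarrow> \<exists>x. a < x \<and> x < b \<and> (\<Sum>k\<le>n. f k * x ^ k) = 0"

lemma poly_intermediate_value:
  fixes p :: "'a::real_closed_field poly"
  assumes "a < b" "poly p a * poly p b < 0"
  shows "\<exists>x. a < x \<and> x < b \<and> poly p x = 0"
proof -
  have *: "\<exists>x. a < x \<and> x < b \<and> poly q x = 0" if "poly q a < 0" "0 < poly q b" for q
    using intermediate_value_sum[OF assms(1), where n = "degree q" and f = "coeff q"] that
    by (simp add: poly_altdef)
  show ?thesis
    using assms(2) *[of p] *[of "- p"] by (auto simp: mult_less_0_iff)
qed

section \<open>Constancy of signs, Rolle's theorem, and signs at infinity\<close>

lemma sgn_poly_eq:
  fixes p :: "'a::real_closed_field poly"
  assumes "\<And>x. min a b \<le> x \<Longrightarrow> x \<le> max a b \<Longrightarrow> poly p x \<noteq> 0"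
  shows "sgn (poly p a) = sgn (poly p b)"
proof (rule ccontr)
  assume "sgn (poly p a) \<noteq> sgn (poly p b)"
  moreover have "poly p a \<noteq> 0" "poly p b \<noteq> 0" using assms by auto
  ultimately have neg: "poly p a * poly p b < 0" and "a \<noteq> b"
    by (auto simp: sgn_if mult_less_0_iff split: if_splits)
  then consider "a < b" | "b < a" by linarith
  then show False
  proof cases
    case 1
    with poly_intermediate_value[OF this neg] show False using assms by force
  next
    case 2
    have "poly p b * poly p a < 0" using neg by (simp add: mult.commute)
    with poly_intermediate_value[OF 2 this] show False using assms 2 by force
  qed
qed

text \<open>The argument is algebraic. With \<open>c\<close> the next zero after \<open>a\<close>,
  the polynomial is a product of a power of \<open>X - a\<close>, a power of \<open>X - c\<close>
  and a factor \<open>s\<close> without zeros on the closed interval. Lowering both powers by one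
  leaves a cofactor \<open>W\<close> of the derivative, and \<open>W\<close> has opposite signs at
  \<open>a\<close> and \<open>c\<close>.\<close>

lemma poly_Rolle:
  fixes p :: "'a::real_closed_field poly"
  assumes "a < b" "poly p a = 0" "poly p b = 0"
  shows "\<exists>x. a < x \<and> x < b \<and> poly (pderiv p) x = 0"
proof (cases "p = 0")
  case True
  then show ?thesis using dense[OF assms(1)] by auto
next
  case False
  define R where "R = {x. poly p x = 0 \<and> a < x \<and> x \<le> b}"
  have R: "finite R" "R \<noteq> {}"
    using poly_roots_finite[OF False] assms by (auto simp: R_def)
  define c where "c = Min R"
  have c: "poly p c = 0" "a < c" "c \<le> b" using Min_in[OF R] by (auto simp: c_def R_def)
  have min: "poly p x \<noteq> 0" if "a < x" "x < c" for x
  proof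
    assume "poly p x = 0"
    then have "x \<in> R" using that c by (auto simp: R_def)
    then show False using Min_le[OF R(1)] that by (force simp: c_def)
  qed
  define A B where "A = [:-a, 1:]" and "B = [:-c, 1:]"
  obtain q where q: "p = A ^ order a p * q" "\<not> A dvd q"
    using order_decomp[OF False] unfolding A_def by blast
  have "q \<noteq> 0" using q False by auto
  then obtain s where s: "q = B ^ order c q * s" "\<not> B dvd s"
    using order_decomp[of q c] unfolding B_def by blast
  have qa: "poly q a \<noteq> 0" using q(2) by (simp add: A_def poly_eq_0_iff_dvd)
  have qc: "poly q c = 0"
    using c by (subst (asm) q(1)) (auto simp: A_def)
  have sc: "poly s c \<noteq> 0" using s(2) by (simp add: B_def poly_eq_0_iff_dvd)
  have sa: "poly s a \<noteq> 0"
    using qa by (subst (asm) s(1)) auto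
  obtain m where m: "order a p = Suc m"
    using assms(2) False by (metis order_root not0_implies_Suc)
  obtain n where n: "order c q = Suc n"
    using qc \<open>q \<noteq> 0\<close> by (metis order_root not0_implies_Suc)
  have p: "p = A ^ Suc m * (B ^ Suc n * s)" using q(1) s(1) m n by simp
  have snz: "poly s x \<noteq> 0" if "min a c \<le> x" "x \<le> max a c" for x
  proof (cases "x = a \<or> x = c")
    case False
    then have "poly p x \<noteq> 0" using that c by (intro min) auto
    then show ?thesis by (auto simp: p)
  qed (use sa sc in auto)
  have sgn: "sgn (poly s a) = sgn (poly s c)" by (rule sgn_poly_eq) (use snz in auto)
  \<comment> \<open>At \<open>a\<close> only the first summand survives and at \<open>c\<close> only
    the second. Their factors \<open>a - c\<close> and \<open>c - a\<close> have opposite signs,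
    while \<open>s\<close> keeps its sign.\<close>
  define W where "W = smult (of_nat (Suc m)) (B * s) + smult (of_nat (Suc n)) (A * s) + A * B * pderiv s"
  have dA: "pderiv A = 1" "pderiv B = 1" by (simp_all add: A_def B_def pderiv_pCons)
  have W: "pderiv p = A ^ m * B ^ n * W"
    unfolding p W_def pderiv_mult pderiv_power_Suc dA
    by (simp add: algebra_simps smult_add_right)
  have ring: "(M * (a - c) * u) * (N * (c - a) * v) = - (M * N * ((c - a) * (c - a)) * (u * v))"
    for M N u v by (simp add: algebra_simps)
  have "poly W a = of_nat (Suc m) * (a - c) * poly s a"
    "poly W c = of_nat (Suc n) * (c - a) * poly s c"
    by (simp_all add: W_def A_def B_def algebra_simps)
  then have "poly W a * poly W c
    = - (of_nat (Suc m) * of_nat (Suc n) * ((c - a) * (c - a)) * (poly s a * poly s c))"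
    by (simp only: ring)
  also have "\<dots> < 0"
  proof -
    have "poly s a * poly s c > 0" using sgn sa sc by (auto simp: sgn_if zero_less_mult_iff split: if_splits)
    moreover have "(c - a) * (c - a) > 0" using c by simp
    moreover have "(of_nat (Suc m) * of_nat (Suc n) :: 'a) > 0" by (metis of_nat_0_less_iff of_nat_mult zero_less_Suc mult_pos_pos)
    ultimately show ?thesis by (metis mult_pos_pos neg_less_0_iff_less)
  qed
  finally obtain x where "a < x" "x < c" "poly W x = 0"
    using poly_intermediate_value c by blast
  then show ?thesis using c by (intro exI[of _ x]) (auto simp: W)
qed

text \<open>A second zero in the closed interval would give a zero of the derivative strictly in
  between by Rolle. Hence the cofactor of \<open>X - c\<close> keeps one sign, also at the ends,
  where the derivative may vanish.\<close>

lemma sgn_poly_simple_root: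
  fixes p :: "'a::real_closed_field poly"
  assumes nz: "\<And>x. a < x \<Longrightarrow> x < b \<Longrightarrow> poly (pderiv p) x \<noteq> 0"
    and c: "a < c" "c < b" "poly p c = 0"
  shows "\<exists>s. s \<noteq> 0 \<and> (\<forall>x. a \<le> x \<longrightarrow> x \<le> b \<longrightarrow> sgn (poly p x) = sgn (x - c) * s)"
proof -
  obtain q where q: "p = [:-c, 1:] * q" using c(3) by (auto simp: poly_eq_0_iff_dvd)
  have "poly (pderiv p) c = poly q c" 
    by (simp only: q pderiv_mult) (simp add: pderiv_pCons)
  then have qc: "poly q c \<noteq> 0" using nz c by auto
  have qnz: "poly q x \<noteq> 0" if x: "a \<le> x" "x \<le> b" for x
  proof
    assume "poly q x = 0"
    then have px: "poly p x = 0" and "x \<noteq> c" using qc by (auto simp: q)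
    then consider "x < c" | "c < x" by linarith
    then show False
    proof cases
      case 1
      then obtain z where "x < z" "z < c" "poly (pderiv p) z = 0" using poly_Rolle px c(3) by blast
      then show False using nz x c by (meson le_less_trans less_trans)
    next
      case 2
      then obtain z where "c < z" "z < x" "poly (pderiv p) z = 0" using poly_Rolle px c(3) by blast
      then show False using nz x c by (meson less_le_trans less_trans)
    qed
  qed
  have qs: "sgn (poly q x) = sgn (poly q c)" if "a \<le> x" "x \<le> b" for x
    by (rule sgn_poly_eq) (use that c qnz in auto)
  have "sgn (poly p x) = sgn (x - c) * sgn (poly q c)" if "a \<le> x" "x \<le> b" for x
  proof -
    have "poly p x = (x - c) * poly q x" by (simp add: q algebra_simps)
    then show ?thesis using qs[OF that] by (simp add: sgn_mult)
  qed
  moreover have "sgn (poly q c) \<noteq> 0" using qc by (simp add: sgn_eq_0_iff)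
  ultimately show ?thesis by blast
qed

text \<open>A positive lower bound instead of mere positivity makes the induction work: multiplied
  by a large \<open>x\<close>, it outweighs the new constant coefficient.\<close>

lemma poly_at_top_bound:
  fixes p :: "'a::linordered_field poly"
  assumes "p \<noteq> 0"
  shows "\<exists>\<delta>>0. \<exists>M. \<forall>x\<ge>M. \<delta> \<le> sgn (lead_coeff p) * poly p x"
  using assms
proof (induction p)
  case (pCons a p)
  show ?case
  proof (cases "p = 0")
    case True
    then show ?thesis using pCons by (intro exI[of _ "\<bar>a\<bar>"]) (auto simp: sgn_mult_self_eq abs_sgn mult.commute sgn_if)
  next
    case False
    then obtain \<delta> M where d: "\<delta> > 0" "\<And>x. M \<le> x \<Longrightarrow> \<delta> \<le> sgn (lead_coeff p) * poly p x"
      using pCons by blast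
    let ?s = "sgn (lead_coeff p)"
    have s: "\<bar>?s\<bar> = 1" using False by (simp add: abs_sgn_eq)
    have "1 \<le> sgn (lead_coeff (pCons a p)) * poly (pCons a p) x"
      \<comment> \<open>The last threshold gives \<open>x * \<delta>\<close> at least
        \<open>\<bar>a\<bar> + 1\<close>, which leaves 1 after the loss of
        \<open>\<bar>a\<bar>\<close>.\<close>
      if x: "max (max M 0) ((\<bar>a\<bar> + 1) / \<delta>) \<le> x" for x
    proof -
      have "\<bar>a\<bar> + 1 \<le> x * \<delta>" using x d(1) by (simp add: pos_divide_le_eq)
      also have "\<dots> \<le> x * (?s * poly p x)" using x d(2) by (intro mult_left_mono) auto
      finally have "1 \<le> x * (?s * poly p x) - \<bar>?s * a\<bar>" using s by (simp add: abs_mult)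
      also have "\<dots> \<le> x * (?s * poly p x) + ?s * a" using abs_ge_minus_self[of "?s * a"] by linarith
      finally show ?thesis using False by (simp add: algebra_simps)
    qed
    then show ?thesis by (meson zero_less_one)
  qed
qed simp

lemma sgn_poly_at_top:
  fixes p :: "'a::linordered_field poly"
  assumes "p \<noteq> 0"
  shows "\<exists>M. \<forall>x\<ge>M. sgn (poly p x) = sgn (lead_coeff p)"
proof -
  obtain \<delta> M where "\<delta> > 0" "\<And>x. x \<ge> M \<Longrightarrow> \<delta> \<le> sgn (lead_coeff p) * poly p x"
    using poly_at_top_bound[OF assms] by blast
  then have "0 < sgn (lead_coeff p) * poly p x" if "x \<ge> M" for x using that by (meson less_le_trans)
  then have "sgn (poly p x) = sgn (lead_coeff p)" if "x \<ge> M" for x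
    using that assms by (cases "lead_coeff p" "0 :: 'a" rule: linorder_cases) (fastforce simp: zero_less_mult_iff)+
  then show ?thesis by blast
qed

lemma sgn_poly_at_bot:
  fixes p :: "'a::linordered_field poly"
  assumes "p \<noteq> 0"
  shows "\<exists>M. \<forall>x\<le>M. sgn (poly p x) = sgn (lead_coeff p) * (-1) ^ degree p"
proof -
  let ?q = "pcompose p [:0, -1:]"
  have "lead_coeff ?q = lead_coeff p * (-1) ^ degree p" by (subst lead_coeff_comp) auto
  moreover have "?q \<noteq> 0" using assms by (simp add: pcompose_eq_0_iff)
  ultimately obtain M where M: "\<And>x. x \<ge> M \<Longrightarrow> sgn (poly p (- x)) = sgn (lead_coeff p * (-1) ^ degree p)"
    using sgn_poly_at_top[of ?q] by (auto simp: poly_pcompose)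
  have "sgn ((-1::'a) ^ k) = (-1) ^ k" for k by (cases "even k") auto
  then have "sgn (poly p x) = sgn (lead_coeff p) * (-1) ^ degree p" if "x \<le> - M" for x
    using M[of "- x"] that by (simp add: sgn_mult)
  then show ?thesis by blast
qed

text \<open>By Rolle each polynomial has at most one zero in the interior, and the signs at the ends
  decide whether it has one. So \<open>p\<close> and \<open>q\<close> have interior zeros together.
  If they do, a map that sends one zero to the other matches the signs; if not,
  \<open>\<phi>\<close> itself does.\<close>

lemma sign_matching_on_interval:
  fixes p q :: "'a::real_closed_field poly"
  assumes \<phi>: "strict_mono \<phi>" "surj \<phi>" and ab: "a < b"
    and p': "\<And>x. a < x \<Longrightarrow> x < b \<Longrightarrow> poly (pderiv p) x \<noteq> 0"
    and q': "\<And>x. \<phi> a < x \<Longrightarrow> x < \<phi> b \<Longrightarrow> poly (pderiv q) x \<noteq> 0"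
    and ends: "sgn (poly p a) = sgn (poly q (\<phi> a))" "sgn (poly p b) = sgn (poly q (\<phi> b))"
  shows "\<exists>\<psi>. strict_mono_on {a..b} \<psi> \<and> \<psi> ` {a..b} = {\<phi> a..\<phi> b} \<and> \<psi> a = \<phi> a \<and> \<psi> b = \<phi> b \<and>
    (\<forall>x\<in>{a..b}. sgn (poly p x) = sgn (poly q (\<psi> x)))"
proof (cases "\<exists>c. a < c \<and> c < b \<and> poly p c = 0")
  case True
  then obtain c where c: "a < c" "c < b" "poly p c = 0" by blast
  obtain s where s: "s \<noteq> 0" "\<And>x. a \<le> x \<Longrightarrow> x \<le> b \<Longrightarrow> sgn (poly p x) = sgn (x - c) * s"
    using sgn_poly_simple_root[OF p' c] by blast
  have pa: "sgn (poly p a) = - s" "sgn (poly p b) = s" using s c by auto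
  have "\<bar>s\<bar> = 1" using pa(2) s(1) by (auto simp: sgn_if split: if_splits)
  then have "sgn (poly q (\<phi> a) * poly q (\<phi> b)) = - 1"
    using ends pa by (auto simp: sgn_mult abs_if split: if_splits)
  then have "poly q (\<phi> a) * poly q (\<phi> b) < 0" by (simp add: sgn_1_neg)
  then obtain d where d: "\<phi> a < d" "d < \<phi> b" "poly q d = 0"
    using poly_intermediate_value \<phi>(1) ab by (metis strict_monoD)
  obtain s' where s': "s' \<noteq> 0" "\<And>x. \<phi> a \<le> x \<Longrightarrow> x \<le> \<phi> b \<Longrightarrow> sgn (poly q x) = sgn (x - d) * s'"
    using sgn_poly_simple_root[OF q' d] by blast
  have ss: "s' = s" using s'(2)[of "\<phi> b"] d ends pa ab by auto
  \<comment> \<open>Piecewise linear with \<open>a\<close>, \<open>c\<close>, \<open>b\<close> sent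
    to \<open>\<phi> a\<close>, \<open>d\<close>, \<open>\<phi> b\<close>.\<close>
  define \<psi> where "\<psi> x = (if x \<le> c then \<phi> a + (x - a) * ((d - \<phi> a) / (c - a))
     else d + (x - c) * ((\<phi> b - d) / (b - c)))" for x
  define k l where "k = (d - \<phi> a) / (c - a)" and "l = (\<phi> b - d) / (b - c)"
  have kl: "k > 0" "l > 0" using c d by (simp_all add: k_def l_def)
  have kc: "\<phi> a + (c - a) * k = d" "d + (b - c) * l = \<phi> b" using c by (simp_all add: k_def l_def)
  have \<psi>: "\<psi> x = (if x \<le> c then \<phi> a + (x - a) * k else d + (x - c) * l)" for x
    by (simp add: \<psi>_def k_def l_def)
  have \<psi>1: "\<psi> x \<le> d" if "x \<le> c" for x
  proof -
    have "(x - a) * k \<le> (c - a) * k" using that kl by (intro mult_right_mono) auto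
    then show ?thesis using that kc by (simp add: \<psi>)
  qed
  have \<psi>2: "d < \<psi> x" if "c < x" for x using that kl by (simp add: \<psi>)
  have mono: "strict_mono \<psi>"
  proof (rule strict_monoI)
    fix x y :: 'a assume xy: "x < y"
    consider "y \<le> c" | "x \<le> c" "c < y" | "c < x" using xy by linarith
    then show "\<psi> x < \<psi> y"
    proof cases
      case 2 then show ?thesis using \<psi>1[of x] \<psi>2[of y] by simp
    qed (use xy kl in \<open>auto simp: \<psi>\<close>)
  qed
  have ends': "\<psi> a = \<phi> a" "\<psi> b = \<phi> b" using c kc by (simp_all add: \<psi>)
  have img: "\<psi> ` {a..b} = {\<phi> a..\<phi> b}"
  proof (intro equalityI subsetI)
    fix y assume "y \<in> \<psi> ` {a..b}"
    then show "y \<in> {\<phi> a..\<phi> b}"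
      using mono unfolding ends'[symmetric] by (auto simp: strict_mono_less_eq)
  next
    fix y assume y: "y \<in> {\<phi> a..\<phi> b}"
    show "y \<in> \<psi> ` {a..b}"
    proof (cases "y \<le> d")
      case True
      let ?x = "a + (y - \<phi> a) / k"
      have "(y - \<phi> a) / k \<le> c - a" using True kc kl by (simp add: pos_divide_le_eq)
      then have "?x \<le> c" "a \<le> ?x" using y kl by auto
      moreover have "\<psi> ?x = y" using \<open>?x \<le> c\<close> kl by (simp add: \<psi>)
      ultimately show ?thesis using c by (intro image_eqI[of _ _ ?x]) auto
    next
      case False
      let ?x = "c + (y - d) / l"
      have "(y - d) / l \<le> b - c" using y kc kl by (simp add: pos_divide_le_eq)
      then have "c < ?x" "?x \<le> b" using False kl by auto
      moreover have "\<psi> ?x = y" using \<open>c < ?x\<close> kl by (simp add: \<psi>)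
      ultimately show ?thesis using c by (intro image_eqI[of _ _ ?x]) auto
    qed
  qed
  have "sgn (poly p x) = sgn (poly q (\<psi> x))" if x: "x \<in> {a..b}" for x
  proof -
    have "\<psi> x \<in> {\<phi> a..\<phi> b}" using x img by blast
    moreover have "\<psi> c = d" using kc by (simp add: \<psi>)
    then have "sgn (\<psi> x - d) = sgn (x - c)"
      using mono by (auto simp: sgn_if strict_mono_less strict_mono_eq)
    ultimately show ?thesis using x s(2)[of x] s'(2)[of "\<psi> x"] ss by simp
  qed
  then show ?thesis using mono img ends' by (intro exI[of _ \<psi>]) (auto intro: monotone_on_subset)
next
  case False
  have noq: "\<not> (\<phi> a < d \<and> d < \<phi> b \<and> poly q d = 0)" for d
  proof
    assume d: "\<phi> a < d \<and> d < \<phi> b \<and> poly q d = 0"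
    obtain s where s: "s \<noteq> 0" "\<And>x. \<phi> a \<le> x \<Longrightarrow> x \<le> \<phi> b \<Longrightarrow> sgn (poly q x) = sgn (x - d) * s"
      using sgn_poly_simple_root[OF q'] d by blast
    have "\<phi> a < \<phi> b" using ab \<phi> by (simp add: strict_mono_less)
    then have pa: "sgn (poly p a) = - s" "sgn (poly p b) = s" using s d ends by auto
    have "\<bar>s\<bar> = 1" using pa(2) s(1) by (auto simp: sgn_if split: if_splits)
    then have "sgn (poly p a * poly p b) = - 1" using pa by (auto simp: sgn_mult abs_if split: if_splits)
    then have "poly p a * poly p b < 0" by (simp add: sgn_1_neg)
    then show False using poly_intermediate_value[OF ab] False by blast
  qed
  have "sgn (poly p x) = sgn (poly q (\<phi> x))" if x: "x \<in> {a..b}" for x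
  proof (cases "x = a \<or> x = b")
    case False
    then have x: "a < x" "x < b" using x by auto
    then have fx: "\<phi> a < \<phi> x" "\<phi> x < \<phi> b" using \<phi> by (auto simp: strict_mono_less)
    show ?thesis
    proof (cases "poly p a = 0")
      case pa: True
      \<comment> \<open>By Rolle the two ends cannot both be zeros; the sign at the other end
        prevails in the interior.\<close>
      then have pb: "poly p b \<noteq> 0" using poly_Rolle[OF ab] p' by blast
      then have qb: "poly q (\<phi> b) \<noteq> 0" using ends by (metis sgn_eq_0_iff)
      have "sgn (poly p x) = sgn (poly p b)"
        by (rule sgn_poly_eq) (use x pb \<open>\<not> (\<exists>c. a < c \<and> c < b \<and> poly p c = 0)\<close> in \<open>force simp: le_less\<close>)
      moreover have "sgn (poly q (\<phi> x)) = sgn (poly q (\<phi> b))"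
        by (rule sgn_poly_eq) (use fx qb noq in \<open>force simp: le_less\<close>)
      ultimately show ?thesis using ends by simp
    next
      case pa: False
      then have qa: "poly q (\<phi> a) \<noteq> 0" using ends by (metis sgn_eq_0_iff)
      have "sgn (poly p x) = sgn (poly p a)"
        by (rule sgn_poly_eq) (use x pa \<open>\<not> (\<exists>c. a < c \<and> c < b \<and> poly p c = 0)\<close> in \<open>force simp: le_less\<close>)
      moreover have "sgn (poly q (\<phi> x)) = sgn (poly q (\<phi> a))"
        by (rule sgn_poly_eq) (use fx qa noq in \<open>force simp: le_less\<close>)
      ultimately show ?thesis using ends by simp
    qed
  qed (use ends in auto)
  moreover have "\<phi> ` {a..b} = {\<phi> a..\<phi> b}"
  proof (intro equalityI subsetI)
    fix y assume y: "y \<in> {\<phi> a..\<phi> b}"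
    obtain x where "y = \<phi> x" using \<phi>(2) by (meson surjD)
    then show "y \<in> \<phi> ` {a..b}" using y \<phi>(1) by (auto simp: strict_mono_less_eq)
  qed (use \<phi>(1) in \<open>auto simp: strict_mono_less_eq\<close>)
  ultimately show ?thesis using \<phi>(1) by (intro exI[of _ \<phi>]) (auto intro: monotone_on_subset)
qed

text \<open>Adds one pair to a matched family \<open>H\<close> that contains the derivatives. The
  zeros of the first components of \<open>H\<close> cut the line into gaps without zeros of
  \<open>pderiv p\<close>; there the map is rebuilt so as to match the signs of \<open>p\<close> and
  \<open>q\<close> too. It is kept at the cut points, and it maps each gap onto the same image as
  before, so the signs of \<open>H\<close> stay matched. Degrees and leading signs take care of both
  unbounded ends.\<close>

lemma sign_matching_extend:
  fixes p q :: "'a::real_closed_field poly"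
  assumes \<phi>: "strict_mono \<phi>" "surj \<phi>" and H: "finite H"
    and nz: "\<And>r s. (r, s) \<in> H \<Longrightarrow> r \<noteq> 0 \<and> s \<noteq> 0"
    and deriv: "(pderiv p, pderiv q) \<in> H"
    and match: "\<And>r s x. (r, s) \<in> H \<Longrightarrow> sgn (poly r x) = sgn (poly s (\<phi> x))"
    and roots: "\<And>r s z. (r, s) \<in> H \<Longrightarrow> poly r z = 0 \<Longrightarrow> sgn (poly p z) = sgn (poly q (\<phi> z))"
    and lead: "degree p = degree q" "sgn (lead_coeff p) = sgn (lead_coeff q)"
  shows "\<exists>\<psi>. strict_mono \<psi> \<and> surj \<psi> \<and>
    (\<forall>(r, s)\<in>insert (p, q) H. \<forall>x. sgn (poly r x) = sgn (poly s (\<psi> x)))"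
proof -
  have inj: "\<phi> x < \<phi> y \<longleftrightarrow> x < y" "\<phi> x \<le> \<phi> y \<longleftrightarrow> x \<le> y" "\<phi> x = \<phi> y \<longleftrightarrow> x = y" for x y
    using \<phi>(1) by (simp_all add: strict_mono_less strict_mono_less_eq strict_mono_eq)
  have pq: "p \<noteq> 0" "q \<noteq> 0" using nz[OF deriv] by auto
  define Z0 where "Z0 = (\<Union>(r, s)\<in>H. {z. poly r z = 0})"
  have Z0: "finite Z0"
    unfolding Z0_def by (rule finite_UN_I[OF H]) (auto dest: nz simp: poly_roots_finite)
  obtain M1 M2 N1 N2 where tail:
    "\<And>x. x \<ge> M1 \<Longrightarrow> sgn (poly p x) = sgn (lead_coeff p)"
    "\<And>x. x \<ge> M2 \<Longrightarrow> sgn (poly q x) = sgn (lead_coeff q)"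
    "\<And>x. x \<le> N1 \<Longrightarrow> sgn (poly p x) = sgn (lead_coeff p) * (-1) ^ degree p"
    "\<And>x. x \<le> N2 \<Longrightarrow> sgn (poly q x) = sgn (lead_coeff q) * (-1) ^ degree q"
    using sgn_poly_at_top[OF pq(1)] sgn_poly_at_top[OF pq(2)]
      sgn_poly_at_bot[OF pq(1)] sgn_poly_at_bot[OF pq(2)] by metis
  obtain M2' N2' where pre: "\<phi> M2' = M2" "\<phi> N2' = N2" using \<phi>(2) by (metis surjD)
  \<comment> \<open>All zeros lie between \<open>m\<close> and \<open>M\<close>, and outside both
    \<open>p\<close> and, after transport by \<open>\<phi>\<close>, \<open>q\<close> have their
    asymptotic signs. The entry \<open>m + 1\<close> in \<open>M\<close> ensures
    \<open>m < M\<close>, so that there is at least one gap.\<close>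
  define m where "m = Min (insert N1 (insert N2' Z0))"
  define M where "M = Max (insert M1 (insert M2' (insert (m + 1) Z0)))"
  define Z where "Z = insert m (insert M Z0)"
  have m: "m \<le> N1" "m \<le> N2'" "\<And>z. z \<in> Z0 \<Longrightarrow> m \<le> z" using Z0 by (auto simp: m_def simp del: Min_insert intro!: Min_le)
  have M: "M \<ge> M1" "M \<ge> M2'" "\<And>z. z \<in> Z0 \<Longrightarrow> z \<le> M" "m + 1 \<le> M" using Z0 by (auto simp: M_def simp del: Max_insert intro!: Max_ge)
  then have "m < M" by (meson less_add_one less_le_trans)
  have Z: "finite Z" "m \<in> Z" "M \<in> Z" "Z0 \<subseteq> Z" "\<And>z. z \<in> Z \<Longrightarrow> m \<le> z \<and> z \<le> M"
    using Z0 m M \<open>m < M\<close> by (auto simp: Z_def)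
  have below: "sgn (poly p x) = sgn (poly q (\<phi> x))" if "x \<le> m" for x
  proof -
    have "\<phi> x \<le> N2" using that m pre inj by (metis order_trans)
    then show ?thesis using tail that m lead by (metis order_trans)
  qed
  have above: "sgn (poly p x) = sgn (poly q (\<phi> x))" if "x \<ge> M" for x
  proof -
    have "\<phi> x \<ge> M2" using that M pre inj by (metis order_trans)
    then show ?thesis using tail that M lead by (metis order_trans)
  qed
  have knots: "sgn (poly p z) = sgn (poly q (\<phi> z))" if "z \<in> Z" for z
    using that below[of z] above[of z] roots by (auto simp: Z_def Z0_def)
  have rZ: "r \<in> fst ` H \<Longrightarrow> poly r x = 0 \<Longrightarrow> x \<in> Z" for r x using Z(4) by (force simp: Z0_def)
  have sZ: "poly s (\<phi> x) = 0 \<Longrightarrow> x \<in> Z" if "(r, s) \<in> H" for r s x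
    using match[OF that, of x] rZ[of r x] that by (force simp: sgn_eq_0_iff)
  define consec where "consec a b \<longleftrightarrow> a \<in> Z \<and> b \<in> Z \<and> a < b \<and> (\<forall>z\<in>Z. z \<le> a \<or> b \<le> z)" for a b
  have "\<exists>\<psi>. strict_mono_on {a..b} \<psi> \<and> \<psi> ` {a..b} = {\<phi> a..\<phi> b} \<and> \<psi> a = \<phi> a \<and> \<psi> b = \<phi> b \<and>
    (\<forall>x\<in>{a..b}. sgn (poly p x) = sgn (poly q (\<psi> x)))" if ab: "consec a b" for a b
  proof (rule sign_matching_on_interval[OF \<phi>])
    fix x assume "a < x" "x < b"
    then have "x \<notin> Z" using ab by (auto simp: consec_def)
    then show "poly (pderiv p) x \<noteq> 0" using rZ deriv by force
  next
    fix y assume y: "\<phi> a < y" "y < \<phi> b"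
    obtain x where x: "y = \<phi> x" using \<phi>(2) by (metis surjD)
    then have "x \<notin> Z" using ab y inj by (auto simp: consec_def)
    then show "poly (pderiv q) y \<noteq> 0" using sZ[OF deriv] x by blast
  qed (use ab knots in \<open>auto simp: consec_def\<close>)
  then obtain F where F: "\<And>a b. consec a b \<Longrightarrow> strict_mono_on {a..b} (F a b)"
    "\<And>a b. consec a b \<Longrightarrow> F a b ` {a..b} = {\<phi> a..\<phi> b}"
    "\<And>a b. consec a b \<Longrightarrow> F a b a = \<phi> a" "\<And>a b. consec a b \<Longrightarrow> F a b b = \<phi> b"
    "\<And>a b x. consec a b \<Longrightarrow> x \<in> {a..b} \<Longrightarrow> sgn (poly p x) = sgn (poly q (F a b x))"
    by metis
  define lo where "lo x = Max {z\<in>Z. z \<le> x}" for x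
  define hi where "hi x = Min {z\<in>Z. x < z}" for x
  have lo: "lo x \<in> Z" "lo x \<le> x" "\<And>z. z \<in> Z \<Longrightarrow> z \<le> x \<Longrightarrow> z \<le> lo x" if "m \<le> x" for x
  proof -
    have f: "finite {z\<in>Z. z \<le> x}" "{z\<in>Z. z \<le> x} \<noteq> {}" using Z that by auto
    show "lo x \<in> Z" "lo x \<le> x" using Max_in[OF f] by (auto simp: lo_def)
    show "\<And>z. z \<in> Z \<Longrightarrow> z \<le> x \<Longrightarrow> z \<le> lo x" using f by (auto simp: lo_def)
  qed
  have hi: "hi x \<in> Z" "x < hi x" "\<And>z. z \<in> Z \<Longrightarrow> x < z \<Longrightarrow> hi x \<le> z" if "x < M" for x
  proof -
    have f: "finite {z\<in>Z. x < z}" "{z\<in>Z. x < z} \<noteq> {}" using Z that by auto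
    show "hi x \<in> Z" "x < hi x" using Min_in[OF f] by (auto simp: hi_def)
    show "\<And>z. z \<in> Z \<Longrightarrow> x < z \<Longrightarrow> hi x \<le> z" using f by (auto simp: hi_def)
  qed
  have consec: "consec (lo x) (hi x)" if "m \<le> x" "x < M" for x
    using lo[OF that(1)] hi[OF that(2)] unfolding consec_def by (meson le_less_trans not_less)
  have lohi: "lo x = a" "hi x = b" if "consec a b" "a \<le> x" "x < b" for a b x
  proof -
    have b: "m \<le> x" "x < M" using that Z(5) unfolding consec_def by (meson order_trans less_le_trans)+
    show "lo x = a" "hi x = b"
      using that lo[OF b(1)] hi[OF b(2)] unfolding consec_def
      by (metis antisym le_less_trans not_less order.trans less_imp_le)+
  qed
  \<comment> \<open>Gluing along half-open gaps: a knot belongs to the piece that starts there,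
    whose value at the knot is that of \<open>\<phi>\<close>.\<close>
  define \<psi> where "\<psi> x = (if m \<le> x \<and> x < M then F (lo x) (hi x) x else \<phi> x)" for x
  have \<psi>: "\<psi> x = F a b x" "\<phi> a \<le> \<psi> x" "\<psi> x < \<phi> b" if ab: "consec a b" and x: "a \<le> x" "x < b" for a b x
  proof -
    have b: "m \<le> x" "x < M" using that Z(5) unfolding consec_def by (meson order_trans less_le_trans)+
    show e: "\<psi> x = F a b x" using b lohi[OF that] by (simp add: \<psi>_def)
    show "\<phi> a \<le> \<psi> x" using F(2)[OF ab] x unfolding e by force
    show "\<psi> x < \<phi> b" using strict_mono_onD[OF F(1)[OF ab], of x b] F(4)[OF ab] x e by auto
  qed
  have G1: "\<psi> x < \<phi> z" if "z \<in> Z" "x < z" for x z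
  proof (cases "m \<le> x \<and> x < M")
    case True
    then have "\<psi> x < \<phi> (hi x)" using \<psi>(3)[OF consec] lo hi by blast
    also have "\<dots> \<le> \<phi> z" using hi(3) True that inj by blast
    finally show ?thesis .
  next
    case False
    then show ?thesis using that by (auto simp: \<psi>_def inj)
  qed
  have G2: "\<phi> z \<le> \<psi> x" if "z \<in> Z" "z \<le> x" for x z
  proof (cases "m \<le> x \<and> x < M")
    case True
    then have "\<phi> z \<le> \<phi> (lo x)" using lo(3) that inj by blast
    also have "\<dots> \<le> \<psi> x" using \<psi>(2)[OF consec] lo hi True by blast
    finally show ?thesis .
  next
    case False
    then show ?thesis using that by (auto simp: \<psi>_def inj)
  qed
  have mono: "strict_mono \<psi>"
  proof (rule strict_monoI)
    fix x y :: 'a assume xy: "x < y"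
    show "\<psi> x < \<psi> y"
    proof (cases "\<exists>z\<in>Z. x < z \<and> z \<le> y")
      case True
      then show ?thesis using G1 G2 by (meson less_le_trans)
    next
      case False
      show ?thesis
      proof (cases "m \<le> x \<and> y < M")
        case True
        then have c: "consec (lo x) (hi x)" using consec xy by (meson less_trans)
        have x: "lo x \<le> x" "x < hi x" using lo hi True xy by (meson less_trans)+
        moreover have "y < hi x" using False x(2) c unfolding consec_def by (meson not_less)
        ultimately show ?thesis
          using \<psi>(1)[OF c] strict_mono_onD[OF F(1)[OF c], of x y] xy by auto
      next
        case out: False
        then have "y < m \<or> M \<le> x" using False Z xy by (metis not_less)
        then show ?thesis using xy by (auto simp: \<psi>_def inj)
      qed
    qed
  qed
  have surj: "surj \<psi>"
    unfolding surj_def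
  proof
    fix y
    obtain x where x: "y = \<phi> x" using \<phi>(2) by (metis surjD)
    show "\<exists>x. y = \<psi> x"
    proof (cases "m \<le> x \<and> x < M")
      case True
      then have c: "consec (lo x) (hi x)" using consec by blast
      have "y \<in> {\<phi> (lo x)..\<phi> (hi x)}" using lo hi True x inj by (auto simp: less_imp_le)
      then obtain w where w: "w \<in> {lo x..hi x}" "y = F (lo x) (hi x) w" using F(2)[OF c] by blast
      have "w \<noteq> hi x" using w(2) F(4)[OF c] x hi True inj by (metis less_irrefl)
      then show ?thesis using \<psi>(1)[OF c] w by (metis atLeastAtMost_iff le_less)
    next
      case False
      then show ?thesis using x by (metis \<psi>_def)
    qed
  qed
  have "sgn (poly p x) = sgn (poly q (\<psi> x))" for x
  proof (cases "m \<le> x \<and> x < M")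
    case True
    then show ?thesis using F(5)[OF consec] \<psi>(1)[OF consec] lo hi
      by (metis atLeastAtMost_iff less_imp_le)
  next
    case False
    then show ?thesis using below above by (auto simp: \<psi>_def not_le not_less)
  qed
  moreover have "sgn (poly r x) = sgn (poly s (\<psi> x))" if rs: "(r, s) \<in> H" for r s x
  proof (cases "m \<le> x \<and> x < M \<and> x \<notin> Z")
    case True
    then have c: "consec (lo x) (hi x)" using consec by blast
    have x: "lo x < x" "x < hi x" using lo hi True by (metis le_less)+
    have "\<phi> (lo x) < \<psi> x" "\<psi> x < \<phi> (hi x)"
      using \<psi>[OF c] x mono F(3)[OF c] c by (metis less_imp_le order_refl strict_monoD consec_def)+
    moreover have "\<phi> (lo x) < \<phi> x" "\<phi> x < \<phi> (hi x)" using x inj by auto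
    ultimately have bnd: "\<phi> (lo x) < min (\<phi> x) (\<psi> x)" "max (\<phi> x) (\<psi> x) < \<phi> (hi x)" by auto
    \<comment> \<open>Both arguments lie between the images of two consecutive knots, where no
      second component of \<open>H\<close> vanishes.\<close>
    have "sgn (poly s (\<phi> x)) = sgn (poly s (\<psi> x))"
    proof (rule sgn_poly_eq)
      fix y assume "min (\<phi> x) (\<psi> x) \<le> y" "y \<le> max (\<phi> x) (\<psi> x)"
      then have y: "\<phi> (lo x) < y" "y < \<phi> (hi x)" using bnd by (meson less_le_trans le_less_trans)+
      obtain w where w: "y = \<phi> w" using \<phi>(2) by (metis surjD)
      then have "w \<notin> Z" using c y inj by (auto simp: consec_def)
      then show "poly s y \<noteq> 0" using sZ[OF rs] w by blast
    qed
    then show ?thesis using match[OF rs] by simp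
  next
    case False
    moreover have "\<psi> x = \<phi> x" if "x \<in> Z" "m \<le> x" "x < M"
    proof -
      have c: "consec (lo x) (hi x)" using consec that by blast
      have "lo x = x" using lo that by (meson antisym order_refl)
      then show ?thesis using \<psi>(1)[OF c] hi F(3)[OF c] that by (metis order_refl)
    qed
    ultimately have "\<psi> x = \<phi> x" unfolding \<psi>_def by metis
    then show ?thesis using match[OF rs] by simp
  qed
  ultimately show ?thesis using mono surj by blast
qed

section \<open>Quantifier elimination and definable completeness\<close>

text \<open>Polynomial functions of an assignment of values to variables. They take the place of
  formal multivariate polynomials, and the variables may come from any type.\<close>

inductive_set polyfun :: "(('v \<Rightarrow> 'a::comm_ring_1) \<Rightarrow> 'a) set" where
  const: "(\<lambda>_. c) \<in> polyfun"
| var: "(\<lambda>e. e i) \<in> polyfun"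
| add: "f \<in> polyfun \<Longrightarrow> g \<in> polyfun \<Longrightarrow> (\<lambda>e. f e + g e) \<in> polyfun"
| mult: "f \<in> polyfun \<Longrightarrow> g \<in> polyfun \<Longrightarrow> (\<lambda>e. f e * g e) \<in> polyfun"

lemma polyfun_minus: "f \<in> polyfun \<Longrightarrow> (\<lambda>e. - f e) \<in> polyfun"
  using polyfun.mult[OF polyfun.const[of "-1"], of f] by simp

lemma polyfun_diff: "f \<in> polyfun \<Longrightarrow> g \<in> polyfun \<Longrightarrow> (\<lambda>e. f e - g e) \<in> polyfun"
  using polyfun.add[OF _ polyfun_minus, of f g] by simp

lemma polyfun_power: "f \<in> polyfun \<Longrightarrow> (\<lambda>e. f e ^ k) \<in> polyfun"
  by (induction k) (auto intro: polyfun.intros)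

lemma polyfun_sum: "(\<And>i. i \<in> I \<Longrightarrow> f i \<in> polyfun) \<Longrightarrow> (\<lambda>e. \<Sum>i\<in>I. f i e) \<in> polyfun"
  by (induction I rule: infinite_finite_induct) (auto intro: polyfun.intros)

lemma polyfun_prod: "(\<And>i. i \<in> I \<Longrightarrow> f i \<in> polyfun) \<Longrightarrow> (\<lambda>e. \<Prod>i\<in>I. f i e) \<in> polyfun"
  by (induction I rule: infinite_finite_induct) (auto intro: polyfun.intros)

lemmas polyfun_intros = polyfun.intros polyfun_minus polyfun_diff polyfun_power polyfun_sum polyfun_prod

text \<open>A polynomial in one main variable whose coefficients are polynomial in the parameters.
  The number \<open>n\<close> is a formal bound: the degree is below \<open>n\<close> for all
  parameters at once, but the coefficient of degree \<open>n - 1\<close> may vanish for some of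
  them.\<close>

definition param_poly :: "nat \<Rightarrow> (('v \<Rightarrow> 'a::comm_ring_1) \<Rightarrow> 'a poly) \<Rightarrow> bool" where
  "param_poly n q \<longleftrightarrow> (\<forall>k. (\<lambda>e. coeff (q e) k) \<in> polyfun) \<and> (\<forall>e. \<forall>k\<ge>n. coeff (q e) k = 0)"

lemma polyfun_as_param_poly:
  assumes "f \<in> polyfun"
  shows "\<exists>n q. param_poly n q \<and> (\<forall>e x. f (e(i := x)) = poly (q e) x)"
  using assms
proof induction
  case (const c)
  have "param_poly 1 (\<lambda>_. [:c:])"
    by (auto simp: param_poly_def intro: polyfun.const simp: coeff_pCons split: nat.splits)
  then show ?case by (intro exI[of _ 1] exI[of _ "\<lambda>_. [:c:]"]) simp
next
  case (var j)
  show ?case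
  proof (cases "j = i")
    case True
    have "param_poly 2 (\<lambda>_. [:0, 1:])"
      by (auto simp: param_poly_def intro: polyfun.const simp: coeff_pCons split: nat.splits)
    then show ?thesis using True by (intro exI[of _ 2] exI[of _ "\<lambda>_. [:0, 1:]"]) simp
  next
    case False
    have "(\<lambda>e. coeff [:e j:] k) \<in> polyfun" for k
      by (cases k) (auto intro: polyfun.intros)
    then have "param_poly 1 (\<lambda>e. [:e j:])"
      by (auto simp: param_poly_def coeff_pCons split: nat.splits)
    then show ?thesis using False by (intro exI[of _ 1] exI[of _ "\<lambda>e. [:e j:]"]) simp
  qed
next
  case (add f g)
  then obtain n p m q where "param_poly n p" "\<forall>e x. f (e(i := x)) = poly (p e) x"
    "param_poly m q" "\<forall>e x. g (e(i := x)) = poly (q e) x" by blast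
  then show ?case
    by (intro exI[of _ "max n m"] exI[of _ "\<lambda>e. p e + q e"])
      (auto simp: param_poly_def simp del: fun_upd_apply intro: polyfun.intros)
next
  case (mult f g)
  then obtain n p m q where p: "param_poly n p" "\<forall>e x. f (e(i := x)) = poly (p e) x"
    and q: "param_poly m q" "\<forall>e x. g (e(i := x)) = poly (q e) x" by blast
  have "coeff (p e * q e) k = 0" if "k \<ge> n + m" for e k
    unfolding coeff_mult
  proof (rule sum.neutral, rule ballI)
    fix j assume "j \<in> {..k}"
    have "j \<ge> n \<or> k - j \<ge> m" using that by linarith
    then show "coeff (p e) j * coeff (q e) (k - j) = 0" using p q by (auto simp: param_poly_def)
  qed
  moreover have "(\<lambda>e. coeff (p e * q e) k) \<in> polyfun" for k
    unfolding coeff_mult using p q by (intro polyfun_intros) (auto simp: param_poly_def)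
  ultimately have "param_poly (n + m) (\<lambda>e. p e * q e)" by (simp add: param_poly_def)
  then show ?case using p q by (intro exI[of _ "n + m"] exI[of _ "\<lambda>e. p e * q e"]) (simp del: fun_upd_apply)
qed

text \<open>Each step of the pseudo-division multiplies by the square of the leading coefficient, which keeps
  the sign.\<close>

lemma param_poly_remainder:
  fixes r :: "('v \<Rightarrow> 'a::linordered_field) \<Rightarrow> 'a poly"
  assumes "param_poly n p" "param_poly (Suc m) r"
  shows "\<exists>s. param_poly m s \<and> (\<forall>e x. coeff (r e) m \<noteq> 0 \<longrightarrow> poly (r e) x = 0 \<longrightarrow>
    sgn (poly (p e) x) = sgn (poly (s e) x))"
  using assms(1)
proof (induction n arbitrary: p)
  case 0
  then show ?case by (intro exI[of _ p]) (auto simp: param_poly_def)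
next
  case (Suc n)
  show ?case
  proof (cases "Suc n \<le> m")
    case True
    then show ?thesis using Suc.prems by (intro exI[of _ p]) (auto simp: param_poly_def)
  next
    case False
    define a b where "a e = coeff (p e) n" and "b e = coeff (r e) m" for e
    \<comment> \<open>The coefficients of degree \<open>n\<close> cancel, and at a zero of
      \<open>r e\<close> only the multiple of \<open>p e\<close> by a square remains.\<close>
    define t where "t e = smult (b e * b e) (p e) - monom (a e * b e) (n - m) * r e" for e
    have ct: "coeff (t e) k = b e * b e * coeff (p e) k -
        (if k < n - m then 0 else a e * b e * coeff (r e) (k - (n - m)))" for e k
      by (simp add: t_def coeff_monom_mult)
    have ab: "a \<in> polyfun" "b \<in> polyfun"
      using assms Suc.prems by (auto simp: param_poly_def a_def[abs_def] b_def[abs_def])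
    have "(\<lambda>e. coeff (t e) k) \<in> polyfun" for k
      unfolding ct using assms(2) Suc.prems ab
      by (cases "k < n - m") (auto simp: param_poly_def intro!: polyfun_intros)
    moreover have "coeff (t e) k = 0" if "k \<ge> n" for e k
    proof (cases "k = n")
      case True
      then show ?thesis using False by (simp add: ct a_def b_def)
    next
      case k: False
      then have "coeff (p e) k = 0" "coeff (r e) (k - (n - m)) = 0"
        using that False assms(2) Suc.prems unfolding param_poly_def by auto
      then show ?thesis by (simp add: ct)
    qed
    ultimately have "param_poly n t" by (simp add: param_poly_def)
    then obtain s where s: "param_poly m s" "\<And>e x. coeff (r e) m \<noteq> 0 \<Longrightarrow> poly (r e) x = 0 \<Longrightarrow>
      sgn (poly (t e) x) = sgn (poly (s e) x)" using Suc.IH by blast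
    have "sgn (poly (p e) x) = sgn (poly (t e) x)" if "coeff (r e) m \<noteq> 0" "poly (r e) x = 0" for e x
    proof -
      have "poly (t e) x = b e * b e * poly (p e) x" using that by (simp add: t_def)
      moreover have "sgn (b e * b e) = 1" using that by (simp add: b_def sgn_mult)
      ultimately show ?thesis by (metis mult_1 sgn_mult)
    qed
    then show ?thesis using s by (metis (no_types, lifting))
  qed
qed

section \<open>Sign diagrams of families of parametrized polynomials\<close>

definition signs_agree :: "(('v \<Rightarrow> 'a::linordered_field) \<Rightarrow> 'a) set \<Rightarrow> ('v \<Rightarrow> 'a) \<Rightarrow> ('v \<Rightarrow> 'a) \<Rightarrow> bool" where
  "signs_agree S e e' \<longleftrightarrow> (\<forall>f\<in>S. sgn (f e) = sgn (f e'))"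

lemma signs_agree_mono: "signs_agree S e e' \<Longrightarrow> S' \<subseteq> S \<Longrightarrow> signs_agree S' e e'"
  by (auto simp: signs_agree_def)

text \<open>The order automorphism \<open>\<phi>\<close> stands for the equality of the sign tables in the
  Cohen--Hoermander procedure.\<close>

definition diagram_determined ::
  "('v \<Rightarrow> 'a::linordered_field) set \<Rightarrow> (('v \<Rightarrow> 'a) \<Rightarrow> 'a poly) set \<Rightarrow> bool" where
  "diagram_determined C Q \<longleftrightarrow> (\<exists>S. finite S \<and> S \<subseteq> polyfun \<and>
     (\<forall>e\<in>C. \<forall>e'\<in>C. signs_agree S e e' \<longrightarrow>
       (\<exists>\<phi>. strict_mono \<phi> \<and> surj \<phi> \<and>
         (\<forall>q\<in>Q. \<forall>x. sgn (poly (q e) x) = sgn (poly (q e') (\<phi> x))))))"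

lemma diagram_determinedI:
  assumes "finite S" "S \<subseteq> polyfun" "\<And>e e'. e \<in> C \<Longrightarrow> e' \<in> C \<Longrightarrow> signs_agree S e e' \<Longrightarrow>
    \<exists>\<phi>. strict_mono \<phi> \<and> surj \<phi> \<and> (\<forall>q\<in>Q. \<forall>x. sgn (poly (q e) x) = sgn (poly (q e') (\<phi> x)))"
  shows "diagram_determined C Q"
proof -
  have "\<forall>e\<in>C. \<forall>e'\<in>C. signs_agree S e e' \<longrightarrow>
    (\<exists>\<phi>. strict_mono \<phi> \<and> surj \<phi> \<and> (\<forall>q\<in>Q. \<forall>x. sgn (poly (q e) x) = sgn (poly (q e') (\<phi> x))))"
    by (intro ballI impI) (rule assms(3))
  then show ?thesis unfolding diagram_determined_def using assms(1,2) by (intro exI[of _ S] conjI)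
qed

lemma diagram_determinedE:
  assumes "diagram_determined C Q"
  obtains S where "finite S" "S \<subseteq> polyfun" "\<And>e e'. e \<in> C \<Longrightarrow> e' \<in> C \<Longrightarrow> signs_agree S e e' \<Longrightarrow>
    \<exists>\<phi>. strict_mono \<phi> \<and> surj \<phi> \<and> (\<forall>q\<in>Q. \<forall>x. sgn (poly (q e) x) = sgn (poly (q e') (\<phi> x)))"
proof -
  obtain S where S: "finite S" "S \<subseteq> polyfun" "\<forall>e\<in>C. \<forall>e'\<in>C. signs_agree S e e' \<longrightarrow>
    (\<exists>\<phi>. strict_mono \<phi> \<and> surj \<phi> \<and> (\<forall>q\<in>Q. \<forall>x. sgn (poly (q e) x) = sgn (poly (q e') (\<phi> x))))"
    using assms unfolding diagram_determined_def by (elim exE conjE)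
  show thesis by (rule that[OF S(1,2) S(3)[rule_format]])
qed

lemma diagram_determined_cong:
  assumes "diagram_determined C Q'" "\<And>q. q \<in> Q \<Longrightarrow> \<exists>q'\<in>Q'. \<forall>e\<in>C. q e = q' e"
  shows "diagram_determined C Q"
proof -
  obtain S where S: "finite S" "S \<subseteq> polyfun" "\<And>e e'. e \<in> C \<Longrightarrow> e' \<in> C \<Longrightarrow> signs_agree S e e' \<Longrightarrow>
     \<exists>\<phi>. strict_mono \<phi> \<and> surj \<phi> \<and> (\<forall>q\<in>Q'. \<forall>x. sgn (poly (q e) x) = sgn (poly (q e') (\<phi> x)))"
    by (rule diagram_determinedE[OF assms(1)]) (rule that)
  have "\<exists>\<phi>. strict_mono \<phi> \<and> surj \<phi> \<and> (\<forall>q\<in>Q. \<forall>x. sgn (poly (q e) x) = sgn (poly (q e') (\<phi> x)))"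
    if "e \<in> C" "e' \<in> C" "signs_agree S e e'" for e e'
    using S(3)[OF that] assms(2) that by metis
  then show ?thesis by (rule diagram_determinedI[OF S(1,2)])
qed

text \<open>The sign of \<open>f\<close>, added to the test functions of both parts, tells that two
  assignments lie in the same part.\<close>

lemma diagram_determined_split:
  assumes f: "f \<in> polyfun"
    and "diagram_determined (C \<inter> {e. f e = 0}) Q" "diagram_determined (C \<inter> {e. f e \<noteq> 0}) Q"
  shows "diagram_determined C Q"
proof -
  obtain S1 where S1: "finite S1" "S1 \<subseteq> polyfun"
    and 1: "\<And>e e'. e \<in> C \<inter> {e. f e = 0} \<Longrightarrow> e' \<in> C \<inter> {e. f e = 0} \<Longrightarrow> signs_agree S1 e e' \<Longrightarrow>
       \<exists>\<phi>. strict_mono \<phi> \<and> surj \<phi> \<and> (\<forall>q\<in>Q. \<forall>x. sgn (poly (q e) x) = sgn (poly (q e') (\<phi> x)))"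
    by (rule diagram_determinedE[OF assms(2)]) (rule that)
  obtain S2 where S2: "finite S2" "S2 \<subseteq> polyfun"
    and 2: "\<And>e e'. e \<in> C \<inter> {e. f e \<noteq> 0} \<Longrightarrow> e' \<in> C \<inter> {e. f e \<noteq> 0} \<Longrightarrow> signs_agree S2 e e' \<Longrightarrow>
       \<exists>\<phi>. strict_mono \<phi> \<and> surj \<phi> \<and> (\<forall>q\<in>Q. \<forall>x. sgn (poly (q e) x) = sgn (poly (q e') (\<phi> x)))"
    by (rule diagram_determinedE[OF assms(3)]) (rule that)
  have "\<exists>\<phi>. strict_mono \<phi> \<and> surj \<phi> \<and> (\<forall>q\<in>Q. \<forall>x. sgn (poly (q e) x) = sgn (poly (q e') (\<phi> x)))"
    if e: "e \<in> C" "e' \<in> C" "signs_agree (insert f (S1 \<union> S2)) e e'" for e e'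
  proof -
    have a: "signs_agree S1 e e'" "signs_agree S2 e e'" by (rule signs_agree_mono[OF e(3)], blast)+
    have "f e = 0 \<longleftrightarrow> f e' = 0" using e(3) unfolding signs_agree_def by (metis insertI1 sgn_eq_0_iff)
    then show ?thesis
      by (cases "f e = 0") (rule 1[of e e'] 2[of e e'], use a e in auto)+
  qed
  moreover have "finite (insert f (S1 \<union> S2))" "insert f (S1 \<union> S2) \<subseteq> polyfun" using S1 S2 f by auto
  ultimately show ?thesis by (rule diagram_determinedI[rotated 2])
qed

text \<open>Cohen--Hoermander elimination by induction on the multiset of formal degree bounds.
  Constants are set aside. A vanishing formal leading coefficient lowers a bound. If none vanishes,
  a polynomial \<open>p\<close> of largest bound is replaced by its derivative and by its remainders
  modulo the derivative and the other polynomials.\<close>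

lemma diagram_determined_param_polys:
  fixes F :: "(nat \<times> (('v \<Rightarrow> 'a::real_closed_field) \<Rightarrow> 'a poly)) list"
  assumes "\<forall>(n, q)\<in>set F. param_poly n q"
  shows "diagram_determined C (snd ` set F)"
  using assms
proof (induction "mset (map fst F)" arbitrary: F C rule: less_induct)
  case less
  have IH: "diagram_determined C (snd ` set G)"
    if "mset (map fst G) < mset (map fst F)" "\<forall>(n, q)\<in>set G. param_poly n q"
    for G :: "(nat \<times> (('v \<Rightarrow> 'a) \<Rightarrow> 'a poly)) list" and C
    using less.hyps that by blast
  have rem: "mset (map fst F) = mset (map fst (remove1 x F)) + {#fst x#}" if "x \<in> set F" for x
    using that by (metis (no_types, lifting) mset_map mset_remove1 image_mset_add_mset insert_DiffM
        set_mset_mset add_mset_add_single)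
  show ?case
  proof (cases "\<exists>(n, q)\<in>set F. n \<le> 1")
    case True
    \<comment> \<open>Constant in the main variable: its sign is that of one coefficient, whatever
      the automorphism.\<close>
    then obtain n q where q: "(n, q) \<in> set F" "n \<le> 1" by blast
    let ?G = "remove1 (n, q) F"
    have "mset (map fst ?G) < mset (map fst F)" using rem[OF q(1)] by simp
    moreover have "\<forall>(n, q)\<in>set ?G. param_poly n q"
      using less.prems set_remove1_subset[of "(n, q)" F] by auto
    ultimately have "diagram_determined C (snd ` set ?G)" by (rule IH)
    obtain S where S: "finite S" "S \<subseteq> polyfun" "\<And>e e'. e \<in> C \<Longrightarrow> e' \<in> C \<Longrightarrow> signs_agree S e e' \<Longrightarrow>
       \<exists>\<phi>. strict_mono \<phi> \<and> surj \<phi> \<and> (\<forall>q\<in>snd ` set ?G. \<forall>x. sgn (poly (q e) x) = sgn (poly (q e') (\<phi> x)))"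
      by (rule diagram_determinedE[OF \<open>diagram_determined C (snd ` set ?G)\<close>]) (rule that)
    define c where "c e = coeff (q e) 0" for e
    have pq: "param_poly n q" using less.prems q by blast
    then have c: "c \<in> polyfun" by (simp add: c_def[abs_def] param_poly_def)
    have qc: "q e = [:c e:]" for e
      using pq q(2) by (auto simp: poly_eq_iff coeff_pCons c_def param_poly_def split: nat.splits)
    have sub: "snd ` set F \<subseteq> insert q (snd ` set ?G)"
    proof
      fix r assume "r \<in> snd ` set F"
      then obtain k where "(k, r) \<in> set F" by auto
      then show "r \<in> insert q (snd ` set ?G)"
        by (cases "(k, r) = (n, q)") (auto intro!: image_eqI[of r snd "(k, r)"])
    qed
    have "\<exists>\<phi>. strict_mono \<phi> \<and> surj \<phi> \<and> (\<forall>q\<in>snd ` set F. \<forall>x. sgn (poly (q e) x) = sgn (poly (q e') (\<phi> x)))"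
      if e: "e \<in> C" "e' \<in> C" "signs_agree (insert c S) e e'" for e e'
    proof -
      have "signs_agree S e e'" by (rule signs_agree_mono[OF e(3)]) blast
      then obtain \<phi> where "strict_mono \<phi>" "surj \<phi>"
        "\<forall>q\<in>snd ` set ?G. \<forall>x. sgn (poly (q e) x) = sgn (poly (q e') (\<phi> x))"
        using S(3) e by blast
      moreover have "sgn (poly (q e) x) = sgn (poly (q e') (\<phi> x))" for x
        using e(3) by (simp add: qc signs_agree_def)
      ultimately show ?thesis using sub by blast
    qed
    then show ?thesis
      by (rule diagram_determinedI[of "insert c S", rotated 2]) (use S c in auto)
  next
    case False
    then have two: "n \<ge> 2" if "(n, q) \<in> set F" for n q using that by force
    \<comment> \<open>The generic cell: all formal leading coefficients are nonzero, so formal and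
      actual degrees agree and pseudo-division applies.\<close>
    have core: "diagram_determined C (snd ` set F)"
      if lead: "\<forall>(n, q)\<in>set F. \<forall>e\<in>C. coeff (q e) (n - 1) \<noteq> 0" for C
    proof (cases "F = []")
      case True
      show ?thesis unfolding diagram_determined_def True
        by (intro exI[of _ "{}"]) (auto intro!: exI[of _ "\<lambda>x. x"] simp: strict_mono_def)
    next
      case ne: False
      define n where "n = Max (fst ` set F)"
      have "n \<in> fst ` set F" unfolding n_def by (rule Max_in) (use ne in auto)
      then obtain p where p: "(n, p) \<in> set F" by auto
      have max: "k \<le> n" if "(k, q) \<in> set F" for k q
        unfolding n_def using that by (intro Max_ge) (auto intro!: image_eqI[of k fst "(k, q)"])
      define p' where "p' e = pderiv (p e)" for e
      define H where "H = (n - 1, p') # remove1 (n, p) F"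
      have n2: "n \<ge> 2" using two p by blast
      have pp: "param_poly n p" using less.prems p by blast
      have "(\<lambda>e. coeff (p' e) k) \<in> polyfun" for k
        unfolding p'_def coeff_pderiv using pp by (intro polyfun_intros) (auto simp: param_poly_def)
      moreover have "coeff (p' e) k = 0" if "k \<ge> n - 1" for e k
        using that pp by (simp add: p'_def coeff_pderiv param_poly_def)
      ultimately have pp': "param_poly (n - 1) p'" by (simp add: param_poly_def)
      have Hin: "x = (n - 1, p') \<or> x \<in> set F" if "x \<in> set H" for x
        using that set_remove1_subset[of "(n, p)" F] by (auto simp: H_def)
      have Hlead: "k \<ge> 1 \<and> k \<le> n \<and> param_poly k r \<and> (\<forall>e\<in>C. coeff (r e) (k - 1) \<noteq> 0)"
        if kr: "(k, r) \<in> set H" for k r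
      proof (cases "(k, r) = (n - 1, p')")
        case True
        have "coeff (p' e) (n - 1 - 1) \<noteq> 0" if "e \<in> C" for e
        proof -
          have "Suc (n - 1 - 1) = n - 1" using n2 by simp
          moreover have "coeff (p e) (n - 1) \<noteq> 0" using lead p that by blast
          ultimately show ?thesis
            unfolding p'_def coeff_pderiv using of_nat_neq_0 by (metis mult_eq_0_iff)
        qed
        then show ?thesis using True n2 pp' by auto
      next
        case False
        then have "(k, r) \<in> set F" using Hin kr by blast
        then show ?thesis using two[of k r] max[of k r] lead less.prems by auto
      qed
      have "\<exists>s. param_poly (fst x - 1) s \<and> (\<forall>e x'. coeff (snd x e) (fst x - 1) \<noteq> 0 \<longrightarrow>
        poly (snd x e) x' = 0 \<longrightarrow> sgn (poly (p e) x') = sgn (poly (s e) x'))" if "x \<in> set H" for x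
        using param_poly_remainder[OF pp, of "fst x - 1" "snd x"] Hlead[of "fst x" "snd x"] that by simp
      then obtain R where R: "\<And>k r. (k, r) \<in> set H \<Longrightarrow> param_poly (k - 1) (R (k, r))"
        "\<And>k r e x. (k, r) \<in> set H \<Longrightarrow> coeff (r e) (k - 1) \<noteq> 0 \<Longrightarrow> poly (r e) x = 0 \<Longrightarrow>
          sgn (poly (p e) x) = sgn (poly (R (k, r) e) x)"
        by (metis fst_conv snd_conv)
      \<comment> \<open>At a zero of a member of \<open>H\<close>, the polynomial \<open>p\<close>
        has the sign of its remainder modulo that member. So the diagram of \<open>G\<close>, from
        which \<open>p\<close> itself is gone, supplies the hypothesis \<open>roots\<close> of
        \<open>sign_matching_extend\<close>.\<close>
      define G where "G = H @ map (\<lambda>x. (fst x - 1, R x)) H"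
      have "mset (map fst G) < mset (map fst F)"
      proof -
        let ?I = "mset (map fst (remove1 (n, p) F))"
        let ?K = "{#n - 1#} + mset (map (\<lambda>x. fst x - 1) H)"
        \<comment> \<open>One entry \<open>n\<close> is traded for finitely many smaller ones: the
          derivative has bound \<open>n - 1\<close>, and the remainder modulo a polynomial of bound
          \<open>k \<le> n\<close> has bound \<open>k - 1\<close>.\<close>
        have "multp (<) (?I + ?K) (?I + {#n#})"
        proof (rule one_step_implies_multp)
          show "\<forall>k\<in>#?K. \<exists>j\<in>#{#n#}. k < j"
            using Hlead n2 by fastforce
        qed simp
        moreover have "?I + ?K = mset (map fst G)" by (simp add: G_def H_def comp_def)
        ultimately show ?thesis using rem[OF p] by (simp add: less_multiset_def)
      qed
      moreover have "\<forall>(k, q)\<in>set G. param_poly k q" using Hlead R(1) by (auto simp: G_def)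
      ultimately have "diagram_determined C (snd ` set G)" by (rule IH)
      obtain S where S: "finite S" "S \<subseteq> polyfun" "\<And>e e'. e \<in> C \<Longrightarrow> e' \<in> C \<Longrightarrow> signs_agree S e e' \<Longrightarrow>
         \<exists>\<phi>. strict_mono \<phi> \<and> surj \<phi> \<and> (\<forall>q\<in>snd ` set G. \<forall>x. sgn (poly (q e) x) = sgn (poly (q e') (\<phi> x)))"
        by (rule diagram_determinedE[OF \<open>diagram_determined C (snd ` set G)\<close>]) (rule that)
      define c where "c e = coeff (p e) (n - 1)" for e
      have c: "c \<in> polyfun" using pp by (simp add: c_def[abs_def] param_poly_def)
      have "\<exists>\<phi>. strict_mono \<phi> \<and> surj \<phi> \<and> (\<forall>q\<in>snd ` set F. \<forall>x. sgn (poly (q e) x) = sgn (poly (q e') (\<phi> x)))"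
        if e: "e \<in> C" "e' \<in> C" "signs_agree (insert c S) e e'" for e e'
      proof -
        have "signs_agree S e e'" by (rule signs_agree_mono[OF e(3)]) blast
        then obtain \<phi> where \<phi>: "strict_mono \<phi>" "surj \<phi>"
          "\<And>q x. q \<in> snd ` set G \<Longrightarrow> sgn (poly (q e) x) = sgn (poly (q e') (\<phi> x))"
          using S(3) e by blast
        have deg: "degree (p e) = n - 1" if "e \<in> C" for e
        proof (rule antisym)
          show "degree (p e) \<le> n - 1" using pp n2 by (intro degree_le) (auto simp: param_poly_def)
          show "n - 1 \<le> degree (p e)" using lead p that by (intro le_degree) blast
        qed
        have "\<exists>\<psi>. strict_mono \<psi> \<and> surj \<psi> \<and> (\<forall>(r, s)\<in>insert (p e, p e') ((\<lambda>x. (snd x e, snd x e')) ` set H).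
          \<forall>x. sgn (poly r x) = sgn (poly s (\<psi> x)))"
        proof (rule sign_matching_extend[OF \<phi>(1,2)])
          show "(pderiv (p e), pderiv (p e')) \<in> (\<lambda>x. (snd x e, snd x e')) ` set H"
            by (rule image_eqI[of _ _ "(n - 1, p')"]) (auto simp: H_def p'_def)
          show "degree (p e) = degree (p e')" using deg e by simp
          have "sgn (c e) = sgn (c e')" using e(3) by (simp add: signs_agree_def)
          then show "sgn (lead_coeff (p e)) = sgn (lead_coeff (p e'))" using deg e by (simp add: c_def)
        next
          fix r s assume "(r, s) \<in> (\<lambda>x. (snd x e, snd x e')) ` set H"
          then obtain k q where q: "(k, q) \<in> set H" "r = q e" "s = q e'" by auto
          have nz: "coeff (q e) (k - 1) \<noteq> 0" "coeff (q e') (k - 1) \<noteq> 0" using Hlead[OF q(1)] e by auto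
          then show "r \<noteq> 0 \<and> s \<noteq> 0" using q by auto
          have "(k, q) \<in> set G" "(k - 1, R (k, q)) \<in> set G" using q by (force simp: G_def)+
          then have qG: "q \<in> snd ` set G" "R (k, q) \<in> snd ` set G" by (metis image_eqI snd_conv)+
          then show m: "sgn (poly r x) = sgn (poly s (\<phi> x))" for x using \<phi>(3) q by blast
          fix z assume z: "poly r z = 0"
          then have sz: "poly s (\<phi> z) = 0" using m[of z] by (metis sgn_eq_0_iff)
          have "sgn (poly (p e) z) = sgn (poly (R (k, q) e) z)"
            by (rule R(2)[OF q(1) nz(1)]) (use z q(2) in blast)
          also have "\<dots> = sgn (poly (R (k, q) e') (\<phi> z))" by (rule \<phi>(3)[OF qG(2)])
          also have "\<dots> = sgn (poly (p e') (\<phi> z))"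
            by (rule R(2)[OF q(1) nz(2), symmetric]) (use sz q(3) in blast)
          finally show "sgn (poly (p e) z) = sgn (poly (p e') (\<phi> z))" .
        qed auto
        then obtain \<psi> where \<psi>: "strict_mono \<psi>" "surj \<psi>" and
          ext: "\<forall>(r, s)\<in>insert (p e, p e') ((\<lambda>x. (snd x e, snd x e')) ` set H).
            \<forall>x. sgn (poly r x) = sgn (poly s (\<psi> x))" by (elim exE conjE)
        have m: "sgn (poly (p e) x) = sgn (poly (p e') (\<psi> x))"
          "(k, q) \<in> set H \<Longrightarrow> sgn (poly (q e) x) = sgn (poly (q e') (\<psi> x))" for k q x
          using ext by auto
        have "sgn (poly (q e) x) = sgn (poly (q e') (\<psi> x))" if q: "q \<in> snd ` set F" for q x
        proof -
          obtain k where k: "(k, q) \<in> set F" using q by auto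
          show ?thesis
          proof (cases "(k, q) = (n, p)")
            case False
            then have "(k, q) \<in> set H" using k by (simp add: H_def)
            then show ?thesis by (rule m(2))
          qed (use m(1) in simp)
        qed
        then show ?thesis using \<psi> by blast
      qed
      then show ?thesis
        by (rule diagram_determinedI[of "insert c S", rotated 2]) (use S c in auto)
    qed
    \<comment> \<open>The set \<open>U\<close> collects the polynomials whose formal leading
      coefficient may still vanish on the cell; each is removed by a case split.\<close>
    have "diagram_determined C (snd ` set F)"
      if "finite U" "U \<subseteq> set F" "\<forall>(n, q)\<in>set F - U. \<forall>e\<in>C. coeff (q e) (n - 1) \<noteq> 0" for U C
      using that
    proof (induction U arbitrary: C)
      case empty
      then show ?case using core by simp
    next
      case (insert x U)
      obtain n q where x: "x = (n, q)" by force
      have q: "(n, q) \<in> set F" using insert.prems x by blast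
      have pq: "param_poly n q" using q less.prems by blast
      have n2: "n \<ge> 2" using two q by blast
      let ?f = "\<lambda>e. coeff (q e) (n - 1)"
      \<comment> \<open>On the cell where the formal leading coefficient vanishes, \<open>q'\<close>
        equals \<open>q\<close> but has a smaller bound.\<close>
      define q' where "q' e = q e - monom (?f e) (n - 1)" for e
      let ?G = "(n - 1, q') # remove1 (n, q) F"
      have f: "?f \<in> polyfun" using pq by (simp add: param_poly_def)
      have "(\<lambda>e. coeff (q' e) k) \<in> polyfun" for k
        unfolding q'_def coeff_diff coeff_monom using pq f
        by (cases "n - 1 = k") (auto intro!: polyfun_intros simp: param_poly_def)
      moreover have "coeff (q' e) k = 0" if "k \<ge> n - 1" for e k
        using that pq by (cases "k = n - 1") (auto simp: q'_def param_poly_def)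
      ultimately have "param_poly (n - 1) q'" by (simp add: param_poly_def)
      then have "\<forall>(n, q)\<in>set ?G. param_poly n q"
        using less.prems set_remove1_subset[of "(n, q)" F] by auto
      moreover have "mset (map fst ?G) < mset (map fst F)"
      proof -
        have "multp (<) (mset (map fst (remove1 (n, q) F)) + {#n - 1#}) (mset (map fst (remove1 (n, q) F)) + {#n#})"
          by (rule one_step_implies_multp) (use n2 in auto)
        then show ?thesis using rem[OF q] by (simp add: less_multiset_def)
      qed
      ultimately have "diagram_determined (C \<inter> {e. ?f e = 0}) (snd ` set ?G)" by (intro IH)
      then have "diagram_determined (C \<inter> {e. ?f e = 0}) (snd ` set F)"
      proof (rule diagram_determined_cong)
        fix r assume "r \<in> snd ` set F"
        then obtain k where k: "(k, r) \<in> set F" by auto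
        show "\<exists>q'\<in>snd ` set ?G. \<forall>e\<in>C \<inter> {e. ?f e = 0}. r e = q' e"
        proof (cases "(k, r) = (n, q)")
          case True
          then show ?thesis by (intro bexI[of _ q']) (auto simp: q'_def)
        next
          case False
          then have "(k, r) \<in> set (remove1 (n, q) F)" using k by simp
          then show ?thesis by (intro bexI[of _ r]) force+
        qed
      qed
      moreover have "diagram_determined (C \<inter> {e. ?f e \<noteq> 0}) (snd ` set F)"
        by (rule insert.IH) (use insert.prems x in auto)
      ultimately show ?case by (rule diagram_determined_split[OF f])
    qed
    from this[of "set F" C] show ?thesis by simp
  qed
qed

text \<open>Finite determination by signs is a semantic form of quantifier-free definability with parameters;
  closure under quantification is then the Tarski--Seidenberg theorem.\<close>

definition definable :: "(('v \<Rightarrow> 'a::linordered_field) \<Rightarrow> bool) \<Rightarrow> bool" where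
  "definable P \<longleftrightarrow> (\<exists>S. finite S \<and> S \<subseteq> polyfun \<and> (\<forall>e e'. signs_agree S e e' \<longrightarrow> P e = P e'))"

section \<open>Closure properties of definable predicates, elimination and suprema\<close>

lemma definableI:
  assumes "finite S" "S \<subseteq> polyfun" "\<And>e e'. signs_agree S e e' \<Longrightarrow> P e = P e'"
  shows "definable P"
proof -
  have "\<forall>e e'. signs_agree S e e' \<longrightarrow> P e = P e'" by (intro allI impI) (rule assms(3))
  then show ?thesis unfolding definable_def using assms(1,2) by (intro exI[of _ S] conjI)
qed

lemma definable_less:
  assumes "f \<in> polyfun" "g \<in> polyfun"
  shows "definable (\<lambda>e. f e < g e)"
proof -
  have pos: "f e < g e \<longleftrightarrow> sgn (g e - f e) = 1" for e by (simp add: sgn_1_pos)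
  show ?thesis
  proof (rule definableI)
    show "finite {\<lambda>e. g e - f e}" by simp
    show "{\<lambda>e. g e - f e} \<subseteq> polyfun" using polyfun_diff[OF assms(2,1)] by blast
    show "(f e < g e) = (f e' < g e')" if "signs_agree {\<lambda>e. g e - f e} e e'" for e e'
      unfolding pos using that unfolding signs_agree_def by (metis singletonI)
  qed
qed

lemma definable_not: "definable P \<Longrightarrow> definable (\<lambda>e. \<not> P e)"
  unfolding definable_def by (elim exE, intro exI) auto

lemma definable_conj:
  assumes "definable P" "definable Q"
  shows "definable (\<lambda>e. P e \<and> Q e)"
proof -
  obtain S T where ST: "finite S" "S \<subseteq> polyfun" "finite T" "T \<subseteq> polyfun"
    and P: "\<And>e e'. signs_agree S e e' \<Longrightarrow> P e = P e'"
    and Q: "\<And>e e'. signs_agree T e e' \<Longrightarrow> Q e = Q e'"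
    using assms unfolding definable_def by blast
  show ?thesis
  proof (rule definableI)
    show "finite (S \<union> T)" "S \<union> T \<subseteq> polyfun" using ST by auto
    show "(P e \<and> Q e) = (P e' \<and> Q e')" if "signs_agree (S \<union> T) e e'" for e e'
      using P[OF signs_agree_mono[OF that]] Q[OF signs_agree_mono[OF that]] by blast
  qed
qed

lemma definable_le: "f \<in> polyfun \<Longrightarrow> g \<in> polyfun \<Longrightarrow> definable (\<lambda>e. f e \<le> g e)"
  using definable_not[OF definable_less[of g f]] by (simp add: not_less)

lemma definable_imp: "definable P \<Longrightarrow> definable Q \<Longrightarrow> definable (\<lambda>e. P e \<longrightarrow> Q e)"
  using definable_not[OF definable_conj[OF _ definable_not, of P Q]] by simp

lemma definable_disj: "definable P \<Longrightarrow> definable Q \<Longrightarrow> definable (\<lambda>e. P e \<or> Q e)"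
  using definable_imp[OF definable_not, of P Q] by (simp add: disj_imp)

lemma definable_const: "definable (\<lambda>_. b)"
  unfolding definable_def by (intro exI[of _ "{}"]) simp

lemma definable_ball: "finite I \<Longrightarrow> (\<And>i. i \<in> I \<Longrightarrow> definable (P i)) \<Longrightarrow> definable (\<lambda>e. \<forall>i\<in>I. P i e)"
  by (induction I rule: finite_induct) (auto intro: definable_const definable_conj)

text \<open>Singles out one variable \<open>i\<close>: along this axis the truth value depends only
  on the signs of finitely many polynomials in one variable. Both elimination and completeness start
  from this.\<close>

lemma definable_slice:
  fixes P :: "('v \<Rightarrow> 'a::linordered_field) \<Rightarrow> bool"
  assumes "definable P"
  obtains F where "\<forall>(n, q)\<in>set F. param_poly n q"
    "\<And>e e' x x'. (\<And>q. q \<in> snd ` set F \<Longrightarrow> sgn (poly (q e) x) = sgn (poly (q e') x'))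
      \<Longrightarrow> P (e(i := x)) = P (e'(i := x'))"
proof -
  obtain S where S: "finite S" "S \<subseteq> polyfun" "\<And>e e'. signs_agree S e e' \<Longrightarrow> P e = P e'"
    using assms unfolding definable_def by blast
  have "\<exists>nq. param_poly (fst nq) (snd nq) \<and> (\<forall>e x. f (e(i := x)) = poly (snd nq e) x)" if "f \<in> S" for f
    using polyfun_as_param_poly[of f i] that S(2) by auto
  then obtain h where h: "\<And>f. f \<in> S \<Longrightarrow> param_poly (fst (h f)) (snd (h f))"
    "\<And>f e x. f \<in> S \<Longrightarrow> f (e(i := x)) = poly (snd (h f) e) x" by metis
  obtain L where L: "set L = S" using finite_list[OF S(1)] by blast
  show ?thesis
  proof (rule that[of "map h L"])
    show "\<forall>(n, q)\<in>set (map h L). param_poly n q" using h(1) L by (auto simp: split_beta)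
    fix e e' x x'
    assume "\<And>q. q \<in> snd ` set (map h L) \<Longrightarrow> sgn (poly (q e) x) = sgn (poly (q e') x')"
    then have "sgn (poly (snd (h f) e) x) = sgn (poly (snd (h f) e') x')" if "f \<in> S" for f
      using that L by auto
    then have "signs_agree S (e(i := x)) (e'(i := x'))"
      by (simp add: signs_agree_def h(2) del: fun_upd_apply)
    then show "P (e(i := x)) = P (e'(i := x'))" by (rule S(3))
  qed
qed

text \<open>The order automorphism between two diagrams carries a witness for one assignment to a
  witness for the other.\<close>

theorem definable_ex:
  fixes P :: "('v \<Rightarrow> 'a::real_closed_field) \<Rightarrow> bool"
  assumes "definable P"
  shows "definable (\<lambda>e. \<exists>x. P (e(i := x)))"
proof -
  obtain F where F: "\<forall>(n, q)\<in>set F. param_poly n q"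
    "\<And>e e' x x'. (\<And>q. q \<in> snd ` set F \<Longrightarrow> sgn (poly (q e) x) = sgn (poly (q e') x'))
      \<Longrightarrow> P (e(i := x)) = P (e'(i := x'))"
    using definable_slice[OF assms, of i] by blast
  obtain S where S: "finite S" "S \<subseteq> polyfun" "\<And>e e'. signs_agree S e e' \<Longrightarrow>
     \<exists>\<phi>. strict_mono \<phi> \<and> surj \<phi> \<and> (\<forall>q\<in>snd ` set F. \<forall>x. sgn (poly (q e) x) = sgn (poly (q e') (\<phi> x)))"
    by (rule diagram_determinedE[OF diagram_determined_param_polys[OF F(1), of UNIV]]) (rule that, auto)
  have "(\<exists>x. P (e(i := x))) \<Longrightarrow> (\<exists>x. P (e'(i := x)))" if "signs_agree S e e'" for e e'
    using S(3)[OF that] F(2) by metis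
  moreover have "signs_agree S e e' \<longleftrightarrow> signs_agree S e' e" for e e' by (auto simp: signs_agree_def)
  ultimately have "(\<exists>x. P (e(i := x))) = (\<exists>x. P (e'(i := x)))" if "signs_agree S e e'" for e e'
    using that by blast
  then show ?thesis by (rule definableI[OF S(1,2)])
qed

text \<open>The elements of a definable set form finitely many intervals, hence the supremum is an end point.\<close>

theorem definable_complete:
  fixes P :: "('v \<Rightarrow> 'a::real_closed_field) \<Rightarrow> bool"
  assumes P: "definable P" and t: "P (e(i := t))" and B: "\<And>x. P (e(i := x)) \<Longrightarrow> x \<le> B"
  shows "\<exists>s. (\<forall>x. P (e(i := x)) \<longrightarrow> x \<le> s) \<and> (\<forall>b. (\<forall>x. P (e(i := x)) \<longrightarrow> x \<le> b) \<longrightarrow> s \<le> b)"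
proof -
  obtain F where F: "\<forall>(n, q)\<in>set F. param_poly n q"
    "\<And>e e' x x'. (\<And>q. q \<in> snd ` set F \<Longrightarrow> sgn (poly (q e) x) = sgn (poly (q e') x'))
      \<Longrightarrow> P (e(i := x)) = P (e'(i := x'))"
    using definable_slice[OF P, of i] by blast
  define R where "R = (\<Union>q\<in>{q \<in> snd ` set F. q e \<noteq> 0}. {x. poly (q e) x = 0})"
  have "finite R" unfolding R_def by (auto simp: poly_roots_finite)
  have const: "P (e(i := x)) = P (e(i := y))" if "\<And>z. min x y \<le> z \<Longrightarrow> z \<le> max x y \<Longrightarrow> z \<notin> R" for x y
  proof (rule F(2))
    fix q assume q: "q \<in> snd ` set F"
    show "sgn (poly (q e) x) = sgn (poly (q e) y)"
    proof (cases "q e = 0")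
      case False
      then show ?thesis by (intro sgn_poly_eq) (use that q in \<open>auto simp: R_def\<close>)
    qed simp
  qed
  define ub where "ub b \<longleftrightarrow> (\<forall>x. P (e(i := x)) \<longrightarrow> x \<le> b)" for b
  \<comment> \<open>Candidates for the supremum: the zeros of the slices that are upper bounds,
    together with the given bound \<open>B\<close>, which makes the set nonempty.\<close>
  define Z where "Z = {z \<in> insert B R. ub z}"
  have Z: "finite Z" "Z \<noteq> {}" using \<open>finite R\<close> B by (auto simp: Z_def ub_def)
  define s where "s = Min Z"
  have s: "ub s" using Min_in[OF Z] by (auto simp: s_def Z_def)
  have "s \<le> b" if b: "ub b" for b
  proof (rule ccontr)
    assume "\<not> s \<le> b"
    then have bs: "b < s" by simp
    \<comment> \<open>The entry \<open>t - 1\<close> is the default if there is no zero below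
      \<open>s\<close>; it is not an upper bound because \<open>t\<close> belongs to the
      set.\<close>
    define W where "W = insert (t - 1) {z \<in> R. z < s}"
    have "finite W" "W \<noteq> {}" using \<open>finite R\<close> by (auto simp: W_def)
    define w where "w = Max W"
    have "w \<in> W" using \<open>finite W\<close> \<open>W \<noteq> {}\<close> by (simp add: w_def)
    have wR: "z \<notin> R" if "w < z" "z < s" for z
      using Max_ge[OF \<open>finite W\<close>, of z] that by (auto simp: w_def W_def)
    have "\<not> ub w"
    proof (cases "w = t - 1")
      case True
      then show ?thesis using t by (auto simp: ub_def)
    next
      case False
      then have "w \<in> R" "w < s" using \<open>w \<in> W\<close> by (auto simp: W_def)
      show ?thesis
      proof
        assume "ub w"
        then have "w \<in> Z" using \<open>w \<in> R\<close> by (auto simp: Z_def)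
        then have "s \<le> w" using Z by (simp add: s_def)
        then show False using \<open>w < s\<close> by simp
      qed
    qed
    then obtain x where x: "P (e(i := x))" "w < x" by (auto simp: ub_def not_le)
    have xb: "x \<le> b" using b x by (simp add: ub_def)
    obtain y where y: "b < y" "y < s" using dense bs by blast
    have "P (e(i := x)) = P (e(i := y))"
      by (rule const) (use x xb y wR in auto)
    then show False using b x y by (auto simp: ub_def)
  qed
  then show ?thesis using s unfolding ub_def by blast
qed

section \<open>The Puiseux series are real closed\<close>

text \<open>Bounds the leading exponent from above and holds for 0 with every bound, which makes it
  stable under sums without case distinctions. With bound 0 it describes the valuation ring, that
  is, the elements bounded by a real; \<open>pcoeff x 0\<close> is then the residue of
  \<open>x\<close>.\<close>

definition order_le :: "puiseux \<Rightarrow> real \<Rightarrow> bool" where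
  "order_le x g \<longleftrightarrow> (\<forall>a>g. pcoeff x a = 0)"

lemma order_le_0 [simp]: "order_le 0 g" by (simp add: order_le_def)

lemma order_le_mono: "order_le x g \<Longrightarrow> g \<le> h \<Longrightarrow> order_le x h"
  by (simp add: order_le_def)

lemma order_le_add: "order_le x g \<Longrightarrow> order_le y g \<Longrightarrow> order_le (x + y) g"
  by (simp add: order_le_def)

lemma order_le_minus [simp]: "order_le (- x) g \<longleftrightarrow> order_le x g"
  by (simp add: order_le_def)

lemma order_le_diff: "order_le x g \<Longrightarrow> order_le y g \<Longrightarrow> order_le (x - y) g"
  by (simp add: order_le_def)

lemma order_le_sum: "(\<And>i. i \<in> I \<Longrightarrow> order_le (f i) g) \<Longrightarrow> order_le (sum f I) g"
  by (simp add: order_le_def pcoeff_sum)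

lemma order_le_psupp: "order_le x g \<Longrightarrow> a \<in> psupp x \<Longrightarrow> a \<le> g"
  by (force simp: order_le_def in_psupp)

lemma order_le_mult:
  assumes "order_le x g" "order_le y h"
  shows "order_le (x * y) (g + h)"
  unfolding order_le_def
proof (intro allI impI, rule ccontr)
  fix a assume a: "g + h < a" "pcoeff (x * y) a \<noteq> 0"
  then obtain b c where "b \<in> psupp x" "c \<in> psupp y" "a = b + c" using psupp_mult in_psupp by blast
  then show False using order_le_psupp[OF assms(1)] order_le_psupp[OF assms(2)] a by force
qed

lemma pcoeff_mult_top:
  assumes "order_le x g" "order_le y h"
  shows "pcoeff (x * y) (g + h) = pcoeff x g * pcoeff y h"
proof -
  have "pcoeff (x * y) (g + h) = (\<Sum>a\<in>{g}. pcoeff x a * pcoeff y (g + h - a))"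
  proof (rule pcoeff_mult)
    fix a assume "a \<in> psupp x" "g + h - a \<in> psupp y"
    then show "a \<in> {g}" using order_le_psupp[OF assms(1)] order_le_psupp[OF assms(2)] by force
  qed simp
  then show ?thesis by simp
qed

lemma order_le_one [simp]: "order_le 1 0" by (simp add: order_le_def pcoeff_1)

lemma order_le_power: "order_le x g \<Longrightarrow> order_le (x ^ n) (real n * g)"
  by (induction n) (auto simp: algebra_simps dest: order_le_mult)

lemma pcoeff_power_top: "order_le x g \<Longrightarrow> pcoeff (x ^ n) (real n * g) = pcoeff x g ^ n"
proof (induction n)
  case (Suc n)
  then show ?case using pcoeff_mult_top[OF Suc.prems order_le_power[OF Suc.prems, of n]]
    by (simp add: algebra_simps)
qed (simp add: pcoeff_1)

lemma order_le_lead_exp: "order_le x (lead_exp x)"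
proof (cases "x = 0")
  case False
  then show ?thesis using pcoeff_above_lead by (simp add: order_le_def)
qed simp

lemma pcoeff_lead_exp: "x \<noteq> 0 \<Longrightarrow> pcoeff x (lead_exp x) \<noteq> 0"
  using plead_coeff_nz by (simp add: plead_coeff_def)

lemma lead_exp_le: "x \<noteq> 0 \<Longrightarrow> order_le x g \<Longrightarrow> lead_exp x \<le> g"
  using pcoeff_lead_exp[of x] by (force simp: order_le_def)

lemma lead_exp_eq:
  assumes "order_le x g" "pcoeff x g \<noteq> 0"
  shows "lead_exp x = g"
proof (rule lead_exp_eqI[OF assms(2)])
  fix a assume "pcoeff x a \<noteq> 0"
  then show "a \<le> g" using assms(1) unfolding order_le_def by (meson not_less)
qed

lemma order_le_pos_iff:
  assumes "order_le x g" "pcoeff x g \<noteq> 0"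
  shows "0 < x \<longleftrightarrow> 0 < pcoeff x g"
  by (simp add: puiseux_pos_iff plead_coeff_def lead_exp_eq[OF assms])

lemma order_le_antimono:
  assumes "0 \<le> x" "x \<le> y" "order_le y g"
  shows "order_le x g"
proof (cases "x = 0")
  case False
  let ?l = "lead_exp x"
  show ?thesis
  proof (cases "?l \<le> g")
    case True
    then show ?thesis using order_le_lead_exp order_le_mono by blast
  next
    case l: False
    have "x > 0" using False assms by simp
    then have p: "pcoeff x ?l > 0" by (simp add: puiseux_pos_iff plead_coeff_def)
    have y: "order_le (y - x) ?l" "pcoeff (y - x) ?l = - pcoeff x ?l"
      using l assms(3) order_le_lead_exp[of x] by (auto simp: order_le_def)
    then have "\<not> y - x > 0" "y - x \<noteq> 0" using order_le_pos_iff[OF y(1)] p by auto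
    then show ?thesis using assms(2) by simp
  qed
qed simp

lemma pcoeff_mono:
  assumes "order_le x g" "order_le y g" "x \<le> y"
  shows "pcoeff x g \<le> pcoeff y g"
proof (rule ccontr)
  assume "\<not> pcoeff x g \<le> pcoeff y g"
  then have "y - x > 0 \<longleftrightarrow> 0 < pcoeff (y - x) g" "pcoeff (y - x) g < 0"
    using order_le_pos_iff[OF order_le_diff[OF assms(2,1)]] by auto
  then show False using assms(3) by (auto simp: le_less)
qed

lemma infinitesimal_order:
  assumes "order_le x 0" "pcoeff x 0 = 0"
  shows "\<exists>\<kappa>>0. order_le x (- \<kappa>)"
proof (cases "x = 0")
  case False
  have "lead_exp x \<le> 0" "lead_exp x \<noteq> 0"
    using lead_exp_le[OF False assms(1)] pcoeff_lead_exp[OF False] assms(2) by auto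
  then show ?thesis using order_le_lead_exp[of x] by (intro exI[of _ "- lead_exp x"]) auto
qed (auto intro: exI[of _ 1])

lemma order_le_inverse:
  assumes "order_le x 0" "pcoeff x 0 \<noteq> 0"
  shows "order_le (inverse x) 0"
proof -
  have x: "x \<noteq> 0" using assms by auto
  have l: "lead_exp x = 0" by (rule lead_exp_eq[OF assms])
  have "lead_exp 1 = 0" by (rule lead_exp_eq) (simp_all add: pcoeff_1)
  moreover have "lead_exp (x * inverse x) = lead_exp x + lead_exp (inverse x)"
    by (rule plead_mult(2)[OF x nonzero_imp_inverse_nonzero[OF x]])
  ultimately have "lead_exp (inverse x) = 0" unfolding right_inverse[OF x] l by linarith
  then show ?thesis using order_le_lead_exp[of "inverse x"] by metis
qed

text \<open>Since \<open>\<kappa>\<close> is a fixed positive gap, each coefficient is stationary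
  from some index on. Above a given exponent a single member of the sequence already shows all
  coefficients of the limit, so its support is admissible.\<close>

lemma puiseux_limit:
  assumes "\<kappa> > 0" and step: "\<And>n. order_le (x (Suc n) - x n) (- (\<kappa> * real (Suc n)))"
  shows "\<exists>l. \<forall>n. order_le (l - x n) (- (\<kappa> * real (Suc n)))"
proof -
  have const: "pcoeff (x (n + k)) a = pcoeff (x n) a" if "- (\<kappa> * real (Suc n)) < a" for n k a
  proof (induction k)
    case (Suc k)
    have "\<kappa> * real (Suc n) \<le> \<kappa> * real (Suc (n + k))" using assms(1) by (intro mult_left_mono) auto
    then have "pcoeff (x (Suc (n + k)) - x (n + k)) a = 0"
      using step[of "n + k"] that unfolding order_le_def by force
    then show ?case using Suc by simp
  qed simp
  define N where "N a = nat \<lceil>\<bar>a\<bar> / \<kappa>\<rceil>" for a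
  have N: "- (\<kappa> * real (Suc (N a))) < a" for a
  proof -
    have "\<bar>a\<bar> / \<kappa> < real (Suc (N a))" unfolding N_def by linarith
    then show ?thesis using assms(1) by (simp add: field_simps)
  qed
  define f where "f a = pcoeff (x (N a)) a" for a
  have f: "f a = pcoeff (x n) a" if "- (\<kappa> * real (Suc n)) < a" for n a
    using const[OF that, of "N a"] const[OF N[of a], of n] by (simp add: f_def add.commute)
  have "puiseux_exponents {a. f a \<noteq> 0}"
    unfolding puiseux_exponents_iff
  proof
    fix r
    have "f a = pcoeff (x (N r)) a" if "r \<le> a" for a using f N[of r] that by force
    then have "{a. f a \<noteq> 0} \<inter> {r..} \<subseteq> psupp (x (N r)) \<inter> {r..}" by (auto simp: in_psupp)
    then show "finite ({a. f a \<noteq> 0} \<inter> {r..})" using finite_supp_above finite_subset by blast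
  qed
  then obtain l where "pcoeff l = f" using Abs_puiseux_inverse[of f] by auto
  then have "order_le (l - x n) (- (\<kappa> * real (Suc n)))" for n
    using f by (simp add: order_le_def)
  then show ?thesis by blast
qed

text \<open>Polynomials over the valuation ring; \<open>residue_poly\<close> reduces them modulo the
  ideal of infinitesimals to real polynomials.\<close>

definition finite_poly :: "puiseux poly \<Rightarrow> bool" where
  "finite_poly p \<longleftrightarrow> (\<forall>k. order_le (coeff p k) 0)"

definition residue_poly :: "puiseux poly \<Rightarrow> real poly" where
  "residue_poly p = map_poly (\<lambda>x. pcoeff x 0) p"

lemma coeff_residue_poly [simp]: "coeff (residue_poly p) k = pcoeff (coeff p k) 0"
  by (simp add: residue_poly_def coeff_map_poly)

lemma finite_poly_pCons [simp]: "finite_poly (pCons a p) \<longleftrightarrow> order_le a 0 \<and> finite_poly p"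
  unfolding finite_poly_def coeff_pCons by (auto split: nat.splits)

lemma finite_poly_0 [simp]: "finite_poly 0" by (simp add: finite_poly_def)

lemma residue_poly_pCons [simp]: "residue_poly (pCons a p) = pCons (pcoeff a 0) (residue_poly p)"
  by (rule poly_eqI) (simp add: coeff_pCons split: nat.splits)

lemma residue_poly_0 [simp]: "residue_poly 0 = 0"
  by (rule poly_eqI) simp

lemma finite_poly_add: "finite_poly p \<Longrightarrow> finite_poly q \<Longrightarrow> finite_poly (p + q)"
  by (simp add: finite_poly_def order_le_add)

lemma residue_poly_add: "residue_poly (p + q) = residue_poly p + residue_poly q"
  by (rule poly_eqI) simp

lemma finite_poly_mult: "finite_poly p \<Longrightarrow> finite_poly q \<Longrightarrow> finite_poly (p * q)"
  using order_le_mult[where g = 0 and h = 0]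
  by (auto simp: finite_poly_def coeff_mult intro: order_le_sum)

lemma residue_poly_mult:
  assumes "finite_poly p" "finite_poly q"
  shows "residue_poly (p * q) = residue_poly p * residue_poly q"
proof (rule poly_eqI)
  fix k
  have "pcoeff (coeff p i * coeff q j) 0 = pcoeff (coeff p i) 0 * pcoeff (coeff q j) 0" for i j
    using pcoeff_mult_top[of "coeff p i" 0 "coeff q j" 0] assms unfolding finite_poly_def
    by (metis add_0)
  then show "coeff (residue_poly (p * q)) k = coeff (residue_poly p * residue_poly q) k"
    by (simp add: coeff_mult pcoeff_sum)
qed

lemma finite_residue_pcompose:
  assumes "finite_poly p" "finite_poly q"
  shows "finite_poly (pcompose p q) \<and> residue_poly (pcompose p q) = pcompose (residue_poly p) (residue_poly q)"
  using assms
proof (induction p)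
  case (pCons a p)
  then have *: "finite_poly (pcompose p q)" "residue_poly (pcompose p q) = pcompose (residue_poly p) (residue_poly q)"
    by auto
  have "finite_poly [:a:]" using pCons.prems by simp
  then show ?case using pCons.prems *
    by (simp add: pcompose_pCons finite_poly_add finite_poly_mult residue_poly_add residue_poly_mult)
qed simp

lemma order_le_of_nat_mult: "order_le x g \<Longrightarrow> order_le (of_nat n * x) g"
  by (induction n) (auto simp: algebra_simps intro: order_le_add)

lemma pcoeff_of_nat_mult: "pcoeff (of_nat n * x) a = real n * pcoeff x a"
  by (induction n) (auto simp: algebra_simps)

lemma finite_residue_higher_pderiv:
  assumes "finite_poly p"
  shows "finite_poly ((pderiv ^^ n) p) \<and> residue_poly ((pderiv ^^ n) p) = (pderiv ^^ n) (residue_poly p)"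
proof (induction n)
  case (Suc n)
  let ?q = "(pderiv ^^ n) p"
  have "finite_poly (pderiv ?q)"
    using Suc unfolding finite_poly_def coeff_pderiv by (metis order_le_of_nat_mult)
  moreover have "residue_poly (pderiv ?q) = pderiv (residue_poly ?q)"
    by (rule poly_eqI) (simp only: coeff_pderiv coeff_residue_poly pcoeff_of_nat_mult)
  ultimately show ?case using Suc by simp
qed (use assms in simp)

lemma finite_residue_eval:
  assumes "finite_poly p" "order_le x 0"
  shows "order_le (poly p x) 0 \<and> pcoeff (poly p x) 0 = poly (residue_poly p) (pcoeff x 0)"
  using assms
proof (induction p)
  case (pCons a p)
  then show ?case
    using order_le_mult[of x 0 "poly p x" 0] pcoeff_mult_top[of x 0 "poly p x" 0]
    by (auto intro: order_le_add)
qed simp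

text \<open>Finiteness of \<open>g\<close> is the point: the remainder has twice the order of
  \<open>h\<close>, which is what Newton's iteration gains from.\<close>

lemma finite_poly_taylor:
  assumes "finite_poly p" "order_le x 0" "order_le h 0"
  shows "\<exists>g. order_le g 0 \<and> poly p (x + h) = poly p x + h * poly (pderiv p) x + h * h * g"
  using assms(1)
proof (induction p)
  case 0
  then show ?case by (intro exI[of _ 0]) simp
next
  case (pCons a p)
  then have fp: "finite_poly p" by simp
  then obtain g where g: "order_le g 0" "poly p (x + h) = poly p x + h * poly (pderiv p) x + h * h * g"
    using pCons.IH by blast
  have "order_le (poly (pderiv p) x) 0"
    using finite_residue_higher_pderiv[OF fp, of 1] finite_residue_eval[of "pderiv p"] assms by simp
  moreover have "order_le ((x + h) * g) 0"
    using order_le_mult[of "x + h" 0 g 0] order_le_add g assms by simp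
  ultimately have "order_le (poly (pderiv p) x + (x + h) * g) 0" by (rule order_le_add)
  moreover have "poly (pCons a p) (x + h) = poly (pCons a p) x + h * poly (pderiv (pCons a p)) x
    + h * h * (poly (pderiv p) x + (x + h) * g)"
    unfolding poly_pCons pderiv_pCons poly_add g(2) by (simp add: algebra_simps)
  ultimately show ?case by blast
qed

text \<open>Newton's iteration from the constant series \<open>r\<close>. The derivative keeps a
  nonzero residue along the iteration, so its inverse stays finite. A gain of
  \<open>\<kappa>\<close> in each step suffices for convergence, hence only this linear rate is
  recorded.\<close>

lemma hensel_root:
  assumes f: "finite_poly f" and root: "poly (residue_poly f) r = 0"
    and simple: "poly (pderiv (residue_poly f)) r \<noteq> 0"
  shows "\<exists>\<rho>. order_le \<rho> 0 \<and> pcoeff \<rho> 0 = r \<and> poly f \<rho> = 0"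
proof -
  have f': "finite_poly (pderiv f)" "residue_poly (pderiv f) = pderiv (residue_poly f)"
    using finite_residue_higher_pderiv[OF f, of 1] by simp_all
  define x0 where "x0 = pmonom r 0"
  have x0: "order_le x0 0" "pcoeff x0 0 = r" by (auto simp: x0_def order_le_def pcoeff_monom)
  obtain \<kappa> where \<kappa>: "\<kappa> > 0" "order_le (poly f x0) (- \<kappa>)"
    using infinitesimal_order finite_residue_eval[OF f x0(1)] x0(2) root by auto
  define x where "x = rec_nat x0 (\<lambda>_ y. y - poly f y * inverse (poly (pderiv f) y))"
  have x_simps: "x 0 = x0" "x (Suc n) = x n - poly f (x n) * inverse (poly (pderiv f) (x n))" for n
    by (simp_all add: x_def)
  have inv: "order_le (x n) 0 \<and> pcoeff (x n) 0 = r \<and> order_le (poly f (x n)) (- (\<kappa> * real (Suc n))) \<and>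
      order_le (x (Suc n) - x n) (- (\<kappa> * real (Suc n)))" for n
  proof -
    have step: "order_le (x (Suc n) - x n) (- (\<kappa> * real (Suc n)))"
      if "order_le (x n) 0" "pcoeff (x n) 0 = r" "order_le (poly f (x n)) (- (\<kappa> * real (Suc n)))" for n
    proof -
      have "order_le (inverse (poly (pderiv f) (x n))) 0"
        by (rule order_le_inverse) (use finite_residue_eval[OF f'(1) that(1)] that f'(2) simple in auto)
      then show ?thesis using order_le_mult[OF that(3), of _ 0] by (simp add: x_simps(2))
    qed
    show ?thesis
    proof (induction n)
      case 0
      have "order_le (x 0) 0" "pcoeff (x 0) 0 = r" "order_le (poly f (x 0)) (- (\<kappa> * real (Suc 0)))"
        using x0 \<kappa>(2) by (simp_all add: x_simps(1))
      with step[OF this] show ?case by blast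
    next
      case (Suc n)
      define h where "h = x (Suc n) - x n"
      have h: "order_le h (- (\<kappa> * real (Suc n)))" using Suc by (simp add: h_def)
      have neg: "\<kappa> * real (Suc n) > 0" using \<kappa> by simp
      have h0: "order_le h 0" "pcoeff h 0 = 0"
        using h neg by (auto simp: order_le_def)
      have xs: "x (Suc n) = x n + h" by (simp add: h_def)
      have a: "order_le (x (Suc n)) 0" "pcoeff (x (Suc n)) 0 = r"
        using Suc h0 order_le_add by (auto simp: xs)
      have "poly (pderiv f) (x n) \<noteq> 0"
        using finite_residue_eval[OF f'(1), of "x n"] Suc f'(2) simple by auto
      then have "h * poly (pderiv f) (x n) = - poly f (x n)" by (simp add: h_def x_simps(2))
      then obtain g where g: "order_le g 0" "poly f (x (Suc n)) = h * h * g"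
        using finite_poly_taylor[OF f _ h0(1), of "x n"] Suc by (auto simp: xs)
      \<comment> \<open>The linear part of the Taylor expansion cancels by the choice of
        \<open>h\<close>. Doubling \<open>n + 1\<close> gives at least \<open>n + 2\<close>.\<close>
      have "order_le (h * h * g) (- (\<kappa> * real (Suc n)) + - (\<kappa> * real (Suc n)) + 0)"
        by (intro order_le_mult h g)
      then have "order_le (poly f (x (Suc n))) (- (\<kappa> * real (Suc (Suc n))))"
        unfolding g(2) by (rule order_le_mono) (use \<kappa> in \<open>simp add: algebra_simps\<close>)
      then show ?case using a step by blast
    qed
  qed
  then obtain \<rho> where \<rho>: "\<And>n. order_le (\<rho> - x n) (- (\<kappa> * real (Suc n)))"
    using puiseux_limit[OF \<kappa>(1), of x] by blast
  have fr: "order_le (\<rho> - x n) 0" for n by (rule order_le_mono[OF \<rho>]) (use \<kappa> in simp)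
  have "pcoeff (\<rho> - x 0) 0 = 0" using \<rho>[of 0] \<kappa> by (auto simp: order_le_def)
  then have r: "pcoeff \<rho> 0 = r" using x0 by (simp add: x_simps)
  have f\<rho>: "order_le \<rho> 0" using order_le_add[OF fr[of 0], of "x 0"] x0 by (simp add: x_simps)
  have small: "order_le (poly f \<rho>) (- (\<kappa> * real (Suc n)))" for n
  proof -
    obtain g where g: "order_le g 0" "poly f \<rho> = poly f (x n) + (\<rho> - x n) * poly (pderiv f) (x n)
        + (\<rho> - x n) * (\<rho> - x n) * g"
      using finite_poly_taylor[OF f _ fr, of "x n" n] inv[of n] by auto
    have "order_le ((\<rho> - x n) * poly (pderiv f) (x n)) (- (\<kappa> * real (Suc n)) + 0)"
      using finite_residue_eval[OF f'(1), of "x n"] inv[of n] by (intro order_le_mult \<rho>) auto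
    moreover have "order_le ((\<rho> - x n) * (\<rho> - x n) * g) (- (\<kappa> * real (Suc n)) + 0 + 0)"
      by (intro order_le_mult \<rho> g fr)
    ultimately show ?thesis unfolding g(2) using inv[of n] by (auto intro!: order_le_add)
  qed
  have "poly f \<rho> = 0"
  proof (rule puiseux_eqI)
    fix a
    obtain n where "\<bar>a\<bar> / \<kappa> < real n" using reals_Archimedean2 by blast
    then have "- (\<kappa> * real (Suc n)) < a" using \<kappa>(1) by (simp add: field_simps)
    then show "pcoeff (poly f \<rho>) a = pcoeff 0 a" using small[of n] by (simp add: order_le_def)
  qed
  then show ?thesis using r f\<rho> by blast
qed

section \<open>Intermediate values over the Puiseux series, from those of real residue
  polynomials\<close>

instance real :: real_closed_field
proof
  fix a b :: real and f :: "nat \<Rightarrow> real" and n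
  assume ab: "a < b" "(\<Sum>k\<le>n. f k * a ^ k) < 0" "0 < (\<Sum>k\<le>n. f k * b ^ k)"
  have "continuous_on {a..b} (\<lambda>x. \<Sum>k\<le>n. f k * x ^ k)" by (intro continuous_intros)
  then obtain x where "a \<le> x" "x \<le> b" "(\<Sum>k\<le>n. f k * x ^ k) = 0"
    using IVT'[of "\<lambda>x. \<Sum>k\<le>n. f k * x ^ k" a 0 b] ab by auto
  with ab show "\<exists>x. a < x \<and> x < b \<and> (\<Sum>k\<le>n. f k * x ^ k) = 0"
    by (metis le_less less_irrefl)
qed

text \<open>Taylor's formula at \<open>c\<close>, cleared of denominators.\<close>

lemma fact_mult_coeff_shift:
  fixes p :: "'a::field_char_0 poly"
  shows "fact k * coeff (pcompose p [:c, 1:]) k = poly ((pderiv ^^ k) p) c"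
proof -
  have "(pderiv ^^ k) (pcompose p [:c, 1:]) = pcompose ((pderiv ^^ k) p) [:c, 1:]"
    by (induction k) (simp_all add: pderiv_pcompose pderiv_pCons)
  then have "coeff ((pderiv ^^ k) (pcompose p [:c, 1:])) 0 = poly ((pderiv ^^ k) p) c" by simp
  then show ?thesis by (simp add: coeff_higher_pderiv pochhammer_fact)
qed

lemma pcompose_shift_order:
  fixes p :: "'a::field_char_0 poly"
  assumes "p \<noteq> 0"
  shows "\<exists>s. p = [:- c, 1:] ^ order c p * s \<and> poly s c \<noteq> 0 \<and>
    pcompose p [:c, 1:] = monom 1 (order c p) * pcompose s [:c, 1:]"
proof -
  obtain s where s: "p = [:- c, 1:] ^ order c p * s" "\<not> [:- c, 1:] dvd s"
    using order_decomp[OF assms] by blast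
  have "poly (pcompose p [:c, 1:]) x = poly (monom 1 (order c p) * pcompose s [:c, 1:]) x" for x
    by (subst s(1)) (simp add: poly_pcompose poly_monom)
  then have "pcompose p [:c, 1:] = monom 1 (order c p) * pcompose s [:c, 1:]"
    by (intro poly_eq_poly_eq_iff[THEN iffD1] ext)
  then show ?thesis using s by (auto simp: poly_eq_0_iff_dvd)
qed

lemma plead_coeff_eq: "order_le x g \<Longrightarrow> pcoeff x g \<noteq> 0 \<Longrightarrow> plead_coeff x = pcoeff x g"
  by (simp add: plead_coeff_def lead_exp_eq)

lemma puiseux_neg_iff: "x < 0 \<longleftrightarrow> plead_coeff x < 0"
  using puiseux_pos_iff[of "- x"] by simp

lemma plead_coeff_mult: "plead_coeff (x * y) = plead_coeff x * plead_coeff y"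
  by (cases "x = 0 \<or> y = 0") (auto simp: plead_mult(3))

lemma order_le_pmonom: "g \<le> h \<Longrightarrow> order_le (pmonom c g) h"
  by (simp add: order_le_def pcoeff_monom)

lemma pmonom_power: "pmonom 1 g ^ n = pmonom 1 (real n * g)"
  by (induction n) (simp_all add: pmonom_1_0 pmonom_mult_monom algebra_simps)

lemma order_le_monom_mult: "order_le x g \<Longrightarrow> order_le (pmonom c h * x) (h + g)"
  by (intro order_le_mult order_le_pmonom) auto

lemma order_le_between:
  assumes "order_le a 0" "order_le b 0" "a \<le> x" "x \<le> b"
  shows "order_le x 0"
proof -
  have "order_le (x - a) 0"
    by (rule order_le_antimono[of _ "b - a"]) (use assms in \<open>auto intro: order_le_diff\<close>)
  then show ?thesis using order_le_add[OF _ assms(1), of "x - a"] by simp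
qed

text \<open>The intermediate value property on an interval whose residues contain at most one zero
  of the residue polynomial, indexed by its multiplicity for an induction. It quantifies over all
  \<open>q\<close>, since the induction step passes to a shifted and rescaled polynomial. For
  \<open>m = 0\<close> the point \<open>r\<close> is not a zero.\<close>

definition local_ivp :: "nat \<Rightarrow> bool" where
  "local_ivp m \<longleftrightarrow> (\<forall>q a b r. finite_poly q \<longrightarrow> residue_poly q \<noteq> 0 \<longrightarrow> order r (residue_poly q) = m \<longrightarrow>
    order_le a 0 \<longrightarrow> order_le b 0 \<longrightarrow> a < b \<longrightarrow> poly q a * poly q b < 0 \<longrightarrow>
    pcoeff a 0 \<le> r \<longrightarrow> r \<le> pcoeff b 0 \<longrightarrow>
    (\<forall>t. pcoeff a 0 \<le> t \<longrightarrow> t \<le> pcoeff b 0 \<longrightarrow> t \<noteq> r \<longrightarrow> poly (residue_poly q) t \<noteq> 0) \<longrightarrow>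
    (\<exists>x. a < x \<and> x < b \<and> poly q x = 0))"

text \<open>The interval of series is not compact, but the real interval of its residues is. If
  \<open>q\<close> had no zero, \<open>local_ivp\<close> would exclude a change of sign near each
  residue \<open>t\<close>, and bisection over the residues would give both ends the same
  sign.\<close>

lemma finite_ivp:
  assumes q: "finite_poly q" "residue_poly q \<noteq> 0"
    and loc: "\<And>t. local_ivp (order t (residue_poly q))"
    and ab: "order_le a 0" "order_le b 0" "a < b" "poly q a * poly q b < 0"
  shows "\<exists>x. a < x \<and> x < b \<and> poly q x = 0"
proof (rule ccontr)
  assume no: "\<not> ?thesis"
  have nz: "poly q x \<noteq> 0" if "a \<le> x" "x \<le> b" for x
    using no ab(4) that by (cases "x = a \<or> x = b") (auto simp: le_less)
  let ?P = "residue_poly q"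
  define same where "same u v \<longleftrightarrow> (\<forall>x y. a \<le> x \<longrightarrow> x \<le> b \<longrightarrow> a \<le> y \<longrightarrow> y \<le> b \<longrightarrow>
    pcoeff x 0 = u \<longrightarrow> pcoeff y 0 = v \<longrightarrow> poly q x * poly q y > 0)" for u v
  have fin: "order_le x 0" if "a \<le> x" "x \<le> b" for x
    using order_le_between[OF ab(1,2)] that by blast
  have res: "pcoeff a 0 \<le> pcoeff x 0" "pcoeff x 0 \<le> pcoeff b 0" if "a \<le> x" "x \<le> b" for x
    using pcoeff_mono[OF ab(1) fin] pcoeff_mono[OF fin ab(2)] that by blast+
  have ab0: "pcoeff a 0 \<le> pcoeff b 0" using res[of a] ab by simp
  \<comment> \<open>At the two extreme residues the constant series may lie outside of the interval,
    so \<open>a\<close> or \<open>b\<close> itself is taken.\<close>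
  have ex: "\<exists>z. a \<le> z \<and> z \<le> b \<and> pcoeff z 0 = v" if v: "pcoeff a 0 \<le> v" "v \<le> pcoeff b 0" for v
  proof -
    consider "v = pcoeff a 0" | "v = pcoeff b 0" | "pcoeff a 0 < v" "v < pcoeff b 0" using v by linarith
    then show ?thesis
    proof cases
      case 3
      let ?z = "pmonom v 0"
      have z: "order_le ?z 0" "pcoeff ?z 0 = v" by (auto simp: order_le_pmonom pcoeff_monom)
      have "\<not> ?z < a" "\<not> b < ?z"
        using pcoeff_mono[OF z(1) ab(1)] pcoeff_mono[OF ab(2) z(1)] z(2) 3 by auto
      then show ?thesis using z by (intro exI[of _ ?z]) auto
    qed (use ab in \<open>auto intro: exI[of _ a] exI[of _ b]\<close>)
  qed
  have "same (pcoeff a 0) (pcoeff b 0)" using ab0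
  proof (induction rule: Bolzano)
    case (trans u v w)
    show ?case unfolding same_def
    proof (intro allI impI)
      fix x y assume xy: "a \<le> x" "x \<le> b" "a \<le> y" "y \<le> b" "pcoeff x 0 = u" "pcoeff y 0 = w"
      then obtain z where z: "a \<le> z" "z \<le> b" "pcoeff z 0 = v"
        using ex[of v] trans(3,4) res by (metis order_trans)
      have "poly q x * poly q z > 0" "poly q z * poly q y > 0"
        using trans(1,2) xy z unfolding same_def by blast+
      then show "poly q x * poly q y > 0" by (auto simp: zero_less_mult_iff)
    qed
  next
    case (local t)
    \<comment> \<open>Residue intervals around \<open>t\<close> of length below \<open>d\<close>
      contain no zero of the residue polynomial other than possibly \<open>t\<close>.\<close>
    obtain d where d: "d > 0" "\<And>s. poly ?P s = 0 \<Longrightarrow> s \<noteq> t \<Longrightarrow> d \<le> dist t s"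
      using finite_set_avoid[OF poly_roots_finite[OF q(2)], of t] by blast
    have key: False if xy: "a \<le> x" "x < y" "y \<le> b" "poly q x * poly q y < 0"
      "pcoeff x 0 \<le> t" "t \<le> pcoeff y 0" "pcoeff y 0 - pcoeff x 0 < d" for x y
    proof -
      have "\<exists>z. x < z \<and> z < y \<and> poly q z = 0"
      proof (rule loc[of t, unfolded local_ivp_def, rule_format])
        show "order_le x 0" "order_le y 0" using fin xy by auto
        fix s assume s: "pcoeff x 0 \<le> s" "s \<le> pcoeff y 0" "s \<noteq> t"
        then have "dist t s < d" using xy by (auto simp: dist_real_def)
        then show "poly ?P s \<noteq> 0" using d(2)[of s] s by force
      qed (use q xy in auto)
      then show False using nz xy by (meson less_imp_le less_trans le_less_trans less_le_trans)
    qed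
    have "same u v" if uv: "u \<le> t" "t \<le> v" "v - u < d" for u v
      unfolding same_def
    proof (intro allI impI)
      fix x y assume xy: "a \<le> x" "x \<le> b" "a \<le> y" "y \<le> b" "pcoeff x 0 = u" "pcoeff y 0 = v"
      have nz2: "poly q x * poly q y \<noteq> 0" using nz xy by simp
      have "\<not> poly q x * poly q y < 0"
      proof
        assume neg: "poly q x * poly q y < 0"
        consider "x < y" | "y < x" | "x = y" by fastforce
        then show False
        proof cases
          case 1
          then show False using key[of x y] xy uv neg by simp
        next
          case 2
          then have "v \<le> u" using pcoeff_mono[OF fin fin, of y x] xy by simp
          then show False using key[of y x] xy uv neg 2 d(1) by (simp add: mult.commute)
        next
          case 3
          then show False using neg by (simp add: mult_less_0_iff)
        qed
      qed
      then show "poly q x * poly q y > 0" using nz2 by (metis neqE)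
    qed
    then show ?case using d(1) by blast
  qed
  then have "poly q a * poly q b > 0" using ab unfolding same_def by auto
  then show False using ab(4) by simp
qed

text \<open>For infinite \<open>x\<close> of order below \<open>c\<close>, the terms of degree less
  than \<open>m\<close> lose because their coefficients are finite, and those of higher degree
  because their coefficients decay faster than the powers of \<open>x\<close> grow. The degree
  \<open>m\<close> is a vertex of the Newton polygon.\<close>

lemma dominant_term:
  assumes q: "finite_poly q" "pcoeff (coeff q m) 0 \<noteq> 0"
    and high: "\<And>k. m < k \<Longrightarrow> order_le (coeff q k) (- (c * (real k - real m)))"
    and x: "0 < lead_exp x" "lead_exp x < c"
  shows "order_le (poly q x) (real m * lead_exp x)"
    "pcoeff (poly q x) (real m * lead_exp x) = pcoeff (coeff q m) 0 * plead_coeff x ^ m"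
proof -
  let ?e = "lead_exp x"
  have xk: "order_le (x ^ k) (real k * ?e)" for k by (intro order_le_power order_le_lead_exp)
  have small: "order_le (coeff q k * x ^ k) (real m * ?e) \<and> pcoeff (coeff q k * x ^ k) (real m * ?e) = 0"
    if "k \<noteq> m" for k
  proof -
    have "\<exists>g. order_le (coeff q k) g \<and> g + real k * ?e < real m * ?e"
    proof (cases "k < m")
      case True
      then have "real k * ?e < real m * ?e" using x(1) by simp
      then show ?thesis using q(1) by (intro exI[of _ 0]) (simp add: finite_poly_def)
    next
      case False
      then have km: "m < k" using that by simp
      then have "0 < (real k - real m) * (c - ?e)" using x by simp
      then have "- (c * (real k - real m)) + real k * ?e < real m * ?e" by (simp add: algebra_simps)
      then show ?thesis using high[OF km] by blast
    qed
    then obtain g where g: "order_le (coeff q k) g" "g + real k * ?e < real m * ?e" by blast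
    have "order_le (coeff q k * x ^ k) (g + real k * ?e)" by (intro order_le_mult g xk)
    then show ?thesis using g(2) by (auto simp: order_le_def)
  qed
  have top: "order_le (coeff q m * x ^ m) (0 + real m * ?e)"
    "pcoeff (coeff q m * x ^ m) (0 + real m * ?e) = pcoeff (coeff q m) 0 * plead_coeff x ^ m"
    using order_le_mult[OF _ xk, of "coeff q m" 0] pcoeff_mult_top[OF _ xk, of "coeff q m" 0]
      pcoeff_power_top[OF order_le_lead_exp, of x m] q(1)
    by (auto simp: finite_poly_def plead_coeff_def)
  show "order_le (poly q x) (real m * ?e)"
    unfolding poly_altdef
  proof (rule order_le_sum)
    fix k show "order_le (coeff q k * x ^ k) (real m * ?e)"
      using small[of k] top(1) by (cases "k = m") auto
  qed
  have "m \<le> degree q" using q(2) by (intro le_degree) auto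
  then have "pcoeff (poly q x) (real m * ?e) = (\<Sum>k\<in>{m}. pcoeff (coeff q k * x ^ k) (real m * ?e))"
    unfolding poly_altdef pcoeff_sum by (intro sum.mono_neutral_right) (use small in auto)
  then show "pcoeff (poly q x) (real m * ?e) = pcoeff (coeff q m) 0 * plead_coeff x ^ m"
    using top(2) by simp
qed

text \<open>A zero \<open>t\<close> of multiplicity \<open>m\<close> would make \<open>p\<close> a
  multiple of the \<open>m\<close>-th power of \<open>X - t\<close>. Vanishing of the coefficient of
  degree \<open>m - 1\<close> then forces \<open>t = 0\<close>, which leaves no room for a nonzero
  coefficient of smaller degree.\<close>

lemma order_less_degree_of_depressed:
  fixes p :: "'a::field_char_0 poly"
  assumes m: "degree p = m" "m > 0" "coeff p (m - 1) = 0" and k: "k < m" "coeff p k \<noteq> 0"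
  shows "order t p < m"
proof (rule ccontr)
  assume "\<not> order t p < m"
  have p: "p \<noteq> 0" using k by auto
  then have o: "order t p = m" using \<open>\<not> order t p < m\<close> order_degree[OF p, of t] m by simp
  obtain s where s: "p = [:- t, 1:] ^ m * s" "pcompose p [:t, 1:] = monom 1 m * pcompose s [:t, 1:]"
    using pcompose_shift_order[OF p, of t] o by auto
  let ?d = "(pderiv ^^ (m - 1)) p"
  define c where "c = pochhammer (of_nat 2) (m - 1) * coeff p m"
  have d0: "poly ?d t = 0"
    using fact_mult_coeff_shift[of "m - 1" p t] m(2) by (simp add: s(2) coeff_monom_mult)
  \<comment> \<open>The derivative of order \<open>m - 1\<close> is linear, and its constant term is
    a multiple of the vanishing coefficient.\<close>
  have d1: "?d = [:0, c:]"
  proof (rule poly_eqI)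
    fix n :: nat
    consider "n = 0" | "n = 1" | "n \<ge> 2" by linarith
    then show "coeff ?d n = coeff [:0, c:] n"
    proof cases
      case 3
      then have "coeff p (n + (m - 1)) = 0" using m by (intro coeff_eq_0) simp
      then show ?thesis using 3 by (simp add: coeff_higher_pderiv coeff_pCons split: nat.splits)
    qed (use m in \<open>simp_all add: coeff_higher_pderiv c_def\<close>)
  qed
  have "pochhammer (2::nat) (m - 1) > 0" by (rule pochhammer_pos) simp
  moreover have "coeff p m \<noteq> 0" using p m(1) by (metis leading_coeff_0_iff)
  ultimately have "c \<noteq> 0" unfolding c_def pochhammer_of_nat by simp
  then have "t = 0" using d0 unfolding d1 by simp
  then have "p = monom 1 m * s" using s(1) by (simp add: monom_altdef)
  then show False using k by (simp add: coeff_monom_mult)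
qed

lemma sgn_power_real: "sgn (x ^ n) = sgn x ^ n" for x :: real
  by (induction n) (simp_all add: sgn_mult)

text \<open>Shifting by a zero \<open>\<rho>\<close> of the derivative of order \<open>m - 1\<close> removes the coefficient of degree \<open>m - 1\<close>.
  After rescaling, the residue polynomial has degree \<open>m\<close> and is not an \<open>m\<close>-th power, so that all its
  zeros have multiplicity less than \<open>m\<close>.\<close>

lemma local_ivp_step:
  assumes IH: "\<And>k. k < m \<Longrightarrow> local_ivp k"
  shows "local_ivp m"
  unfolding local_ivp_def
proof (intro allI impI)
  fix q a b r
  assume q: "finite_poly q" and P0: "residue_poly q \<noteq> 0" and m: "order r (residue_poly q) = m"
    and ab: "order_le a 0" "order_le b 0" "a < b" "poly q a * poly q b < 0"
    and r: "pcoeff a 0 \<le> r" "r \<le> pcoeff b 0"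
    and iso: "\<forall>t. pcoeff a 0 \<le> t \<longrightarrow> t \<le> pcoeff b 0 \<longrightarrow> t \<noteq> r \<longrightarrow> poly (residue_poly q) t \<noteq> 0"
  let ?P = "residue_poly q"
  have opp: "plead_coeff (poly q a) * plead_coeff (poly q b) < 0"
    using ab(4) by (simp add: puiseux_neg_iff plead_coeff_mult)
  obtain S where S: "?P = [:- r, 1:] ^ m * S" "poly S r \<noteq> 0"
    "pcompose ?P [:r, 1:] = monom 1 m * pcompose S [:r, 1:]"
    using pcompose_shift_order[OF P0, of r] m by auto
  have Snz: "poly S t \<noteq> 0" if "pcoeff a 0 \<le> t" "t \<le> pcoeff b 0" for t
    using iso that S(2) by (cases "t = r") (auto simp: S(1))
  have Ssgn: "sgn (poly S t) = sgn (poly S r)" if "pcoeff a 0 \<le> t" "t \<le> pcoeff b 0" for t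
    by (rule sgn_poly_eq) (use that r Snz in auto)
  show "\<exists>x. a < x \<and> x < b \<and> poly q x = 0"
  proof (cases "m = 0")
    case True
    \<comment> \<open>Without a zero of the residue polynomial there is no change of sign, against
      the assumption on the ends.\<close>
    have "sgn (plead_coeff (poly q x)) = sgn (poly S r)"
      if x: "order_le x 0" "pcoeff a 0 \<le> pcoeff x 0" "pcoeff x 0 \<le> pcoeff b 0" for x
    proof -
      have "pcoeff (poly q x) 0 = poly S (pcoeff x 0)" "order_le (poly q x) 0"
        using finite_residue_eval[OF q x(1)] S(1) True by auto
      then show ?thesis using plead_coeff_eq[of "poly q x" 0] Snz Ssgn x by simp
    qed
    from this[of a] this[of b] have "sgn (plead_coeff (poly q a)) = sgn (plead_coeff (poly q b))"
      using ab r by simp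
    then show ?thesis using opp by (auto simp: mult_less_0_iff sgn_if split: if_splits)
  next
    case False
    define f where "f = (pderiv ^^ (m - 1)) q"
    have f: "finite_poly f" "residue_poly f = (pderiv ^^ (m - 1)) ?P"
      using finite_residue_higher_pderiv[OF q] by (auto simp: f_def)
    have "poly (residue_poly f) r = 0"
      using fact_mult_coeff_shift[of "m - 1" ?P r] False by (simp add: f S(3) coeff_monom_mult)
    moreover have "poly (pderiv (residue_poly f)) r \<noteq> 0"
    proof -
      have "pderiv (residue_poly f) = (pderiv ^^ m) ?P"
        using False by (metis f(2) funpow.simps(2) o_apply Suc_pred' neq0_conv)
      moreover have "poly ((pderiv ^^ m) ?P) r = fact m * poly S r"
        using fact_mult_coeff_shift[of m ?P r] by (simp add: S(3) coeff_monom_mult)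
      ultimately show ?thesis using S(2) by simp
    qed
    ultimately obtain \<rho> where \<rho>: "order_le \<rho> 0" "pcoeff \<rho> 0 = r" "poly f \<rho> = 0"
      using hensel_root[OF f(1)] by blast
    define q1 where "q1 = pcompose q [:\<rho>, 1:]"
    have q1: "finite_poly q1" "residue_poly q1 = monom 1 m * pcompose S [:r, 1:]"
      using finite_residue_pcompose[OF q, of "[:\<rho>, 1:]"] \<rho> S(3) by (auto simp: q1_def pcoeff_1)
    have q1_eval: "poly q1 (x - \<rho>) = poly q x" for x by (simp add: q1_def poly_pcompose)
    have q1c: "pcoeff (coeff q1 k) 0 = (if k < m then 0 else coeff (pcompose S [:r, 1:]) (k - m))" for k
      unfolding coeff_residue_poly[symmetric] q1(2) coeff_monom_mult by simp
    have q1m: "pcoeff (coeff q1 m) 0 = poly S r" by (simp add: q1c)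
    have "fact (m - 1) * coeff q1 (m - 1) = 0"
      using fact_mult_coeff_shift[of "m - 1" q \<rho>] \<rho>(3) by (simp add: q1_def f_def)
    then have q1m1: "coeff q1 (m - 1) = 0" by simp
    define a1 b1 where "a1 = a - \<rho>" and "b1 = b - \<rho>"
    have opp1: "plead_coeff (poly q1 a1) * plead_coeff (poly q1 b1) < 0"
      using opp by (simp add: a1_def b1_def q1_eval)
    have q1S: "pcoeff (poly q1 x) 0 = pcoeff x 0 ^ m * poly S (r + pcoeff x 0)" "order_le (poly q1 x) 0"
      if "order_le x 0" for x
      using finite_residue_eval[OF q1(1) that] by (auto simp: q1(2) poly_monom poly_pcompose)
    \<comment> \<open>All that is kept of the position of \<open>x + \<rho>\<close> between the old
      ends: the factor \<open>S\<close> has the sign of \<open>poly S r\<close> at its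
      residue.\<close>
    define good where "good x \<longleftrightarrow> order_le x 0 \<and> sgn (poly S (r + pcoeff x 0)) = sgn (poly S r)" for x
    have "pcoeff a 0 \<le> pcoeff b 0" using r by simp
    then have good: "good a1" "good b1"
      using ab \<rho> Ssgn[of "pcoeff a 0"] Ssgn[of "pcoeff b 0"]
      by (auto simp: good_def a1_def b1_def order_le_diff)
    have ab1: "a1 < b1" using ab by (simp add: a1_def b1_def)
    have "\<exists>x. a1 < x \<and> x < b1 \<and> poly q1 x = 0"
    proof (cases "\<forall>k<m. coeff q1 k = 0")
      case True
      \<comment> \<open>Here \<open>q1\<close> is a power of \<open>X\<close> times a factor of
        constant sign at good points, and 0 is a zero. If both ends lay on one side of 0, their
        signs would agree, so 0 lies strictly between them.\<close>
      then obtain s where s: "q1 = monom 1 m * s"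
        using monom_1_dvd_iff'[of m q1] by auto
      have cs: "coeff s k = coeff q1 (k + m)" for k by (simp add: s coeff_monom_mult)
      have fs: "finite_poly s" using q1(1) by (simp add: finite_poly_def cs)
      have "residue_poly s = pcompose S [:r, 1:]"
        by (rule poly_eqI) (simp add: cs q1c)
      then have sS: "pcoeff (poly s x) 0 = poly S (r + pcoeff x 0)" "order_le (poly s x) 0"
        if "order_le x 0" for x using finite_residue_eval[OF fs that] by (auto simp: poly_pcompose)
      have sg: "sgn (plead_coeff (poly s x)) = sgn (poly S r)" if "good x" for x
      proof -
        have "sgn (pcoeff (poly s x) 0) = sgn (poly S r)" using that sS by (simp add: good_def)
        then show ?thesis using plead_coeff_eq[of "poly s x" 0] sS[of x] S(2) that
          by (metis good_def sgn_0_0)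
      qed
      have q1s: "sgn (plead_coeff (poly q1 x)) = sgn (plead_coeff x) ^ m * sgn (poly S r)" if "good x" for x
      proof -
        have "plead_coeff (x ^ m) = plead_coeff x ^ m" for x
          by (induction m) (simp_all add: plead_coeff_mult plead_coeff_eq[of 1 0] pcoeff_1)
        then show ?thesis using sg[OF that] by (simp add: s poly_monom plead_coeff_mult sgn_mult sgn_power_real)
      qed
      have ne: "sgn (plead_coeff (poly q1 a1)) \<noteq> sgn (plead_coeff (poly q1 b1))"
        using opp1 by (auto simp: mult_less_0_iff sgn_if)
      have z: "poly q1 0 = 0" using False by (simp add: s poly_monom)
      have "a1 \<noteq> 0" "b1 \<noteq> 0" using opp1 z by auto
      moreover have "\<not> (0 < a1)"
      proof
        assume "0 < a1"
        then have "0 < plead_coeff a1" "0 < plead_coeff b1" using ab1 less_trans unfolding puiseux_pos_iff[symmetric] by blast+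
        then show False using ne q1s good by simp
      qed
      moreover have "\<not> (b1 < 0)"
      proof
        assume "b1 < 0"
        then have "plead_coeff a1 < 0" "plead_coeff b1 < 0" using ab1 less_trans unfolding puiseux_neg_iff[symmetric] by blast+
        then show False using ne q1s good by simp
      qed
      ultimately show ?thesis using z by (intro exI[of _ 0]) auto
    next
      case B: False
      define K where "K = {k. k < m \<and> coeff q1 k \<noteq> 0}"
      have K: "finite K" "K \<noteq> {}" using B by (auto simp: K_def)
      \<comment> \<open>A slope of the Newton polygon: the largest \<open>c\<close> for which the
        rescaled coefficients of degree below \<open>m\<close> stay finite. It is attained at
        \<open>k0\<close>, whose coefficient thus gets a nonzero residue; it is positive because
        these coefficients of \<open>q1\<close> are infinitesimal.\<close>
      define c where "c = - Max ((\<lambda>k. lead_exp (coeff q1 k) / (real m - real k)) ` K)"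
      have "- c \<in> (\<lambda>k. lead_exp (coeff q1 k) / (real m - real k)) ` K"
        unfolding c_def minus_minus by (rule Max_in) (use K in auto)
      then obtain k0 where k0: "k0 \<in> K" "lead_exp (coeff q1 k0) = - c * (real m - real k0)"
        by (auto simp: K_def field_simps)
      have cK: "lead_exp (coeff q1 k) \<le> - c * (real m - real k)" if "k \<in> K" for k
      proof -
        have "lead_exp (coeff q1 k) / (real m - real k) \<le> - c"
          unfolding c_def minus_minus by (rule Max_ge) (use K that in auto)
        then show ?thesis using that by (simp add: K_def pos_divide_le_eq)
      qed
      have "lead_exp (coeff q1 k0) < 0"
      proof -
        have "coeff q1 k0 \<noteq> 0" "k0 < m" using k0 by (auto simp: K_def)
        then have "lead_exp (coeff q1 k0) \<le> 0" "lead_exp (coeff q1 k0) \<noteq> 0"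
          using lead_exp_le q1(1) pcoeff_lead_exp[of "coeff q1 k0"] q1c[of k0]
          by (auto simp: finite_poly_def)
        then show ?thesis by simp
      qed
      then have c: "c > 0" using k0 by (auto simp: K_def zero_less_mult_iff)
      \<comment> \<open>The variable is stretched by \<open>t\<close> to the power \<open>c\<close>,
        and the outer factor restores the coefficient of degree \<open>m\<close>. The coefficients
        of higher degree become infinitesimal.\<close>
      define q2 where "q2 = smult (pmonom 1 (c * real m)) (pcompose q1 [:0, pmonom 1 (- c):])"
      have q2c: "coeff q2 k = pmonom 1 (c * (real m - real k)) * coeff q1 k" for k
      proof -
        have "coeff q2 k = pmonom 1 (c * real m) * (pmonom 1 (real k * - c) * coeff q1 k)"
          by (simp only: q2_def coeff_smult coeff_pcompose_linear pmonom_power)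
        also have "\<dots> = (pmonom 1 (c * real m) * pmonom 1 (real k * - c)) * coeff q1 k"
          by (rule mult.assoc[symmetric])
        also have "pmonom 1 (c * real m) * pmonom 1 (real k * - c) = pmonom 1 (c * (real m - real k))"
          by (simp only: pmonom_mult_monom) (simp add: algebra_simps)
        finally show ?thesis .
      qed
      have q2p: "pcoeff (coeff q2 k) 0 = pcoeff (coeff q1 k) (- (c * (real m - real k)))" for k
        by (simp add: q2c pcoeff_monom_mult)
      have high: "order_le (coeff q2 k) (- (c * (real k - real m)))" if "m < k" for k
        using order_le_monom_mult[of "coeff q1 k" 0 1 "c * (real m - real k)"] q1(1)
        by (simp add: finite_poly_def q2c algebra_simps)
      have high0: "order_le (coeff q2 k) 0 \<and> pcoeff (coeff q2 k) 0 = 0" if "m < k" for k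
      proof -
        have "0 < c * (real k - real m)" using c that by simp
        then show ?thesis using high[OF that] by (auto simp: order_le_def)
      qed
      have "order_le (coeff q2 k) 0" for k
      proof -
        consider "m < k" | "k = m" | "k \<in> K" | "k < m" "coeff q1 k = 0" by (force simp: K_def)
        then show ?thesis
        proof cases
          case 3
          have "order_le (coeff q2 k) (c * (real m - real k) + lead_exp (coeff q1 k))"
            unfolding q2c by (intro order_le_monom_mult order_le_lead_exp)
          then show ?thesis by (rule order_le_mono) (use cK[OF 3] in simp)
        qed (use high0 q1(1) in \<open>auto simp: q2c finite_poly_def pmonom_1_0\<close>)
      qed
      then have q2: "finite_poly q2" by (simp add: finite_poly_def)
      let ?P2 = "residue_poly q2"
      have P2m: "coeff ?P2 m = poly S r" by (simp add: q2p q1m)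
      have deg: "degree ?P2 = m"
        by (rule antisym) (use high0 P2m S(2) in \<open>auto intro!: degree_le le_degree\<close>)
      have P2k: "coeff ?P2 k0 \<noteq> 0"
        using pcoeff_lead_exp[of "coeff q1 k0"] k0 by (simp add: q2p K_def)
      have ord: "order t ?P2 < m" for t
        by (rule order_less_degree_of_depressed[OF deg _ _ _ P2k]) (use False k0 q1m1 in \<open>auto simp: q2p K_def\<close>)
      have P2nz: "?P2 \<noteq> 0" using P2k by (metis coeff_0)
      define T where "T = pmonom 1 c"
      have T: "0 < T" "T \<noteq> 0"
        using order_le_pos_iff[of T c] by (auto simp: T_def order_le_pmonom pcoeff_monom)
      have q2_eval: "poly q2 (x * T) = pmonom 1 (c * real m) * poly q1 x" for x
        by (simp add: q2_def poly_pcompose T_def mult.assoc pmonom_mult_monom pmonom_1_0)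
      have sgn2: "sgn (plead_coeff (poly q2 (x * T))) = sgn (plead_coeff (poly q1 x))" for x
      proof -
        have "plead_coeff (pmonom 1 (c * real m)) = 1"
          using plead_coeff_eq[of "pmonom 1 (c * real m)" "c * real m"] by (simp add: order_le_pmonom pcoeff_monom)
        then show ?thesis by (simp add: q2_eval plead_coeff_mult)
      qed
      define \<sigma> where "\<sigma> x = sgn (plead_coeff (poly q2 x))" for x
      \<comment> \<open>At arguments that become infinite after the stretching, the term of degree
        \<open>m\<close> fixes the sign: by \<open>dominant_term\<close> if \<open>x\<close> is
        infinitesimal, and by the residue of \<open>q1\<close> if \<open>x\<close> has order
        0.\<close>
      have unbounded_sgn: "\<sigma> (x * T) = sgn (poly S r) * sgn (plead_coeff x) ^ m"
        if x: "good x" "\<not> order_le (x * T) 0" for x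
      proof -
        have x0: "x \<noteq> 0" using x(2) by auto
        have le: "lead_exp x \<le> 0" using lead_exp_le[OF x0] x(1) by (simp add: good_def)
        have Tl: "lead_exp T = c" "plead_coeff T = 1"
          using lead_exp_eq[of T c] plead_coeff_eq[of T c] by (auto simp: T_def order_le_pmonom pcoeff_monom)
        have xT: "lead_exp (x * T) = lead_exp x + c" "plead_coeff (x * T) = plead_coeff x"
          using plead_mult(2)[OF x0 T(2)] Tl by (auto simp: plead_coeff_mult)
        have pos: "0 < lead_exp (x * T)"
          using x(2) order_le_lead_exp[of "x * T"] order_le_mono by (meson not_less)
        show ?thesis
        proof (cases "lead_exp x < 0")
          case True
          have nz: "pcoeff (coeff q2 m) 0 \<noteq> 0" using P2m S(2) by simp
          have "lead_exp (x * T) < c" using True xT by simp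
          note dom = dominant_term[OF q2 nz high pos this]
          have "plead_coeff (poly q2 (x * T)) = poly S r * plead_coeff x ^ m"
            using plead_coeff_eq[OF dom(1)] dom(2) P2m S(2) plead_coeff_nz[OF x0] by (simp add: xT)
          then show ?thesis by (simp add: \<sigma>_def sgn_mult sgn_power_real)
        next
          case l: False
          then have "pcoeff x 0 = plead_coeff x" using le by (simp add: plead_coeff_def)
          then have e: "pcoeff (poly q1 x) 0 = plead_coeff x ^ m * poly S (r + pcoeff x 0)"
            using q1S(1) x(1) by (simp add: good_def)
          have "poly S (r + pcoeff x 0) \<noteq> 0" using x(1) S(2) by (metis good_def sgn_0_0)
          then have "plead_coeff (poly q1 x) = plead_coeff x ^ m * poly S (r + pcoeff x 0)"
            using plead_coeff_eq[OF q1S(2)] e x(1) plead_coeff_nz[OF x0] by (simp add: good_def)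
          then show ?thesis using x(1) by (simp add: \<sigma>_def sgn2 sgn_mult sgn_power_real good_def)
        qed
      qed
      obtain M1 M2 where M12: "\<And>t. M1 \<le> t \<Longrightarrow> sgn (poly ?P2 t) = sgn (poly S r)"
        "\<And>t. t \<le> M2 \<Longrightarrow> sgn (poly ?P2 t) = sgn (poly S r) * (-1) ^ m"
        using sgn_poly_at_top[OF P2nz] sgn_poly_at_bot[OF P2nz] unfolding deg P2m by metis
      \<comment> \<open>Beyond \<open>M\<close> in absolute value the residue polynomial has its
        asymptotic sign; \<open>M\<close> also exceeds the residues at exponent 0 of both stretched
        ends, so that clipping keeps the order of the ends.\<close>
      define M where "M = Max {1, M1, - M2, \<bar>pcoeff (a1 * T) 0\<bar> + 1, \<bar>pcoeff (b1 * T) 0\<bar> + 1}"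
      have M: "M \<ge> 1" "M \<ge> M1" "M \<ge> - M2" "M \<ge> \<bar>pcoeff (a1 * T) 0\<bar> + 1" "M \<ge> \<bar>pcoeff (b1 * T) 0\<bar> + 1"
        unfolding M_def by (rule Max_ge; simp)+
      \<comment> \<open>Stretching may make the ends infinite, but \<open>finite_ivp\<close> needs
        finite ones. An infinite end is replaced by a constant on its side, where \<open>q2\<close>
        has the same sign.\<close>
      define cl where "cl x = (if order_le x 0 then x else if 0 < x then pmonom M 0 else pmonom (- M) 0)" for x
      have cl_fin: "order_le (cl x) 0" for x by (simp add: cl_def order_le_pmonom)
      have cl_sgn: "\<sigma> (cl (x * T)) = \<sigma> (x * T)" if "good x" for x
      proof (cases "order_le (x * T) 0")
        case nf: False
        have x0: "x \<noteq> 0" using nf by auto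
        have ev: "\<sigma> (pmonom t 0) = sgn (poly ?P2 t)" if "poly ?P2 t \<noteq> 0" for t
          using finite_residue_eval[OF q2, of "pmonom t 0"] plead_coeff_eq[of "poly q2 (pmonom t 0)" 0] that
          by (simp add: \<sigma>_def order_le_pmonom pcoeff_monom)
        have M': "poly ?P2 M \<noteq> 0" "poly ?P2 (- M) \<noteq> 0" using M12(1)[of M] M12(2)[of "- M"] M S(2)
          by (auto simp: sgn_eq_0_iff)
        show ?thesis
        proof (cases "0 < x")
          case True
          then have "0 < plead_coeff x" by (simp only: puiseux_pos_iff)
          then have "0 < x * T" "sgn (plead_coeff x) = 1" using T True by simp_all
          then show ?thesis using nf ev[OF M'(1)] M12(1)[of M] M unbounded_sgn[OF that nf] by (simp add: cl_def)
        next
          case neg: False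
          then have "x < 0" using x0 by simp
          then have "plead_coeff x < 0" by (simp only: puiseux_neg_iff)
          then have "\<not> 0 < x * T" "sgn (plead_coeff x) = -1"
            using T neg by (simp_all add: zero_less_mult_iff)
          then show ?thesis using nf ev[OF M'(2)] M12(2)[of "- M"] M unbounded_sgn[OF that nf] by (simp add: cl_def)
        qed
      qed (simp add: cl_def)
      have large: "y < x" if "\<not> order_le x 0" "0 < x" "order_le y 0" for x y
      proof (rule ccontr)
        assume "\<not> y < x"
        then show False using order_le_antimono[of x y 0] that by simp
      qed
      have small: "x < y" if "\<not> order_le x 0" "x < 0" "order_le y 0" for x y
        using large[of "- x" "- y"] that by simp
      have const_less: "x < pmonom M 0" "pmonom (- M) 0 < x" if "order_le x 0" "M \<ge> \<bar>pcoeff x 0\<bar> + 1" for x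
      proof -
        have "\<not> pmonom M 0 \<le> x" "\<not> x \<le> pmonom (- M) 0"
          using pcoeff_mono[of "pmonom M 0" 0 x] pcoeff_mono[of x 0 "pmonom (- M) 0"] that
          by (auto simp: order_le_pmonom pcoeff_monom)
        then show "x < pmonom M 0" "pmonom (- M) 0 < x" by auto
      qed
      have mM: "pmonom (- M) 0 < pmonom M 0"
        using const_less(1)[of "pmonom (- M) 0"] pcoeff_mono[of "pmonom M 0" 0 "pmonom (- M) 0"] M(1)
        by (auto simp: order_le_pmonom pcoeff_monom not_le[symmetric])
      let ?a = "a1 * T" and ?b = "b1 * T"
      have ab2: "?a < ?b" using ab1 T by simp
      have opp2: "\<sigma> ?a * \<sigma> ?b < 0"
        unfolding \<sigma>_def sgn2 using opp1 by (auto simp: mult_less_0_iff sgn_if)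
      \<comment> \<open>Because the signs at the ends differ, the ends cannot both be infinite on
        the same side.\<close>
      have ne: "cl ?a \<noteq> cl ?b"
      proof
        assume "cl ?a = cl ?b"
        then have "\<sigma> ?a = \<sigma> ?b" using cl_sgn good by metis
        then show False using opp2 by (simp add: mult_less_0_iff)
      qed
      have bnd: "?a \<le> cl ?a" "cl ?b \<le> ?b" "cl ?a < cl ?b"
      proof -
        have A: "order_le ?a 0 \<or> ?a < 0"
        proof (rule ccontr)
          assume "\<not> ?thesis"
          then have A: "\<not> order_le ?a 0" "0 < ?a" by (auto simp: not_less le_less)
          then have "\<not> order_le ?b 0" using large[OF A, of ?b] ab2 by force
          then show False using A ab2 ne by (auto simp: cl_def)
        qed
        have B: "order_le ?b 0 \<or> 0 < ?b"
        proof (rule ccontr)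
          assume "\<not> ?thesis"
          then have B: "\<not> order_le ?b 0" "?b < 0" by (auto simp: not_less le_less)
          then have "\<not> order_le ?a 0" using small[OF B, of ?a] ab2 by force
          then show False using B ab2 ne by (auto simp: cl_def)
        qed
        show "?a \<le> cl ?a"
          using A small[of ?a "pmonom (- M) 0"] by (auto simp: cl_def order_le_pmonom)
        show "cl ?b \<le> ?b"
          using B large[of ?b "pmonom M 0"] by (auto simp: cl_def order_le_pmonom)
        show "cl ?a < cl ?b"
          using A B ab2 mM const_less(1)[of ?a] const_less(2)[of ?b] M by (auto simp: cl_def)
      qed
      have "poly q2 (cl ?a) * poly q2 (cl ?b) < 0"
      proof -
        have "\<sigma> (cl ?a) * \<sigma> (cl ?b) < 0" using opp2 cl_sgn good by simp
        then show ?thesis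
          by (auto simp: \<sigma>_def puiseux_neg_iff plead_coeff_mult mult_less_0_iff sgn_if split: if_splits)
      qed
      then obtain x where x: "cl ?a < x" "x < cl ?b" "poly q2 x = 0"
        using finite_ivp[OF q2 P2nz IH[OF ord] cl_fin cl_fin bnd(3)] by blast
      define y where "y = x / T"
      have xy: "x = y * T" using T by (simp add: y_def)
      have "?a < y * T" "y * T < ?b" using x bnd xy by auto
      then have "a1 < y" "y < b1" using T by simp_all
      moreover have "poly q1 y = 0"
      proof -
        have "pmonom 1 (c * real m) \<noteq> 0" by (metis pcoeff_0 pcoeff_monom zero_neq_one)
        then show ?thesis using q2_eval[of y] x(3) xy by simp
      qed
      ultimately show ?thesis by blast
    qed
    then obtain x where "a1 < x" "x < b1" "poly q1 x = 0" by blast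
    then show ?thesis using q1_eval[of "x + \<rho>"]
      by (intro exI[of _ "x + \<rho>"]) (auto simp: a1_def b1_def algebra_simps)
  qed
qed

lemma local_ivp_all: "local_ivp m"
  by (induction m rule: less_induct) (rule local_ivp_step)

text \<open>Mapping the interval to the one from 0 to 1 makes the ends finite. Dividing by the power
  of \<open>t\<close> of the largest coefficient makes the polynomial finite with nonzero residue.
  Then \<open>finite_ivp\<close> applies.\<close>

instance puiseux :: real_closed_field
proof
  fix a b :: puiseux and f n
  assume ab: "a < b" "(\<Sum>k\<le>n. f k * a ^ k) < 0" "0 < (\<Sum>k\<le>n. f k * b ^ k)"
  define p where "p = (\<Sum>k\<le>n. monom (f k) k)"
  have p: "poly p x = (\<Sum>k\<le>n. f k * x ^ k)" for x by (simp add: p_def poly_sum poly_monom)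
  define q where "q = pcompose p [:a, b - a:]"
  have q_eval: "poly q x = poly p (a + x * (b - a))" for x by (simp add: q_def poly_pcompose)
  have q01: "poly q 0 < 0" "0 < poly q 1" using ab p by (simp_all add: q_eval)
  then have "q \<noteq> 0" by auto
  define K where "K = {k. k \<le> degree q \<and> coeff q k \<noteq> 0}"
  have K: "finite K" "K \<noteq> {}" using \<open>q \<noteq> 0\<close> by (auto simp: K_def intro: exI[of _ "degree q"])
  define g where "g = Max ((\<lambda>k. lead_exp (coeff q k)) ` K)"
  have ord: "order_le (coeff q k) g" for k
  proof (cases "coeff q k = 0")
    case False
    then have "k \<in> K" by (simp add: K_def le_degree)
    then have "lead_exp (coeff q k) \<le> g" unfolding g_def using K(1) by (intro Max_ge) auto
    then show ?thesis using order_le_lead_exp order_le_mono by blast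
  qed simp
  have "g \<in> (\<lambda>k. lead_exp (coeff q k)) ` K" unfolding g_def by (rule Max_in) (use K in auto)
  then obtain k where k: "coeff q k \<noteq> 0" "g = lead_exp (coeff q k)" by (auto simp: K_def)
  define q' where "q' = smult (pmonom 1 (- g)) q"
  have "finite_poly q'"
    unfolding finite_poly_def q'_def coeff_smult using order_le_monom_mult[OF ord, where c = 1 and h = "- g"] by simp
  moreover have "coeff (residue_poly q') k \<noteq> 0"
    using pcoeff_lead_exp[OF k(1)] k(2) by (simp add: q'_def pcoeff_monom_mult)
  then have "residue_poly q' \<noteq> 0" by (metis coeff_0)
  moreover have "poly q' 0 * poly q' 1 < 0"
  proof -
    have "0 < pmonom 1 (- g)"
      using order_le_pos_iff[of "pmonom 1 (- g)" "- g"] by (simp add: order_le_pmonom pcoeff_monom)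
    then show ?thesis unfolding q'_def poly_smult using q01
      by (metis mult_neg_pos mult_pos_neg mult_pos_pos)
  qed
  ultimately obtain x where x: "0 < x" "x < 1" "poly q' x = 0"
    using finite_ivp[OF _ _ local_ivp_all, of q' 0 1] by auto
  have "pmonom 1 (- g) \<noteq> 0" by (metis pcoeff_0 pcoeff_monom zero_neq_one)
  then have "poly p (a + x * (b - a)) = 0" using x(3) by (simp add: q'_def q_eval)
  moreover have "a < a + x * (b - a)" using x ab by simp
  moreover have "a + x * (b - a) < b"
  proof -
    have "x * (b - a) < 1 * (b - a)" using x ab by (intro mult_strict_right_mono) auto
    then show ?thesis by (simp add: algebra_simps)
  qed
  ultimately show "\<exists>x. a < x \<and> x < b \<and> (\<Sum>k\<le>n. f k * x ^ k) = 0" unfolding p by blast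
qed

section \<open>Separation of closed convex sets from boxes\<close>

lemma definable_ex_set:
  fixes P :: "('v \<Rightarrow> 'a::real_closed_field) \<Rightarrow> bool"
  assumes "finite J" "definable P"
  shows "definable (\<lambda>e. \<exists>x. P (override_on e x J))"
  using assms(1)
proof (induction J rule: finite_induct)
  case empty
  then show ?case using assms(2) by simp
next
  case (insert j J)
  have "(\<exists>x. P (override_on e x (insert j J))) \<longleftrightarrow> (\<exists>t x. P (override_on (e(j := t)) x J))" for e
  proof
    assume "\<exists>x. P (override_on e x (insert j J))"
    then obtain x where "P (override_on e x (insert j J))" by blast
    moreover have "override_on e x (insert j J) = override_on (e(j := x j)) x J"
      by (rule ext) (auto simp: override_on_def)
    ultimately show "\<exists>t x. P (override_on (e(j := t)) x J)" by metis
  next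
    assume "\<exists>t x. P (override_on (e(j := t)) x J)"
    then obtain t x where "P (override_on (e(j := t)) x J)" by blast
    moreover have "override_on (e(j := t)) x J = override_on e (x(j := t)) (insert j J)"
      using insert.hyps by (intro ext) (auto simp: override_on_def)
    ultimately show "\<exists>x. P (override_on e x (insert j J))" by metis
  qed
  then show ?case using definable_ex[OF insert.IH, of j] by (simp del: fun_upd_apply)
qed

lemma polyfun_mpoly_eval:
  fixes g :: "'n::finite \<Rightarrow> ('v \<Rightarrow> 'a::comm_ring_1) \<Rightarrow> 'a"
  assumes "\<And>i. g i \<in> polyfun"
  shows "(\<lambda>e. mpoly_eval p (\<chi> i. g i e)) \<in> polyfun"
  unfolding mpoly_eval_def vec_lambda_beta by (intro polyfun_intros assms)

lemma definable_semialgebraic: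
  fixes X :: "('a::linordered_field ^ 'n::finite) set"
  assumes "semialgebraic X" "\<And>i. g i \<in> polyfun"
  shows "definable (\<lambda>e. (\<chi> i. g i e) \<in> X)"
  using assms(1)
proof induction
  case (nonneg p)
  then show ?case using definable_le[OF polyfun.const[of 0] polyfun_mpoly_eval[OF assms(2)]] by simp
next
  case (pos p)
  then show ?case using definable_less[OF polyfun.const[of 0] polyfun_mpoly_eval[OF assms(2)]] by simp
next
  case (compl A)
  then show ?case using definable_not by simp
next
  case (union A B)
  then show ?case using definable_disj by simp
next
  case (inter A B)
  then show ?case using definable_conj by simp
qed

text \<open>Definable compactness: the coordinates of a limit point are found one after the other as suprema
  of the eventual lower bounds.\<close>

lemma definable_family_limit:
  fixes P :: "('v \<Rightarrow> 'a::real_closed_field) \<Rightarrow> bool"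
  assumes P: "definable P" and J: "finite J" "ev \<notin> J" "mv \<notin> J" "ev \<noteq> mv"
    and indep: "\<And>e t. P (e(mv := t)) = P e"
    and ne: "\<And>\<epsilon>. 0 < \<epsilon> \<Longrightarrow> \<exists>x. P ((override_on e x J)(ev := \<epsilon>))"
    and mono: "\<And>x \<epsilon> \<epsilon>'. 0 < \<epsilon> \<Longrightarrow> \<epsilon> \<le> \<epsilon>' \<Longrightarrow> P (x(ev := \<epsilon>)) \<Longrightarrow> P (x(ev := \<epsilon>'))"
    and bdd: "\<And>x \<epsilon> j. 0 < \<epsilon> \<Longrightarrow> \<epsilon> \<le> 1 \<Longrightarrow> P ((override_on e x J)(ev := \<epsilon>)) \<Longrightarrow> j \<in> J \<Longrightarrow> \<bar>x j\<bar> \<le> B"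
  shows "\<exists>s. \<forall>\<epsilon>>0. \<exists>x. P ((override_on e x J)(ev := \<epsilon>)) \<and> (\<forall>j\<in>J. \<bar>x j - s j\<bar> \<le> \<epsilon>)"
proof -
  have "\<exists>s. \<forall>\<epsilon>>0. \<exists>x. P ((override_on e x J)(ev := \<epsilon>)) \<and> (\<forall>j\<in>I. \<bar>x j - s j\<bar> \<le> \<epsilon>)"
    if "finite I" "I \<subseteq> J" for I
    using that
  proof (induction I rule: finite_induct)
    case empty
    then show ?case using ne by (simp del: fun_upd_apply)
  next
    case (insert j I)
    then obtain s where s: "\<And>\<epsilon>. 0 < \<epsilon> \<Longrightarrow> \<exists>x. P ((override_on e x J)(ev := \<epsilon>)) \<and> (\<forall>j\<in>I. \<bar>x j - s j\<bar> \<le> \<epsilon>)"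
      by blast
    define Q where "Q \<epsilon> x \<longleftrightarrow> P ((override_on e x J)(ev := \<epsilon>)) \<and> (\<forall>j\<in>I. \<bar>x j - s j\<bar> \<le> \<epsilon>)" for \<epsilon> x
    have Q_mono: "Q \<epsilon> x \<Longrightarrow> 0 < \<epsilon> \<Longrightarrow> \<epsilon> \<le> \<epsilon>' \<Longrightarrow> Q \<epsilon>' x" for \<epsilon> \<epsilon>' x
      using mono unfolding Q_def by (meson order_trans)
    define W where "W f \<longleftrightarrow> P f \<and> (\<forall>i\<in>I. f i - s i \<le> f ev \<and> s i - f i \<le> f ev) \<and> f j < f mv" for f
    \<comment> \<open>\<open>D\<close> says that the value of \<open>mv\<close> is an eventual lower
      bound of coordinate \<open>j\<close>: at some scale \<open>t\<close> no admissible point lies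
      below it. By monotonicity in the scale, the supremum of these bounds is the lower limit of the
      coordinate.\<close>
    define D where "D f \<longleftrightarrow> (\<exists>t. 0 < (f(ev := t)) ev \<and> \<not> (\<exists>x. W (override_on (f(ev := t)) x J)))" for f
    have "definable W"
      unfolding W_def[abs_def]
      by (intro definable_conj definable_ball insert.hyps P definable_le definable_less polyfun_intros)
    then have "definable (\<lambda>f. \<not> (\<exists>x. W (override_on f x J)))"
      by (intro definable_not definable_ex_set J)
    then have "definable (\<lambda>f. 0 < f ev \<and> \<not> (\<exists>x. W (override_on f x J)))"
      by (intro definable_conj definable_less polyfun_intros)
    from definable_ex[OF this, of ev] have D: "definable D" unfolding D_def[abs_def] by simp
    have W_iff: "W (override_on (e(mv := m, ev := t)) x J) \<longleftrightarrow> Q t x \<and> x j < m" for m t x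
    proof -
      have "override_on (e(mv := m, ev := t)) x J = ((override_on e x J)(ev := t))(mv := m)"
        using J by (intro ext) (auto simp: override_on_def)
      moreover have "(\<forall>i\<in>I. x i - s i \<le> t \<and> s i - x i \<le> t) \<longleftrightarrow> (\<forall>i\<in>I. \<bar>x i - s i\<bar> \<le> t)"
        by (auto simp: abs_le_iff)
      ultimately show ?thesis using insert.prems J
        by (auto simp: W_def Q_def indep override_on_def subset_iff)
    qed
    have D_iff: "D (e(mv := m)) \<longleftrightarrow> (\<exists>t>0. \<forall>x. Q t x \<longrightarrow> m \<le> x j)" for m
      unfolding D_def W_iff by (auto simp: not_less)
    have Qb: "\<bar>x j\<bar> \<le> B" if "Q t x" "0 < t" "t \<le> 1" for t x
      using bdd[of t x j] that insert.prems by (auto simp: Q_def)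
    have "D (e(mv := - B))"
      unfolding D_iff by (rule exI[of _ 1]) (use Qb[of 1] in \<open>auto simp: abs_le_iff minus_le_iff\<close>)
    moreover have "m \<le> B" if "D (e(mv := m))" for m
    proof -
      obtain t where t: "t > 0" "\<And>x. Q t x \<Longrightarrow> m \<le> x j" using \<open>D (e(mv := m))\<close> D_iff by blast
      obtain x where x: "Q (min t 1) x" using s[of "min t 1"] t by (auto simp: Q_def)
      then have "m \<le> x j" using t Q_mono[OF x, of t] by simp
      moreover have "\<bar>x j\<bar> \<le> B" using Qb[OF x] t by simp
      ultimately show ?thesis by linarith
    qed
    ultimately obtain l where l: "\<And>m. D (e(mv := m)) \<Longrightarrow> m \<le> l"
      "\<And>b. (\<And>m. D (e(mv := m)) \<Longrightarrow> m \<le> b) \<Longrightarrow> l \<le> b"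
      using definable_complete[OF D] by metis
    have "\<exists>x. Q \<epsilon> x \<and> \<bar>x j - l\<bar> \<le> \<epsilon>" if \<epsilon>: "0 < \<epsilon>" for \<epsilon>
    proof -
      have "\<not> l \<le> l - \<epsilon>" using \<epsilon> by simp
      then obtain m where m: "D (e(mv := m))" "l - \<epsilon> < m" using l(2)[of "l - \<epsilon>"] by (meson not_le)
      obtain t where t: "t > 0" "\<And>x. Q t x \<Longrightarrow> m \<le> x j" using m(1) D_iff by blast
      \<comment> \<open>No eventual lower bound exceeds \<open>l\<close>, so there is a point below
        \<open>l + \<epsilon>\<close> even at the smaller scale \<open>min t \<epsilon>\<close>,
        where \<open>m\<close> is still a lower bound.\<close>
      have "\<not> D (e(mv := l + \<epsilon>))" using l(1)[of "l + \<epsilon>"] \<epsilon> by auto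
      then obtain x where x: "Q (min t \<epsilon>) x" "x j < l + \<epsilon>"
        using t(1) \<epsilon> unfolding D_iff by (metis min_less_iff_conj not_le)
      have "Q t x" "Q \<epsilon> x" using Q_mono[OF x(1)] t(1) \<epsilon> by auto
      then have "Q \<epsilon> x \<and> \<bar>x j - l\<bar> \<le> \<epsilon>" using t(2)[of x] x m by (auto simp: abs_le_iff)
      then show ?thesis by blast
    qed
    then have "\<exists>x. P ((override_on e x J)(ev := \<epsilon>)) \<and> (\<forall>i\<in>insert j I. \<bar>x i - (s(j := l)) i\<bar> \<le> \<epsilon>)"
      if "0 < \<epsilon>" for \<epsilon>
      using that insert.hyps unfolding Q_def by (metis fun_upd_apply insert_iff)
    then show ?case by blast
  qed
  then show ?thesis using J by blast
qed

lemma closed_vec_limit: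
  fixes X :: "('a::{linordered_field,linorder_topology} ^ 'n::finite) set"
  assumes X: "closed X" and lim: "\<And>\<epsilon>. 0 < \<epsilon> \<Longrightarrow> \<exists>x\<in>X. \<forall>i. \<bar>x $ i - s $ i\<bar> \<le> \<epsilon>"
  shows "s \<in> X"
proof (rule ccontr)
  assume "s \<notin> X"
  moreover have "open (- X)" using X by (simp add: open_Compl)
  ultimately obtain A where A: "\<And>i. open (A i)" "\<And>i. s $ i \<in> A i" "\<And>y. (\<And>i. y $ i \<in> A i) \<Longrightarrow> y \<notin> X"
    unfolding open_vec_def by (metis ComplD ComplI)
  have "\<exists>r>0. \<forall>t. \<bar>t - s $ i\<bar> \<le> r \<longrightarrow> t \<in> A i" for i
  proof -
    obtain b where b: "s $ i < b" "{s $ i..<b} \<subseteq> A i"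
      using open_right[OF A(1,2), of i "s $ i + 1"] by auto
    obtain c where c: "c < s $ i" "{c<..s $ i} \<subseteq> A i"
      using open_left[OF A(1,2), of "s $ i - 1" i] by auto
    obtain r where r: "0 < r" "r < min (b - s $ i) (s $ i - c)"
      using dense[of 0 "min (b - s $ i) (s $ i - c)"] b c by auto
    have "t \<in> A i" if "\<bar>t - s $ i\<bar> \<le> r" for t
    proof -
      have "t < b" "c < t" using that r by (auto simp: abs_le_iff algebra_simps)
      then have "t \<in> {s $ i..<b} \<or> t \<in> {c<..s $ i}" by auto
      then show ?thesis using b c by blast
    qed
    then show ?thesis using r by blast
  qed
  then obtain r where r: "\<And>i. r i > 0" "\<And>i t. \<bar>t - s $ i\<bar> \<le> r i \<Longrightarrow> t \<in> A i" by metis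
  define \<epsilon> where "\<epsilon> = Min (range r)"
  have "\<epsilon> > 0" "\<And>i. \<epsilon> \<le> r i" using r by (auto simp: \<epsilon>_def)
  then obtain x where "x \<in> X" "\<And>i. \<bar>x $ i - s $ i\<bar> \<le> \<epsilon>" using lim by blast
  then show False using A(3)[of x] r(2) \<open>\<And>i. \<epsilon> \<le> r i\<close> by (meson order_trans)
qed

text \<open>First-order condition for a quadratic in \<open>\<mu>\<close> that is minimal at the
  left end of the unit interval.\<close>

lemma variational_inequality:
  fixes w v :: "'i \<Rightarrow> 'a::linordered_field"
  assumes "\<And>\<mu>. 0 \<le> \<mu> \<Longrightarrow> \<mu> \<le> 1 \<Longrightarrow> (\<Sum>i\<in>I. (w i)\<^sup>2) \<le> (\<Sum>i\<in>I. (w i + \<mu> * v i)\<^sup>2)"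
  shows "0 \<le> (\<Sum>i\<in>I. w i * v i)"
proof (rule ccontr)
  define a b where "a = (\<Sum>i\<in>I. w i * v i)" and "b = (\<Sum>i\<in>I. (v i)\<^sup>2)"
  assume "\<not> ?thesis"
  then have a: "a < 0" by (simp add: a_def)
  have b: "0 \<le> b" by (simp add: b_def sum_nonneg)
  have exp: "(\<Sum>i\<in>I. (w i + \<mu> * v i)\<^sup>2) = (\<Sum>i\<in>I. (w i)\<^sup>2) + \<mu> * (2 * a + \<mu> * b)" for \<mu>
    by (simp add: a_def b_def power2_eq_square algebra_simps sum.distrib sum_distrib_left)
  \<comment> \<open>Chosen so that \<open>\<mu> * b \<le> - a\<close>, hence
    \<open>2 * a + \<mu> * b < 0\<close>. The summand 1 covers \<open>b = 0\<close>.\<close>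
  define \<mu> where "\<mu> = min 1 (- a / (b + 1))"
  have l: "0 < \<mu>" "\<mu> \<le> 1" "\<mu> \<le> - a / (b + 1)" using a b by (auto simp: \<mu>_def divide_neg_pos)
  have "\<mu> * b \<le> (- a / (b + 1)) * b" using l b by (intro mult_right_mono) auto
  also have "\<dots> \<le> - a" using a b by (simp add: field_simps)
  finally have "2 * a + \<mu> * b < 0" using a by linarith
  then have "\<mu> * (2 * a + \<mu> * b) < 0" using l by (simp add: mult_pos_neg)
  then show False using assms[of \<mu>] l exp[of \<mu>] by simp
qed

lemma abs_le_of_square:
  fixes x :: "'a::linordered_field"
  assumes "x\<^sup>2 \<le> c"
  shows "\<bar>x\<bar> \<le> c + 1"
proof (cases "\<bar>x\<bar> \<le> 1")
  case True
  have "0 \<le> c" using assms zero_le_power2[of x] by linarith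
  then show ?thesis using True by linarith
next
  case False
  then have "\<bar>x\<bar> * 1 \<le> \<bar>x\<bar> * \<bar>x\<bar>" by (intro mult_left_mono) auto
  then show ?thesis using assms by (simp add: power2_eq_square)
qed

section \<open>Nearest points of a closed semialgebraic set and a box\<close>

definition vec_box :: "'a::order ^ 'n \<Rightarrow> 'a ^ 'n \<Rightarrow> ('a ^ 'n) set" where
  "vec_box l u = {b. \<forall>i. l $ i \<le> b $ i \<and> b $ i \<le> u $ i}"

definition sq_dist :: "'a::comm_ring_1 ^ 'n::finite \<Rightarrow> 'a ^ 'n \<Rightarrow> 'a" where
  "sq_dist x y = (\<Sum>i\<in>UNIV. (x $ i - y $ i)\<^sup>2)"

lemma sq_dist_nonneg: "0 \<le> sq_dist x (y :: 'a::linordered_field ^ 'n::finite)"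
  by (simp add: sq_dist_def sum_nonneg)

lemma sq_dist_component: "(x $ i - y $ i)\<^sup>2 \<le> sq_dist x (y :: 'a::linordered_field ^ 'n::finite)"
  unfolding sq_dist_def by (rule member_le_sum) auto

text \<open>Definable completeness gives the infimum \<open>m\<close> of the squared distances.
  Pairs within \<open>\<epsilon>\<close> of it form a definable family that shrinks with
  \<open>\<epsilon>\<close>. It is bounded although \<open>X\<close> need not be, since the box is
  bounded and near-minimal points stay close to it. A limit pair attains \<open>m\<close>.\<close>

lemma nearest_points_exist:
  fixes X :: "('a::{real_closed_field,linorder_topology} ^ 'n::finite) set"
  assumes X: "X \<noteq> {}" "closed X" "semialgebraic X" and lu: "vec_box l u \<noteq> {}"
  shows "\<exists>x\<in>X. \<exists>b\<in>vec_box l u. \<forall>x'\<in>X. \<forall>b'\<in>vec_box l u. sq_dist x b \<le> sq_dist x' b'"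
proof -
  \<comment> \<open>The coordinates of the two points, and two spare variables for the tolerance and
    for a bound.\<close>
  let ?xv = "\<lambda>i. Inl (Inl i) :: ('n + 'n) + bool" and ?bv = "\<lambda>i. Inl (Inr i) :: ('n + 'n) + bool"
  let ?ev = "Inr True :: ('n + 'n) + bool" and ?mv = "Inr False :: ('n + 'n) + bool"
  define xf :: "(('n + 'n) + bool \<Rightarrow> 'a) \<Rightarrow> 'a ^ 'n" where "xf f = (\<chi> i. f (?xv i))" for f
  define bf :: "(('n + 'n) + bool \<Rightarrow> 'a) \<Rightarrow> 'a ^ 'n" where "bf f = (\<chi> i. f (?bv i))" for f
  define J where "J = range (Inl :: 'n + 'n \<Rightarrow> ('n + 'n) + bool)"
  have J: "finite J" "?ev \<notin> J" "?mv \<notin> J" by (auto simp: J_def)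
  define R where "R f \<longleftrightarrow> xf f \<in> X \<and> (\<forall>i\<in>UNIV. l $ i \<le> f (?bv i) \<and> f (?bv i) \<le> u $ i)" for f
  have R_iff: "R f \<longleftrightarrow> xf f \<in> X \<and> bf f \<in> vec_box l u" for f
    by (simp add: R_def bf_def vec_box_def)
  have R: "definable R"
    unfolding R_def[abs_def] xf_def
    by (intro definable_conj definable_ball definable_semialgebraic X definable_le polyfun_intros) simp
  have dist: "(\<lambda>f. sq_dist (xf f) (bf f)) \<in> polyfun"
    unfolding sq_dist_def xf_def bf_def by (simp add: polyfun_intros)
  define env where "env x b = (\<lambda>v :: ('n + 'n) + bool. case v of Inl (Inl i) \<Rightarrow> x $ i | Inl (Inr i) \<Rightarrow> b $ i | Inr _ \<Rightarrow> 0)"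
    for x b :: "'a ^ 'n"
  have env: "xf (override_on e (env x b) J) = x" "bf (override_on e (env x b) J) = b" for e x b
    by (simp_all add: xf_def bf_def env_def J_def override_on_def vec_eq_iff)
  have upd: "xf (f(Inr c := t)) = xf f" "bf (f(Inr c := t)) = bf f" "R (f(Inr c := t)) = R f" for f c t
    by (simp_all add: xf_def bf_def R_def)
  \<comment> \<open>The distance is compared with the negated variable, because completeness is
    stated for suprema.\<close>
  define N where "N f \<longleftrightarrow> R f \<and> sq_dist (xf f) (bf f) \<le> - f ?mv" for f
  have "definable N"
    unfolding N_def[abs_def] by (intro definable_conj R definable_le dist polyfun_intros)
  from definable_ex_set[OF J(1) this]
  have N: "definable (\<lambda>f. \<exists>x. N (override_on f x J))" .
  define e where "e = (\<lambda>_ :: ('n + 'n) + bool. 0 :: 'a)"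
  have N_iff: "(\<exists>x. N (override_on (e(?mv := t)) x J)) \<longleftrightarrow>
      (\<exists>x\<in>X. \<exists>b\<in>vec_box l u. sq_dist x b \<le> - t)" for t
  proof
    assume "\<exists>x. N (override_on (e(?mv := t)) x J)"
    then obtain x where "N (override_on (e(?mv := t)) x J)" by blast
    then show "\<exists>x\<in>X. \<exists>b\<in>vec_box l u. sq_dist x b \<le> - t"
      using J by (auto simp: N_def R_iff override_on_def)
  next
    assume "\<exists>x\<in>X. \<exists>b\<in>vec_box l u. sq_dist x b \<le> - t"
    then obtain x b where xb: "x \<in> X" "b \<in> vec_box l u" "sq_dist x b \<le> - t" by blast
    have "override_on (e(?mv := t)) (env x b) J ?mv = t" using J by (simp add: override_on_def)
    then have "N (override_on (e(?mv := t)) (env x b) J)" unfolding N_def R_iff env using xb by simp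
    then show "\<exists>x. N (override_on (e(?mv := t)) x J)" by blast
  qed
  obtain x0 b0 where xb0: "x0 \<in> X" "b0 \<in> vec_box l u" using X(1) lu by blast
  have "\<exists>s. (\<forall>t. (\<exists>x. N (override_on (e(?mv := t)) x J)) \<longrightarrow> t \<le> s) \<and>
      (\<forall>b. (\<forall>t. (\<exists>x. N (override_on (e(?mv := t)) x J)) \<longrightarrow> t \<le> b) \<longrightarrow> s \<le> b)"
  proof (rule definable_complete[OF N])
    show "\<exists>x. N (override_on (e(?mv := - sq_dist x0 b0)) x J)" unfolding N_iff using xb0 by auto
    show "t \<le> 0" if "\<exists>x. N (override_on (e(?mv := t)) x J)" for t
      using that sq_dist_nonneg unfolding N_iff by (meson neg_0_le_iff_le order_trans)
  qed
  then obtain s where s: "\<And>t x b. x \<in> X \<Longrightarrow> b \<in> vec_box l u \<Longrightarrow> sq_dist x b \<le> - t \<Longrightarrow> t \<le> s"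
    "\<And>c. (\<And>t x b. x \<in> X \<Longrightarrow> b \<in> vec_box l u \<Longrightarrow> sq_dist x b \<le> - t \<Longrightarrow> t \<le> c) \<Longrightarrow> s \<le> c"
    unfolding N_iff by metis
  define m where "m = - s"
  have m_le: "m \<le> sq_dist x b" if "x \<in> X" "b \<in> vec_box l u" for x b
    using s(1)[OF that, of "- sq_dist x b"] by (simp add: m_def)
  have near: "\<exists>x\<in>X. \<exists>b\<in>vec_box l u. sq_dist x b \<le> m + \<epsilon>" if "0 < \<epsilon>" for \<epsilon>
  proof (rule ccontr)
    assume no: "\<not> ?thesis"
    have "s \<le> s - \<epsilon>"
    proof (rule s(2))
      fix t x b assume "x \<in> X" "b \<in> vec_box l u" "sq_dist x b \<le> - t"
      then have "m + \<epsilon> < - t" using no by (meson le_less_trans not_le order_trans)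
      then show "t \<le> s - \<epsilon>" by (simp add: m_def algebra_simps)
    qed
    then show False using that by simp
  qed
  define P where "P f \<longleftrightarrow> R f \<and> sq_dist (xf f) (bf f) \<le> m + f ?ev" for f
  define B0 where "B0 = (\<Sum>i\<in>UNIV. \<bar>l $ i\<bar> + \<bar>u $ i\<bar>)"
  have box_bdd: "\<bar>b $ i\<bar> \<le> B0" if "b \<in> vec_box l u" for b i
  proof -
    have "l $ i \<le> b $ i" "b $ i \<le> u $ i" using that by (auto simp: vec_box_def)
    then have "\<bar>b $ i\<bar> \<le> \<bar>l $ i\<bar> + \<bar>u $ i\<bar>" unfolding abs_le_iff
      using abs_ge_self[of "u $ i"] abs_ge_minus_self[of "l $ i"] abs_ge_zero[of "l $ i"] abs_ge_zero[of "u $ i"]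
      by linarith
    also have "\<dots> \<le> B0" unfolding B0_def by (rule member_le_sum) auto
    finally show ?thesis .
  qed
  have "\<exists>s. \<forall>\<epsilon>>0. \<exists>x. P ((override_on e x J)(?ev := \<epsilon>)) \<and> (\<forall>j\<in>J. \<bar>x j - s j\<bar> \<le> \<epsilon>)"
  proof (rule definable_family_limit[where mv = ?mv])
    show "definable P"
      unfolding P_def[abs_def] by (intro definable_conj R definable_le dist polyfun_intros)
    show "P (f(?mv := t)) = P f" for f t by (simp add: P_def upd)
    show "\<exists>x. P ((override_on e x J)(?ev := \<epsilon>))" if \<epsilon>: "0 < \<epsilon>" for \<epsilon>
    proof -
      obtain x b where "x \<in> X" "b \<in> vec_box l u" "sq_dist x b \<le> m + \<epsilon>" using near[OF \<epsilon>] by blast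
      then have "P ((override_on e (env x b) J)(?ev := \<epsilon>))" by (simp add: P_def upd R_iff env)
      then show ?thesis by blast
    qed
    show "P (x(?ev := \<epsilon>'))" if "\<epsilon> \<le> \<epsilon>'" "P (x(?ev := \<epsilon>))" for x \<epsilon> \<epsilon>'
      using that by (auto simp: P_def upd)
    show "\<bar>x j\<bar> \<le> B0 + \<bar>m\<bar> + 2" if \<epsilon>: "\<epsilon> \<le> 1" and p: "P ((override_on e x J)(?ev := \<epsilon>))" and "j \<in> J" for x \<epsilon> j
    proof -
      let ?f = "override_on e x J"
      have f: "bf ?f \<in> vec_box l u" "sq_dist (xf ?f) (bf ?f) \<le> m + 1"
        using p \<epsilon> by (auto simp: P_def upd R_iff)
      have b: "\<bar>x (?bv i)\<bar> \<le> B0" for i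
        using box_bdd[OF f(1), of i] by (simp add: bf_def override_on_def J_def)
      have "\<bar>x (?xv i)\<bar> \<le> B0 + \<bar>m\<bar> + 2" for i
      proof -
        have "\<bar>x (?xv i) - x (?bv i)\<bar> \<le> m + 1 + 1"
          using order_trans[OF sq_dist_component[of "xf ?f" i "bf ?f"] f(2)]
          by (intro abs_le_of_square) (simp add: xf_def bf_def override_on_def J_def)
        then show ?thesis using b[of i] by (simp add: abs_if split: if_splits)
      qed
      moreover have "\<bar>x (?bv i)\<bar> \<le> B0 + \<bar>m\<bar> + 2" for i using b[of i] by (simp add: add_increasing2)
      ultimately show ?thesis using \<open>j \<in> J\<close> unfolding J_def by (metis (full_types) imageE sum.exhaust)
    qed
  qed (use J in auto)
  then obtain c where c: "\<And>\<epsilon>. 0 < \<epsilon> \<Longrightarrow> \<exists>x. P ((override_on e x J)(?ev := \<epsilon>)) \<and> (\<forall>j\<in>J. \<bar>x j - c j\<bar> \<le> \<epsilon>)"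
    by blast
  define x1 where "x1 = xf c"
  define b1 where "b1 = bf c"
  have lim: "\<exists>x\<in>X. \<exists>b\<in>vec_box l u. sq_dist x b \<le> m + \<epsilon> \<and> (\<forall>i. \<bar>x $ i - x1 $ i\<bar> \<le> \<epsilon>) \<and> (\<forall>i. \<bar>b $ i - b1 $ i\<bar> \<le> \<epsilon>)"
    if \<epsilon>: "0 < \<epsilon>" for \<epsilon>
  proof -
    obtain x where x: "P ((override_on e x J)(?ev := \<epsilon>))" "\<forall>j\<in>J. \<bar>x j - c j\<bar> \<le> \<epsilon>" using c[OF \<epsilon>] by blast
    let ?f = "override_on e x J"
    have "xf ?f \<in> X" "bf ?f \<in> vec_box l u" "sq_dist (xf ?f) (bf ?f) \<le> m + \<epsilon>"
      using x(1) by (auto simp: P_def upd R_iff)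
    moreover have "\<bar>xf ?f $ i - x1 $ i\<bar> \<le> \<epsilon>" "\<bar>bf ?f $ i - b1 $ i\<bar> \<le> \<epsilon>" for i
      using x(2) by (auto simp: xf_def bf_def x1_def b1_def override_on_def J_def)
    ultimately show ?thesis by blast
  qed
  have x1: "x1 \<in> X" by (rule closed_vec_limit[OF X(2)]) (use lim in blast)
  have b1: "b1 \<in> vec_box l u"
  proof -
    have "l $ i \<le> b1 $ i \<and> b1 $ i \<le> u $ i" for i
    proof (rule conjI; rule field_le_epsilon)
      fix \<epsilon> :: 'a assume "0 < \<epsilon>"
      then obtain b where b: "b \<in> vec_box l u" "\<bar>b $ i - b1 $ i\<bar> \<le> \<epsilon>" using lim by blast
      then have "l $ i \<le> b $ i" "b $ i \<le> u $ i" by (auto simp: vec_box_def)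
      then show "l $ i \<le> b1 $ i + \<epsilon>" "b1 $ i \<le> u $ i + \<epsilon>" using b(2) by (auto simp: abs_le_iff)
    qed
    then show ?thesis by (simp add: vec_box_def)
  qed
  have "sq_dist x1 b1 \<le> m"
  proof (rule field_le_epsilon)
    fix \<delta> :: 'a assume \<delta>: "0 < \<delta>"
    define w where "w i = x1 $ i - b1 $ i" for i
    define K where "K = (\<Sum>i\<in>UNIV. 4 * (\<bar>w i\<bar> + 1))"
    have K: "0 \<le> K" unfolding K_def by (rule sum_nonneg) simp
    \<comment> \<open>In \<open>1 + K\<close>, the 1 pays for near-minimality of the pair and
      \<open>K\<close> for passing from it to the limit pair.\<close>
    define \<epsilon> where "\<epsilon> = min 1 (\<delta> / (1 + K))"
    have \<epsilon>: "0 < \<epsilon>" "\<epsilon> \<le> 1" "\<epsilon> * (1 + K) \<le> \<delta>"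
    proof -
      show "0 < \<epsilon>" "\<epsilon> \<le> 1" using \<delta> K by (auto simp: \<epsilon>_def)
      have "\<epsilon> \<le> \<delta> / (1 + K)" by (simp add: \<epsilon>_def)
      then show "\<epsilon> * (1 + K) \<le> \<delta>" using K by (simp add: pos_le_divide_eq)
    qed
    obtain x b where xb: "sq_dist x b \<le> m + \<epsilon>" "\<And>i. \<bar>x $ i - x1 $ i\<bar> \<le> \<epsilon>" "\<And>i. \<bar>b $ i - b1 $ i\<bar> \<le> \<epsilon>"
      using lim[OF \<epsilon>(1)] by blast
    have "sq_dist x1 b1 \<le> (\<Sum>i\<in>UNIV. (x $ i - b $ i)\<^sup>2 + \<epsilon> * (4 * (\<bar>w i\<bar> + 1)))"
      unfolding sq_dist_def
    proof (rule sum_mono)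
      fix i
      define d where "d = (x $ i - b $ i) - w i"
      have d: "\<bar>d\<bar> \<le> 2 * \<epsilon>" using xb(2)[of i] xb(3)[of i] by (auto simp: d_def w_def abs_le_iff)
      have "- (d * (2 * w i)) \<le> \<bar>d\<bar> * \<bar>2 * w i\<bar>" by (metis abs_ge_minus_self abs_mult)
      also have "\<dots> \<le> 2 * \<epsilon> * \<bar>2 * w i\<bar>" using d by (intro mult_right_mono) auto
      finally have dw: "- (d * (2 * w i)) \<le> \<epsilon> * (4 * \<bar>w i\<bar>)" by (simp add: abs_mult)
      have "(x1 $ i - b1 $ i)\<^sup>2 = (x $ i - b $ i)\<^sup>2 - d * (2 * w i) - d\<^sup>2"
        by (simp add: d_def w_def power2_eq_square algebra_simps)
      also have "\<dots> \<le> (x $ i - b $ i)\<^sup>2 + \<epsilon> * (4 * \<bar>w i\<bar>)" using dw zero_le_power2[of d] by linarith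
      also have "\<dots> \<le> (x $ i - b $ i)\<^sup>2 + \<epsilon> * (4 * (\<bar>w i\<bar> + 1))" using \<epsilon> by simp
      finally show "(x1 $ i - b1 $ i)\<^sup>2 \<le> (x $ i - b $ i)\<^sup>2 + \<epsilon> * (4 * (\<bar>w i\<bar> + 1))" .
    qed
    also have "\<dots> = sq_dist x b + \<epsilon> * K"
      by (simp only: sq_dist_def K_def sum.distrib sum_distrib_left)
    also have "\<dots> \<le> m + \<epsilon> * (1 + K)" using xb(1) by (simp add: algebra_simps)
    also have "\<dots> \<le> m + \<delta>" using \<epsilon> by simp
    finally show "sq_dist x1 b1 \<le> m + \<delta>" .
  qed
  then show ?thesis using x1 b1 m_le by (meson order_trans)
qed

text \<open>The difference \<open>w\<close> of nearest points is normal to a hyperplane through the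
  point \<open>p\<close> of \<open>X\<close>. Convexity on both sides gives weak inequalities at
  \<open>p\<close> and \<open>q\<close>; strictness on the box comes from the positive squared
  length of \<open>w\<close>.\<close>

theorem closed_convex_box_separation:
  fixes X :: "('a::{real_closed_field,linorder_topology} ^ 'n::finite) set"
  assumes X: "X \<noteq> {}" "closed X" "semialgebraic X" "field_convex X"
    and box: "vec_box l u \<noteq> {}" "X \<inter> vec_box l u = {}"
  shows "\<exists>a0 a. a \<noteq> 0 \<and> X \<subseteq> halfspace a0 a \<and> (\<forall>b\<in>vec_box l u. a0 + (\<Sum>i\<in>UNIV. a $ i * b $ i) < 0)"
proof -
  obtain p q where p: "p \<in> X" and q: "q \<in> vec_box l u"
    and min: "\<And>x b. x \<in> X \<Longrightarrow> b \<in> vec_box l u \<Longrightarrow> sq_dist p q \<le> sq_dist x b"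
    using nearest_points_exist[OF X(1-3) box(1)] by blast
  define w where "w = p - q"
  define a0 where "a0 = - (\<Sum>i\<in>UNIV. w $ i * p $ i)"
  have "p \<noteq> q" using p q box(2) by blast
  then have w: "w \<noteq> 0" by (simp add: w_def)
  have conv: "0 \<le> (\<Sum>i\<in>UNIV. w $ i * (x $ i - p $ i))" if x: "x \<in> X" for x
  proof (rule variational_inequality)
    fix t :: 'a assume t: "0 \<le> t" "t \<le> 1"
    have "(1 - t) *s p + t *s x \<in> X"
      by (rule X(4)[unfolded field_convex_def, rule_format]) (use p x t in auto)
    then have "sq_dist p q \<le> sq_dist ((1 - t) *s p + t *s x) q" using min q by blast
    then show "(\<Sum>i\<in>UNIV. (w $ i)\<^sup>2) \<le> (\<Sum>i\<in>UNIV. (w $ i + t * (x $ i - p $ i))\<^sup>2)"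
      by (simp add: sq_dist_def w_def algebra_simps)
  qed
  have box_conv: "0 \<le> (\<Sum>i\<in>UNIV. w $ i * (q $ i - b $ i))" if b: "b \<in> vec_box l u" for b
  proof (rule variational_inequality)
    fix t :: 'a assume t: "0 \<le> t" "t \<le> 1"
    have "(1 - t) *s q + t *s b \<in> vec_box l u"
      unfolding vec_box_def
    proof (intro CollectI allI)
      fix i
      have lu: "l $ i \<le> q $ i" "q $ i \<le> u $ i" "l $ i \<le> b $ i" "b $ i \<le> u $ i"
        using b q by (auto simp: vec_box_def)
      have "(1 - t) * l $ i + t * l $ i \<le> (1 - t) * q $ i + t * b $ i"
        "(1 - t) * q $ i + t * b $ i \<le> (1 - t) * u $ i + t * u $ i"
        using lu t by (intro add_mono mult_left_mono; simp)+
      then show "l $ i \<le> ((1 - t) *s q + t *s b) $ i \<and> ((1 - t) *s q + t *s b) $ i \<le> u $ i"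
        by (simp add: algebra_simps)
    qed
    then have "sq_dist p q \<le> sq_dist p ((1 - t) *s q + t *s b)" using min p by blast
    then show "(\<Sum>i\<in>UNIV. (w $ i)\<^sup>2) \<le> (\<Sum>i\<in>UNIV. (w $ i + t * (q $ i - b $ i))\<^sup>2)"
      by (simp add: sq_dist_def w_def algebra_simps)
  qed
  have "x \<in> halfspace a0 w" if "x \<in> X" for x
    using conv[OF that] by (simp add: halfspace_def a0_def right_diff_distrib sum_subtractf)
  moreover have "a0 + (\<Sum>i\<in>UNIV. w $ i * b $ i) < 0" if "b \<in> vec_box l u" for b
  proof -
    have "0 < (\<Sum>i\<in>UNIV. w $ i * w $ i)"
    proof -
      obtain i where "w $ i \<noteq> 0" using w by (auto simp: vec_eq_iff)
      then have "0 < w $ i * w $ i" by (auto simp: zero_less_mult_iff neq_iff)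
      also have "\<dots> \<le> (\<Sum>i\<in>UNIV. w $ i * w $ i)" by (rule member_le_sum) auto
      finally show ?thesis .
    qed
    moreover have "(\<Sum>i\<in>UNIV. w $ i * w $ i) = (\<Sum>i\<in>UNIV. w $ i * p $ i) - (\<Sum>i\<in>UNIV. w $ i * q $ i)"
      by (simp add: w_def right_diff_distrib sum_subtractf)
    ultimately show ?thesis using box_conv[OF that]
      by (simp add: a0_def right_diff_distrib sum_subtractf)
  qed
  ultimately show ?thesis using w by blast
qed

section \<open>Lifts of signed tropical vectors\<close>

lemma pmonom_pos: "0 < c \<Longrightarrow> 0 < pmonom c g"
  using order_le_pos_iff[of "pmonom c g" g] by (simp add: order_le_pmonom pcoeff_monom)

text \<open>Unlike the function \<open>sval\<close>, this relation is compatible with sums and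
  products. A signed number prescribes leading exponent and sign; a balanced one only bounds the
  exponents, since leading terms may have cancelled.\<close>

definition lifts :: "puiseux \<Rightarrow> symtrop \<Rightarrow> bool" where
  "lifts z s \<longleftrightarrow> (case s of TZero \<Rightarrow> z = 0 | TNum \<sigma> r \<Rightarrow> order_le z r \<and>
     (\<sigma> = Pl \<longrightarrow> 0 < pcoeff z r) \<and> (\<sigma> = Mi \<longrightarrow> pcoeff z r < 0))"

lemma lifts_simps [simp]:
  "lifts z TZero \<longleftrightarrow> z = 0"
  "lifts z (TNum \<sigma> r) \<longleftrightarrow> order_le z r \<and> (\<sigma> = Pl \<longrightarrow> 0 < pcoeff z r) \<and> (\<sigma> = Mi \<longrightarrow> pcoeff z r < 0)"
  by (simp_all add: lifts_def)

lemma lifts_0: "lifts 0 0" by (simp add: zero_symtrop_def)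

lemma lifts_add:
  assumes "lifts z s" "lifts w t"
  shows "lifts (z + w) (s + t)"
proof (cases s)
  case TZero
  then show ?thesis using assms by simp
next
  case s: (TNum \<sigma> r)
  show ?thesis
  proof (cases t)
    case TZero
    then show ?thesis using assms s by simp
  next
    case t: (TNum \<tau> q)
    consider "q < r" | "r < q" | "r = q" by linarith
    then show ?thesis
    proof cases
      case 1
      then have "pcoeff w r = 0" "order_le w r" using assms(2) t by (auto simp: order_le_def)
      then show ?thesis using assms 1 by (auto simp: s t order_le_add)
    next
      case 2
      then have "pcoeff z q = 0" "order_le z q" using assms(1) s by (auto simp: order_le_def)
      then show ?thesis using assms 2 by (auto simp: s t order_le_add)
    next
      case 3
      then show ?thesis using assms by (auto simp: s t order_le_add)
    qed
  qed
qed

lemma lifts_mult: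
  assumes "lifts z s" "lifts w t"
  shows "lifts (z * w) (s * t)"
proof (cases s)
  case TZero
  then show ?thesis using assms by simp
next
  case s: (TNum \<sigma> r)
  show ?thesis
  proof (cases t)
    case TZero
    then show ?thesis using assms s by simp
  next
    case t: (TNum \<tau> q)
    have "order_le z r" "order_le w q" using assms s t by auto
    then have "order_le (z * w) (r + q)" "pcoeff (z * w) (r + q) = pcoeff z r * pcoeff w q"
      by (simp_all add: order_le_mult pcoeff_mult_top)
    then show ?thesis using assms
      by (cases \<sigma>; cases \<tau>) (auto simp: s t mult_pos_pos mult_neg_neg mult_pos_neg mult_neg_pos)
  qed
qed

lemma lifts_sum: "(\<And>i. i \<in> I \<Longrightarrow> lifts (z i) (s i)) \<Longrightarrow> lifts (\<Sum>i\<in>I. z i) (\<Sum>i\<in>I. s i)"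
  by (induction I rule: infinite_finite_induct) (auto simp: lifts_0 intro: lifts_add)

lemma lifts_sval: "lifts z (sval z)"
proof -
  consider "z = 0" | "0 < z" | "z < 0" by fastforce
  then show ?thesis
  proof cases
    case 2
    then have "0 < plead_coeff z" by (simp only: puiseux_pos_iff)
    then show ?thesis using 2 order_le_lead_exp by (auto simp: sval_def plead_coeff_def)
  next
    case 3
    then have "plead_coeff z < 0" by (simp only: puiseux_neg_iff)
    then show ?thesis using 3 order_le_lead_exp by (auto simp: sval_def plead_coeff_def)
  qed (simp add: sval_def lifts_0)
qed

lemma lifts_Mi_neg: "lifts z (TNum Mi r) \<Longrightarrow> z < 0"
  using order_le_pos_iff[of z r] by (auto simp: neq_iff[of z 0, symmetric] not_less le_less)

lemma tpositive_or_tbalanced_iff: "s \<in> tpositive \<union> tbalanced \<longleftrightarrow> (\<forall>r. s \<noteq> TNum Mi r)"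
proof (cases s)
  case (TNum \<sigma> r)
  then show ?thesis
    by (cases \<sigma>) (auto simp: tpositive_def tbalanced_def zero_symtrop_def)
qed (auto simp: tbalanced_def zero_symtrop_def)

lemma tsigned_iff: "s \<in> tsigned \<longleftrightarrow> (\<forall>r. s \<noteq> TNum Ba r)"
proof (cases s)
  case (TNum \<sigma> r)
  then show ?thesis
    by (cases \<sigma>) (auto simp: tsigned_def tpositive_def tnegative_def zero_symtrop_def)
qed (auto simp: tsigned_def zero_symtrop_def)

lemma sval_tsigned: "sval x \<in> tsigned"
  by (simp add: tsigned_iff sval_def zero_symtrop_def)

lemma sval_vec_tsigned: "sval_vec x \<in> tsigned_vec"
  by (simp add: tsigned_vec_def sval_vec_def sval_tsigned)

lemma sval_eq_0_iff: "sval x = 0 \<longleftrightarrow> x = 0"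
  by (simp add: sval_def zero_symtrop_def)

text \<open>The value of the affine function lifts the tropical value, and a lift of a negative
  number is negative.\<close>

lemma sval_vec_image_halfspace:
  fixes a :: "puiseux ^ 'd::finite"
  assumes "X \<subseteq> halfspace a0 a"
  shows "sval_vec ` X \<subseteq> trop_halfspace (sval a0) (sval_vec a)"
proof (rule image_subsetI)
  fix x assume "x \<in> X"
  then have nonneg: "0 \<le> a0 + (\<Sum>i\<in>UNIV. a $ i * x $ i)"
    using assms by (auto simp: halfspace_def)
  have "lifts (a0 + (\<Sum>i\<in>UNIV. a $ i * x $ i)) (sval a0 + (\<Sum>i\<in>UNIV. sval_vec a $ i * sval_vec x $ i))"
    unfolding sval_vec_def by (simp add: lifts_add lifts_sum lifts_mult lifts_sval)
  then show "sval_vec x \<in> trop_halfspace (sval a0) (sval_vec a)"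
    using nonneg lifts_Mi_neg unfolding trop_halfspace_def tpositive_or_tbalanced_iff
    by (auto simp: sval_vec_tsigned not_le[symmetric])
qed

section \<open>Detecting tropical nonnegativity through lifts\<close>

definition norm_le :: "symtrop \<Rightarrow> real \<Rightarrow> bool" where
  "norm_le s r \<longleftrightarrow> (\<forall>\<sigma> q. s = TNum \<sigma> q \<longrightarrow> q \<le> r)"

lemma norm_le_add: "norm_le (s + t) r \<longleftrightarrow> norm_le s r \<and> norm_le t r"
  by (cases s; cases t) (auto simp: norm_le_def)

lemma norm_le_sum: "finite I \<Longrightarrow> norm_le (\<Sum>i\<in>I. s i) r \<longleftrightarrow> (\<forall>i\<in>I. norm_le (s i) r)"
  by (induction I rule: finite_induct) (auto simp: norm_le_add, auto simp: norm_le_def zero_symtrop_def)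

text \<open>Negative numbers alone never add up to a positive or balanced one, so some summand of
  full norm is not negative.\<close>

lemma add_not_Mi:
  assumes "s + t = TNum \<sigma> r" "\<sigma> \<noteq> Mi"
  shows "(\<exists>\<tau>. \<tau> \<noteq> Mi \<and> s = TNum \<tau> r) \<or> (\<exists>\<tau>. \<tau> \<noteq> Mi \<and> t = TNum \<tau> r)"
  using assms by (cases s; cases t) (auto split: if_splits)

lemma sum_not_Mi:
  assumes "finite I" "(\<Sum>i\<in>I. s i) = TNum \<sigma> r" "\<sigma> \<noteq> Mi"
  shows "\<exists>i\<in>I. \<exists>\<tau>. \<tau> \<noteq> Mi \<and> s i = TNum \<tau> r"
  using assms
proof (induction I arbitrary: \<sigma> rule: finite_induct)
  case (insert i I)
  then show ?case using add_not_Mi[of "s i" "\<Sum>i\<in>I. s i" \<sigma> r] by auto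
qed (simp add: zero_symtrop_def)

definition unit_lift :: "symtrop \<Rightarrow> puiseux" where
  "unit_lift s = (case s of TZero \<Rightarrow> 0 | TNum \<sigma> r \<Rightarrow> pmonom (if \<sigma> = Pl then 1 else - 1) r)"

lemma lifts_unit_lift: "s \<in> tsigned \<Longrightarrow> lifts (unit_lift s) s"
  by (cases s) (auto simp: unit_lift_def tsigned_iff order_le_pmonom pcoeff_monom)

lemma tsigned_mult: "s \<in> tsigned \<Longrightarrow> t \<in> tsigned \<Longrightarrow> s * t \<in> tsigned"
proof (cases s; cases t)
  fix \<sigma> r \<tau> q
  assume "s \<in> tsigned" "t \<in> tsigned" "s = TNum \<sigma> r" "t = TNum \<tau> q"
  then show "s * t \<in> tsigned" by (cases \<sigma>; cases \<tau>) (auto simp: tsigned_iff)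
qed (auto simp: tsigned_iff)

text \<open>If \<open>y\<close> lies in the tropical halfspace then some lift of \<open>y\<close> lies in the halfspace: scale up the
  coordinates that contribute positive terms and scale down the others.\<close>

lemma not_in_trop_halfspace:
  fixes a :: "puiseux ^ 'd::finite"
  assumes y: "y \<in> tsigned_vec"
    and neg: "\<And>c. (\<And>i. 0 < c i) \<Longrightarrow> a0 + (\<Sum>i\<in>UNIV. a $ i * (pmonom (c i) 0 * unit_lift (y $ i))) < 0"
  shows "y \<notin> trop_halfspace (sval a0) (sval_vec a)"
proof
  assume "y \<in> trop_halfspace (sval a0) (sval_vec a)"
  define s where "s = sval a0 + (\<Sum>i\<in>UNIV. sval (a $ i) * y $ i)"
  have s: "\<And>r. s \<noteq> TNum Mi r"
    using \<open>y \<in> trop_halfspace (sval a0) (sval_vec a)\<close>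
    unfolding trop_halfspace_def tpositive_or_tbalanced_iff by (auto simp: s_def sval_vec_def)
  define z where "z i = a $ i * unit_lift (y $ i)" for i
  have ys: "y $ i \<in> tsigned" for i using y by (simp add: tsigned_vec_def)
  have z: "lifts (z i) (sval (a $ i) * y $ i)" for i
    unfolding z_def by (intro lifts_mult lifts_sval lifts_unit_lift ys)
  have neg': "a0 + (\<Sum>i\<in>UNIV. pmonom (c i) 0 * z i) < 0" if "\<And>i. 0 < c i" for c
    using neg[OF that] by (simp add: z_def mult.left_commute)
  show False
  proof (cases s)
    case TZero
    have "lifts (a0 + (\<Sum>i\<in>UNIV. z i)) s" unfolding s_def by (intro lifts_add lifts_sum lifts_sval z)
    then have "a0 + (\<Sum>i\<in>UNIV. z i) = 0" using TZero by simp
    then show False using neg'[of "\<lambda>_. 1"] by (simp add: pmonom_1_0)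
  next
    case (TNum \<sigma> r)
    then have \<sigma>: "\<sigma> \<noteq> Mi" using s by auto
    have "norm_le s r" using TNum by (simp add: norm_le_def)
    then have nb: "norm_le (sval a0) r" "\<And>i. norm_le (sval (a $ i) * y $ i) r"
      by (auto simp: s_def norm_le_add norm_le_sum)
    have ord: "order_le w r" if "lifts w t" "norm_le t r" for w t
      using that by (cases t) (auto simp: norm_le_def intro: order_le_mono)
    have a0: "order_le a0 r" using ord[OF lifts_sval nb(1)] .
    have zo: "order_le (z i) r" for i using ord[OF z nb(2)] .
    define A where "A = pcoeff a0 r"
    define k where "k i = pcoeff (z i) r" for i
    have "0 < A \<or> (\<exists>i. 0 < k i)"
    proof -
      \<comment> \<open>The single terms are signed, so a term that is not negative is positive. A
        balanced value can only arise in the sum.\<close>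
      have pl: "\<tau> = Pl" if "TNum \<tau> r \<in> tsigned" "\<tau> \<noteq> Mi" for \<tau>
        using that by (cases \<tau>) (auto simp: tsigned_iff)
      consider \<tau> where "\<tau> \<noteq> Mi" "sval a0 = TNum \<tau> r"
        | i \<tau> where "\<tau> \<noteq> Mi" "sval (a $ i) * y $ i = TNum \<tau> r"
        using add_not_Mi[OF TNum[unfolded s_def] \<sigma>]
          sum_not_Mi[of UNIV "\<lambda>i. sval (a $ i) * y $ i" _ r] by auto
      then show ?thesis
      proof cases
        case 1
        then have "sval a0 = TNum Pl r" using pl sval_tsigned by metis
        then show ?thesis using lifts_sval[of a0] by (simp add: A_def)
      next
        case 2
        then have "sval (a $ i) * y $ i = TNum Pl r" using pl tsigned_mult[OF sval_tsigned ys] by metis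
        then show ?thesis using z[of i] by (auto simp: k_def)
      qed
    qed
    define p q where "p = (\<Sum>i\<in>UNIV. max (k i) 0)" and "q = (\<Sum>i\<in>UNIV. max (- k i) 0)"
    have pq: "0 \<le> p" "0 \<le> q" by (simp_all add: p_def q_def sum_nonneg)
    have "0 < A \<or> 0 < p"
    proof (cases "0 < A")
      case False
      then obtain i where i: "0 < k i" using \<open>0 < A \<or> (\<exists>i. 0 < k i)\<close> by blast
      also have "k i \<le> max (k i) 0" by simp
      also have "\<dots> \<le> p" unfolding p_def by (rule member_le_sum) auto
      finally show ?thesis by simp
    qed simp
    \<comment> \<open>All terms have order at most \<open>r\<close>, so only the coefficients at
      \<open>r\<close> count. Positive ones get weight \<open>M\<close> and the others
      \<open>1 / M\<close>; the constant \<open>A\<close> cannot be scaled. A large \<open>M\<close>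
      makes \<open>q / M\<close> negligible if \<open>A\<close> is positive, and lets
      \<open>M * p\<close> outweigh the rest if \<open>p\<close> is.\<close>
    then obtain M where M: "1 \<le> M" "0 < A + M * p - q / M"
    proof
      assume A: "0 < A"
      define M where "M = 1 + q / A"
      have M1: "1 \<le> M" "q / A < M" using A pq by (auto simp: M_def)
      then have "q < A * M" using A by (simp add: pos_divide_less_eq mult.commute)
      then have "q / M < A" using M1 by (simp add: pos_divide_less_eq)
      moreover have "0 \<le> M * p" using M1 pq by simp
      ultimately show thesis using that[OF M1(1)] by linarith
    next
      assume p: "0 < p"
      define M where "M = 1 + (\<bar>A\<bar> + q) / p"
      have M1: "1 \<le> M" using p pq by (simp add: M_def)
      have "M * p = p + (\<bar>A\<bar> + q)" using p by (simp add: M_def field_simps)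
      moreover have "q / M \<le> q / 1" using M1 pq by (intro divide_left_mono) auto
      ultimately show thesis using that[OF M1] p by linarith
    qed
    define c where "c i = (if 0 < k i then M else 1 / M)" for i
    have c: "0 < c i" for i using M by (simp add: c_def)
    have ck: "c i * k i = M * max (k i) 0 - max (- k i) 0 / M" for i by (simp add: c_def max_def)
    have zc: "order_le (pmonom (c i) 0 * z i) r" for i
      using order_le_monom_mult[OF zo, of "c i" 0 i] by simp
    have "order_le (a0 + (\<Sum>i\<in>UNIV. pmonom (c i) 0 * z i)) r"
      by (intro order_le_add order_le_sum a0 zc)
    moreover have "pcoeff (a0 + (\<Sum>i\<in>UNIV. pmonom (c i) 0 * z i)) r = A + M * p - q / M"
      by (simp add: pcoeff_sum pcoeff_monom_mult A_def k_def[symmetric] ck p_def q_def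
          sum_subtractf sum_distrib_left sum_divide_distrib)
    ultimately have "0 < a0 + (\<Sum>i\<in>UNIV. pmonom (c i) 0 * z i)"
      using order_le_pos_iff M by simp
    then show False using neg'[of c] c by simp
  qed
qed

text \<open>For nonzero coordinates the ratio to \<open>unit_lift\<close> lies between
  \<open>1 / N\<close> and \<open>N\<close>, written without division so that the condition is
  polynomial in \<open>N\<close> as well. Where \<open>unit_lift\<close> is 0 the two inequalities
  are vacuous, hence the last clause.\<close>

definition scaled_box :: "symtrop ^ 'd \<Rightarrow> puiseux \<Rightarrow> (puiseux ^ 'd) set" where
  "scaled_box y N = {x. \<forall>i. \<bar>unit_lift (y $ i)\<bar> \<le> N * (sgn (unit_lift (y $ i)) * x $ i) \<and>
     sgn (unit_lift (y $ i)) * x $ i \<le> N * \<bar>unit_lift (y $ i)\<bar> \<and> (y $ i = 0 \<longrightarrow> x $ i = 0)}"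

lemma unit_lift_cases:
  assumes "s \<in> tsigned"
  obtains "s = 0" "unit_lift s = 0"
  | r where "s = TNum Pl r" "unit_lift s = pmonom 1 r" "0 < unit_lift s"
  | r where "s = TNum Mi r" "unit_lift s = - pmonom 1 r" "unit_lift s < 0"
proof (cases s)
  case TZero
  then show ?thesis using that(1) by (simp add: zero_symtrop_def unit_lift_def)
next
  case (TNum \<sigma> r)
  have "0 < pmonom 1 r" by (simp add: pmonom_pos)
  moreover have "pmonom (- 1) r = - pmonom 1 r" by (rule puiseux_eqI) (simp add: pcoeff_monom)
  ultimately show ?thesis using that(2,3)[of r] TNum assms
    by (cases \<sigma>) (auto simp: unit_lift_def tsigned_iff)
qed

lemma sval_of_bounds:
  assumes "pmonom 1 r \<le> pmonom n 0 * z" "z \<le> pmonom n 0 * pmonom 1 r" "0 < n"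
  shows "0 < z" "lead_exp z = r"
proof -
  have "0 < pmonom n 0 * z" using pmonom_pos[of 1 r] assms(1) by simp
  then show z: "0 < z" using pmonom_pos[OF assms(3), of 0] by (simp add: zero_less_mult_iff)
  have "order_le z r"
    by (rule order_le_antimono[OF _ assms(2)]) (use z in \<open>auto simp: pmonom_mult_monom order_le_pmonom\<close>)
  moreover have "order_le (pmonom n 0 * z) r" using order_le_monom_mult[OF \<open>order_le z r\<close>, of n 0] by simp
  then have "1 \<le> n * pcoeff z r"
    using pcoeff_mono[OF _ _ assms(1), of r] by (simp add: order_le_pmonom pcoeff_monom pcoeff_monom_mult)
  then have "pcoeff z r \<noteq> 0" by auto
  ultimately show "lead_exp z = r" by (rule lead_exp_eq)
qed

text \<open>A factor bounded above and below by positive reals changes neither the sign nor the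
  leading exponent.\<close>

lemma sval_vec_scaled_box:
  fixes x :: "puiseux ^ 'd::finite"
  assumes y: "y \<in> tsigned_vec" and x: "x \<in> scaled_box y (pmonom n 0)" and n: "0 < n"
  shows "sval_vec x = y"
  unfolding vec_eq_iff
proof
  fix i
  have "y $ i \<in> tsigned" using y by (simp add: tsigned_vec_def)
  moreover have bnd: "\<bar>unit_lift (y $ i)\<bar> \<le> pmonom n 0 * (sgn (unit_lift (y $ i)) * x $ i)"
    "sgn (unit_lift (y $ i)) * x $ i \<le> pmonom n 0 * \<bar>unit_lift (y $ i)\<bar>" "y $ i = 0 \<longrightarrow> x $ i = 0"
    using x by (auto simp: scaled_box_def)
  ultimately have "sval (x $ i) = y $ i"
  proof (cases rule: unit_lift_cases)
    case 1
    then show ?thesis using bnd by (simp add: sval_eq_0_iff)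
  next
    case (2 r)
    then have "pmonom 1 r \<le> pmonom n 0 * x $ i" "x $ i \<le> pmonom n 0 * pmonom 1 r"
      using bnd by (simp_all add: 2(2)[symmetric])
    from sval_of_bounds[OF this n] show ?thesis using 2 by (simp add: sval_def)
  next
    case (3 r)
    then have "pmonom 1 r \<le> pmonom n 0 * (- x $ i)" "- x $ i \<le> pmonom n 0 * pmonom 1 r"
      using bnd by (simp_all add: abs_if)
    from sval_of_bounds[OF this n] have "x $ i < 0" "lead_exp (- x $ i) = r" by simp_all
    then show ?thesis using 3 by (simp add: sval_def lead_exp_def)
  qed
  then show "sval_vec x $ i = y $ i" by (simp add: sval_vec_def)
qed

text \<open>Every positive real weight fits, because \<open>N\<close> exceeds both the weight and
  its reciprocal.\<close>

lemma lift_in_scaled_box: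
  fixes y :: "symtrop ^ 'd::finite"
  assumes y: "y \<in> tsigned_vec" and N: "\<And>n. 0 < n \<Longrightarrow> pmonom n 0 \<le> N" and c: "\<And>i. 0 < c i"
  shows "(\<chi> i. pmonom (c i) 0 * unit_lift (y $ i)) \<in> scaled_box y N"
proof -
  have "\<bar>unit_lift (y $ i)\<bar> \<le> N * (sgn (unit_lift (y $ i)) * (pmonom (c i) 0 * unit_lift (y $ i))) \<and>
     sgn (unit_lift (y $ i)) * (pmonom (c i) 0 * unit_lift (y $ i)) \<le> N * \<bar>unit_lift (y $ i)\<bar> \<and>
     (y $ i = 0 \<longrightarrow> pmonom (c i) 0 * unit_lift (y $ i) = 0)" for i
  proof -
    let ?u = "unit_lift (y $ i)" and ?c = "pmonom (c i) 0"
    have su: "sgn ?u * (?c * ?u) = ?c * \<bar>?u\<bar>" by (simp add: abs_sgn mult_ac)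
    have cpos: "0 < ?c" by (rule pmonom_pos) (rule c)
    have "pmonom (1 / c i) 0 * ?c = 1" using c[of i] by (simp add: pmonom_mult_monom pmonom_1_0)
    moreover have "pmonom (1 / c i) 0 * ?c \<le> N * ?c"
      using N[of "1 / c i"] c[of i] cpos by (intro mult_right_mono) auto
    ultimately have "1 * \<bar>?u\<bar> \<le> (N * ?c) * \<bar>?u\<bar>" by (intro mult_right_mono) auto
    moreover have "?c * \<bar>?u\<bar> \<le> N * \<bar>?u\<bar>" using N c by (intro mult_right_mono) auto
    moreover have "y $ i = 0 \<longrightarrow> ?u = 0" by (simp add: zero_symtrop_def unit_lift_def)
    ultimately show ?thesis unfolding su by (simp add: mult.assoc)
  qed
  then show ?thesis by (simp add: scaled_box_def)
qed

lemma scaled_box_mono: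
  assumes "0 < N" "N \<le> N'" "x \<in> scaled_box y N"
  shows "x \<in> scaled_box y N'"
proof -
  have "\<bar>u\<bar> \<le> N' * z \<and> z \<le> N' * \<bar>u\<bar>" if "\<bar>u\<bar> \<le> N * z" "z \<le> N * \<bar>u\<bar>" for u z
  proof -
    have "0 \<le> N * z" using that(1) abs_ge_zero order_trans by blast
    then have "0 \<le> z" using assms(1) by (simp add: zero_le_mult_iff)
    then have "N * z \<le> N' * z" "N * \<bar>u\<bar> \<le> N' * \<bar>u\<bar>" using assms(2) by (simp_all add: mult_right_mono)
    then show ?thesis using that by (meson order_trans)
  qed
  then show ?thesis using assms(3) unfolding scaled_box_def by blast
qed

lemma scaled_box_eq_vec_box:
  fixes y :: "symtrop ^ 'd::finite"
  assumes y: "y \<in> tsigned_vec" and N: "0 < N"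
  shows "\<exists>l u. scaled_box y N = vec_box l u"
proof -
  define B where "B i x \<longleftrightarrow> \<bar>unit_lift (y $ i)\<bar> \<le> N * (sgn (unit_lift (y $ i)) * x) \<and>
     sgn (unit_lift (y $ i)) * x \<le> N * \<bar>unit_lift (y $ i)\<bar> \<and> (y $ i = 0 \<longrightarrow> x = 0)" for i x
  have ex: "\<exists>l u. \<forall>x. B i x \<longleftrightarrow> l \<le> x \<and> x \<le> u" for i
  proof -
    let ?u = "unit_lift (y $ i)"
    have "y $ i \<in> tsigned" using y by (simp add: tsigned_vec_def)
    then show ?thesis
    proof (cases rule: unit_lift_cases)
      case 1
      then show ?thesis by (intro exI[of _ 0]) (auto simp: B_def)
    next
      case (2 r)
      then show ?thesis using N
        by (intro exI[of _ "?u / N"] exI[of _ "N * ?u"])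
          (auto simp: B_def pos_divide_le_eq mult.commute zero_symtrop_def)
    next
      case (3 r)
      have bounds: "- ?u \<le> N * (- x) \<longleftrightarrow> x \<le> ?u / N" "- x \<le> N * (- ?u) \<longleftrightarrow> N * ?u \<le> x" for x
        using N by (auto simp: pos_le_divide_eq mult.commute)
      have u: "\<bar>?u\<bar> = - ?u" "sgn ?u = - 1" using 3(3) by simp_all
      have "y $ i \<noteq> 0" using 3(1) by (simp add: zero_symtrop_def)
      then have "B i x \<longleftrightarrow> N * ?u \<le> x \<and> x \<le> ?u / N" for x
        unfolding B_def u mult_minus1 bounds by blast
      then show ?thesis by blast
    qed
  qed
  have "\<forall>i. \<exists>l. \<exists>u. \<forall>x. B i x \<longleftrightarrow> l \<le> x \<and> x \<le> u" using ex by blast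
  then obtain l where "\<forall>i. \<exists>u. \<forall>x. B i x \<longleftrightarrow> l i \<le> x \<and> x \<le> u" by (rule choice[THEN exE])
  then obtain u where "\<forall>i. \<forall>x. B i x \<longleftrightarrow> l i \<le> x \<and> x \<le> u i" by (rule choice[THEN exE])
  then have "scaled_box y N = vec_box (\<chi> i. l i) (\<chi> i. u i)"
    unfolding scaled_box_def vec_box_def B_def[symmetric] by simp
  then show ?thesis by blast
qed

text \<open>Overspill: a definable up-closed set of scales without real elements has an infimum, and half of it
  is an infinitely large scale outside of the set.\<close>

lemma infinite_scale_exists:
  fixes X :: "(puiseux ^ 'd::finite) set"
  assumes X: "semialgebraic X" and y: "y \<in> tsigned_vec" "y \<notin> sval_vec ` X"
  shows "\<exists>N. (\<forall>n>0. pmonom n 0 \<le> N) \<and> X \<inter> scaled_box y N = {}"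
proof -
  have real: "pmonom n 0 < N" if n: "0 < n" and N: "0 < N" "X \<inter> scaled_box y N \<noteq> {}" for n N
  proof (rule ccontr)
    assume "\<not> ?thesis"
    then have "N \<le> pmonom n 0" by simp
    then obtain x where "x \<in> X" "x \<in> scaled_box y (pmonom n 0)"
      using N scaled_box_mono[OF N(1)] by blast
    then show False using sval_vec_scaled_box[OF y(1) _ n] y(2) by blast
  qed
  show ?thesis
  proof (cases "\<exists>N>0. X \<inter> scaled_box y N \<noteq> {}")
    case False
    \<comment> \<open>If no box of positive scale meets \<open>X\<close>, any infinite scale will
      do, for instance \<open>t\<close> itself.\<close>
    have "pmonom n 0 \<le> pmonom 1 1" for n
    proof -
      have "order_le (pmonom 1 1 - pmonom n 0) 1" "pcoeff (pmonom 1 1 - pmonom n 0) 1 = 1"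
        by (auto simp: order_le_def pcoeff_monom)
      then have "0 < pmonom 1 1 - pmonom n 0" using order_le_pos_iff by force
      then show ?thesis by simp
    qed
    then show ?thesis using False pmonom_pos[of 1 1] by auto
  next
    case True
    \<comment> \<open>The variable \<open>None\<close> holds the negated scale, which turns the
      infimum of the scales into a supremum. The equation for zero coordinates is split into two
      inequalities to fit the available atoms.\<close>
    define W :: "('d option \<Rightarrow> puiseux) \<Rightarrow> bool" where
      "W f \<longleftrightarrow> 0 < - f None \<and> (\<chi> i. f (Some i)) \<in> X \<and>
        (\<forall>i\<in>UNIV. \<bar>unit_lift (y $ i)\<bar> \<le> - f None * (sgn (unit_lift (y $ i)) * f (Some i)) \<and>
          sgn (unit_lift (y $ i)) * f (Some i) \<le> - f None * \<bar>unit_lift (y $ i)\<bar>) \<and>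
        (\<forall>i\<in>{i. y $ i = 0}. f (Some i) \<le> 0 \<and> 0 \<le> f (Some i))" for f
    have "definable W"
      unfolding W_def[abs_def]
      by (intro definable_conj definable_ball definable_semialgebraic X definable_less definable_le polyfun_intros) simp_all
    from definable_ex_set[OF _ this, of "range Some"]
    have D: "definable (\<lambda>f. \<exists>x. W (override_on f x (range Some)))" by simp
    have W_iff: "(\<exists>x. W (override_on ((\<lambda>_. 0)(None := t)) x (range Some))) \<longleftrightarrow>
        0 < - t \<and> X \<inter> scaled_box y (- t) \<noteq> {}" for t
    proof
      assume "\<exists>x. W (override_on ((\<lambda>_. 0)(None := t)) x (range Some))"
      then obtain x where x: "W (override_on ((\<lambda>_. 0)(None := t)) x (range Some))" by blast
      then have "(\<chi> i. x (Some i)) \<in> X \<inter> scaled_box y (- t)" "0 < - t"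
        by (auto simp: W_def override_on_def scaled_box_def)
      then show "0 < - t \<and> X \<inter> scaled_box y (- t) \<noteq> {}" by blast
    next
      assume t: "0 < - t \<and> X \<inter> scaled_box y (- t) \<noteq> {}"
      then obtain x where x: "x \<in> X" "x \<in> scaled_box y (- t)" by blast
      have "W (override_on ((\<lambda>_. 0)(None := t)) (case_option 0 (($) x)) (range Some))"
        using t x by (auto simp: W_def override_on_def scaled_box_def)
      then show "\<exists>x. W (override_on ((\<lambda>_. 0)(None := t)) x (range Some))" by blast
    qed
    obtain N0 where N0: "0 < N0" "X \<inter> scaled_box y N0 \<noteq> {}" using True by blast
    have "\<exists>s. (\<forall>t. (\<exists>x. W (override_on ((\<lambda>_. 0)(None := t)) x (range Some))) \<longrightarrow> t \<le> s) \<and>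
      (\<forall>b. (\<forall>t. (\<exists>x. W (override_on ((\<lambda>_. 0)(None := t)) x (range Some))) \<longrightarrow> t \<le> b) \<longrightarrow> s \<le> b)"
    proof (rule definable_complete[OF D])
      show "\<exists>x. W (override_on ((\<lambda>_. 0)(None := - N0)) x (range Some))" unfolding W_iff using N0 by simp
      show "t \<le> 0" if "\<exists>x. W (override_on ((\<lambda>_. 0)(None := t)) x (range Some))" for t
        using that unfolding W_iff by simp
    qed
    then obtain s where s: "\<And>t. 0 < - t \<Longrightarrow> X \<inter> scaled_box y (- t) \<noteq> {} \<Longrightarrow> t \<le> s"
      "\<And>b. (\<And>t. 0 < - t \<Longrightarrow> X \<inter> scaled_box y (- t) \<noteq> {} \<Longrightarrow> t \<le> b) \<Longrightarrow> s \<le> b"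
      unfolding W_iff by metis
    have s_inf: "pmonom n 0 \<le> - s" if n: "0 < n" for n
    proof -
      have "s \<le> - pmonom n 0"
      proof (rule s(2))
        fix t assume "0 < - t" "X \<inter> scaled_box y (- t) \<noteq> {}"
        from real[OF n this] show "t \<le> - pmonom n 0" by simp
      qed
      then show ?thesis by simp
    qed
    have "0 < - s" using s_inf[of 1] pmonom_pos[of 1 0] by simp
    \<comment> \<open>The infimum \<open>- s\<close> may itself belong to the set of scales; half of
      it lies strictly below, and it still exceeds every real \<open>n\<close>, because
      \<open>- s\<close> exceeds \<open>2 * n\<close>.\<close>
    define N where "N = - s / 2"
    have "N < - s" "0 < N" using \<open>0 < - s\<close> by (simp_all add: N_def)
    have "X \<inter> scaled_box y N = {}"
    proof (rule ccontr)
      assume "X \<inter> scaled_box y N \<noteq> {}"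
      then have "- N \<le> s" using s(1)[of "- N"] \<open>0 < N\<close> by simp
      then show False using \<open>N < - s\<close> by simp
    qed
    moreover have "pmonom n 0 \<le> N" if "0 < n" for n
    proof -
      have "pmonom (2 * n) 0 = pmonom n 0 + pmonom n 0"
        by (rule puiseux_eqI) (simp only: pcoeff_add pcoeff_monom, simp)
      then show ?thesis using s_inf[of "2 * n"] that by (simp add: N_def)
    qed
    ultimately show ?thesis by blast
  qed
qed

theorem theorem5p4:
  fixes X :: "(puiseux ^ 'd) set"
  assumes "X \<noteq> {}" and "closed X" and "field_convex X" and "semialgebraic X"
  shows "(\<forall>y \<in> tsigned_vec. y \<notin> sval_vec ` X \<longrightarrow>
            (\<exists>a0 a. a \<noteq> 0 \<and> X \<subseteq> halfspace a0 a \<and> y \<notin> trop_halfspace (sval a0) (sval_vec a)))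
       \<and> sval_vec ` X = tsigned_vec \<inter> \<Inter> {H \<in> closed_trop_halfspaces. sval_vec ` X \<subseteq> H}"
proof -
  have sep: "\<exists>a0 a. a \<noteq> 0 \<and> X \<subseteq> halfspace a0 a \<and> y \<notin> trop_halfspace (sval a0) (sval_vec a)"
    if y: "y \<in> tsigned_vec" "y \<notin> sval_vec ` X" for y
  proof -
    obtain N where N: "\<And>n. 0 < n \<Longrightarrow> pmonom n 0 \<le> N" "X \<inter> scaled_box y N = {}"
      using infinite_scale_exists[OF assms(4) y] by blast
    have "0 < N" using N(1)[of 1] pmonom_1_0 by (metis less_le_trans zero_less_one)
    then obtain l u where lu: "scaled_box y N = vec_box l u"
      using scaled_box_eq_vec_box[OF y(1)] by blast
    have "scaled_box y N \<noteq> {}" using lift_in_scaled_box[OF y(1) N(1), of "\<lambda>_. 1"] by auto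
    then obtain a0 a where a: "a \<noteq> 0" "X \<subseteq> halfspace a0 a"
      "\<And>b. b \<in> scaled_box y N \<Longrightarrow> a0 + (\<Sum>i\<in>UNIV. a $ i * b $ i) < 0"
      using closed_convex_box_separation[OF assms(1,2,4,3), of l u] N(2) unfolding lu by blast
    have "y \<notin> trop_halfspace (sval a0) (sval_vec a)"
      by (rule not_in_trop_halfspace[OF y(1)]) (use a(3)[OF lift_in_scaled_box[OF y(1) N(1)]] in simp)
    then show ?thesis using a by blast
  qed
  have "y \<in> sval_vec ` X" if y: "y \<in> tsigned_vec" "\<And>H. H \<in> closed_trop_halfspaces \<Longrightarrow> sval_vec ` X \<subseteq> H \<Longrightarrow> y \<in> H" for y
  proof (rule ccontr)
    assume "y \<notin> sval_vec ` X"
    then obtain a0 a where a: "a \<noteq> 0" "X \<subseteq> halfspace a0 a" "y \<notin> trop_halfspace (sval a0) (sval_vec a)"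
      using sep y(1) by blast
    have "sval_vec a \<noteq> 0" using a(1) by (auto simp: vec_eq_iff sval_vec_def sval_eq_0_iff)
    then have "trop_halfspace (sval a0) (sval_vec a) \<in> closed_trop_halfspaces"
      unfolding closed_trop_halfspaces_def using sval_tsigned sval_vec_tsigned by blast
    then show False using y(2) sval_vec_image_halfspace[OF a(2)] a(3) by blast
  qed
  then have eq: "sval_vec ` X = tsigned_vec \<inter> \<Inter> {H \<in> closed_trop_halfspaces. sval_vec ` X \<subseteq> H}"
    using sval_vec_tsigned by blast
  show ?thesis by (intro conjI ballI impI sep eq)
qed

end
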